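(* There are absolute constants $b,c_3,c_4,c_5>0$ such that the following holds. Let $D\subset\mathbb R^d$ be compact, let $K\colon D\times D\to\mathbb C$ be a continuous Hermitian positive definite kernel with $\sup_{x\in D}\sqrt{K(x,x)}<\infty$ whose reproducing kernel Hilbert space $H(K)$ is infinite dimensional, and let $\varrho_D$ be any finite Borel measure on $D$ with full support. Let $(\sigma_k)_{k\ge1}$ be the non-increasing sequence of singular numbers of the embedding $H(K)\to L_2(D,\varrho_D)$. Then for all integers $m\ge2$ the sampling numbers $g_n(\mathrm{Id})=g_n(\mathrm{Id}\colon H(K)\to\ell_\infty(D))$ satisfy: (i) $$g_{\lfloor bm\log m\rfloor}(\mathrm{Id})^2\le c_3\max\Big\{\frac{N_{K,\varrho_D}(m)}{m}\sum_{k\ge\lfloor m/2\rfloor}\sigma_k^2,\ \sum_{k\ge\lfloor m/2\rfloor}\frac{N_{K,\varrho_D}(4k)\sigma_k^2}{k}\Big\};$$ (ii) $$g_m(\mathrm{Id})^2\le c_4\max\Big\{\frac{N_{K,\varrho_D}(m)\log m}{m}\sum_{k\ge\lfloor c_5m\rfloor}\sigma_k^2,\ \sum_{k\ge\lfloor c_5m\rfloor}\frac{N_{K,\varrho_D}(4k)\sigma_k^2}{k}\Big\}.$$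
   Context: $\log$ is the natural logarithm; $\|f\|_{\ell_\infty(D)}=\sup_{x\in D}|f(x)|$. All sums over $k$ run over positive integers $k$ in the indicated range. Sampling numbers: for a normed space $F$ of functions on $D$, $$g_n(\mathrm{Id}\colon H(K)\to F):=\inf_{x^1,\dots,x^n\in D}\ \inf_{R\in\mathcal L(\mathbb C^n,F)}\ \sup_{\|f\|_{H(K)}\le1}\|f-R(f(x^1),\dots,f(x^n))\|_F,$$ where $\mathcal L(\mathbb C^n,F)$ is the set of linear maps $\mathbb C^n\to F$. Spectral data: $\mathrm{Id}\colon H(K)\to L_2(D,\varrho_D)$ is compact. Let $\lambda_1\ge\lambda_2\ge\dots>0$ be the eigenvalues of $\mathrm{Id}^*\circ\mathrm{Id}\colon H(K)\to H(K)$, $\sigma_k=\sqrt{\lambda_k}$, $(e_k^* )_{k\ge1}$ a corresponding $H(K)$-orthonormal system of eigenfunctions, and $\eta_k:=\sigma_k^{-1}e_k^*$ (pointwise defined), which is orthonormal in $L_2(D,\varrho_D)$. The quantity $N_{K,\varrho_D}(m):=\sup_{x\in D}\sum_{k=1}^{m-1}|\eta_k(x)|^2$. *)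

theory Defs
  imports "HOL-Analysis.Analysis" "HOL-Library.Function_Algebras"
begin

text \<open>
  A function on \<open>D\<close> is represented by a total function that vanishes off \<open>D\<close>, so that
  equality of functions on \<open>D\<close> is equality in HOL and the pointwise operations of
  \<^theory>\<open>HOL-Library.Function_Algebras\<close> apply.

  Subsets of \<open>\<real>\<^sup>d\<close> with \<open>d\<close> a natural number are subsets of \<open>topspace (Euclidean_space d)\<close>, the
  sequences \<open>nat \<Rightarrow> real\<close> that vanish from index \<open>d\<close> on. The product topology of the type
  \<open>nat \<Rightarrow> real\<close> induces the usual topology of \<open>\<real>\<^sup>d\<close> on this set, so compactness, continuity and
  Borel sets can be taken in the type. With \<open>d\<close> a number instead of a type, constants can be
  required not to depend on the dimension.
\<close>

definition cscale :: "complex \<Rightarrow> ('a \<Rightarrow> complex) \<Rightarrow> ('a \<Rightarrow> complex)" where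
  "cscale c f = (\<lambda>x. c * f x)"

interpretation cfun: vector_space cscale
  by unfold_locales (auto simp: cscale_def algebra_simps)

definition infinite_dimensional :: "('a \<Rightarrow> complex) set \<Rightarrow> bool" where
  "infinite_dimensional H \<longleftrightarrow> \<not> (\<exists>B. finite B \<and> H \<subseteq> cfun.span B)"


subsection \<open>Kernels and reproducing kernel Hilbert spaces\<close>

text \<open>
  Positive definiteness is meant in the sense of Aronszajn: the quadratic forms are nonnegative,
  not necessarily strictly positive.
\<close>

definition hermitian_pos_def_kernel :: "'a set \<Rightarrow> ('a \<Rightarrow> 'a \<Rightarrow> complex) \<Rightarrow> bool" where
  "hermitian_pos_def_kernel D K \<longleftrightarrow>
     (\<forall>x\<in>D. \<forall>y\<in>D. K y x = cnj (K x y)) \<and>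
     (\<forall>(n::nat) (x :: nat \<Rightarrow> 'a) (c :: nat \<Rightarrow> complex). (\<forall>i<n. x i \<in> D) \<longrightarrow>
        0 \<le> Re (\<Sum>i<n. \<Sum>j<n. c i * cnj (c j) * K (x i) (x j)))"

definition ip_norm :: "(('a \<Rightarrow> complex) \<Rightarrow> ('a \<Rightarrow> complex) \<Rightarrow> complex) \<Rightarrow> ('a \<Rightarrow> complex) \<Rightarrow> real" where
  "ip_norm ip f = sqrt (Re (ip f f))"

definition hilbert_function_space ::
  "'a set \<Rightarrow> ('a \<Rightarrow> complex) set \<Rightarrow> (('a \<Rightarrow> complex) \<Rightarrow> ('a \<Rightarrow> complex) \<Rightarrow> complex) \<Rightarrow> bool" where
  "hilbert_function_space D H ip \<longleftrightarrow>
     cfun.subspace H \<and> (\<forall>f\<in>H. \<forall>x. x \<notin> D \<longrightarrow> f x = 0) \<and>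
     (\<forall>f\<in>H. \<forall>g\<in>H. \<forall>h\<in>H. ip (f + g) h = ip f h + ip g h) \<and>
     (\<forall>c. \<forall>f\<in>H. \<forall>g\<in>H. ip (cscale c f) g = c * ip f g) \<and>
     (\<forall>f\<in>H. \<forall>g\<in>H. ip g f = cnj (ip f g)) \<and>
     (\<forall>f\<in>H. 0 \<le> Re (ip f f)) \<and> (\<forall>f\<in>H. ip f f = 0 \<longrightarrow> f = 0) \<and>
     (\<forall>F :: nat \<Rightarrow> 'a \<Rightarrow> complex. (\<forall>n. F n \<in> H) \<longrightarrow>
        (\<forall>\<epsilon>>0. \<exists>M. \<forall>m\<ge>M. \<forall>n\<ge>M. ip_norm ip (F m - F n) < \<epsilon>) \<longrightarrow>
        (\<exists>f\<in>H. (\<lambda>n. ip_norm ip (F n - f)) \<longlonglongrightarrow> 0))"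

definition kernel_section :: "'a set \<Rightarrow> ('a \<Rightarrow> 'a \<Rightarrow> complex) \<Rightarrow> 'a \<Rightarrow> ('a \<Rightarrow> complex)" where
  "kernel_section D K x = (\<lambda>y. if y \<in> D then K y x else 0)"

text \<open>
  By the Moore--Aronszajn theorem, a Hermitian positive definite kernel \<open>K\<close> on \<open>D\<close> determines
  exactly one Hilbert space \<open>H\<close> (with \<open>ip\<close> unique on \<open>H\<close>) satisfying the following predicate.
\<close>

definition is_rkhs ::
  "'a set \<Rightarrow> ('a \<Rightarrow> 'a \<Rightarrow> complex) \<Rightarrow> ('a \<Rightarrow> complex) set \<Rightarrow>
   (('a \<Rightarrow> complex) \<Rightarrow> ('a \<Rightarrow> complex) \<Rightarrow> complex) \<Rightarrow> bool" where
  "is_rkhs D K H ip \<longleftrightarrow>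
     hilbert_function_space D H ip \<and>
     (\<forall>x\<in>D. kernel_section D K x \<in> H) \<and>
     (\<forall>f\<in>H. \<forall>x\<in>D. f x = ip f (kernel_section D K x))"


subsection \<open>Measures and the embedding into \<open>L\<^sub>2\<close>\<close>

definition finite_borel_measure_on :: "'a::topological_space set \<Rightarrow> 'a measure \<Rightarrow> bool" where
  "finite_borel_measure_on D \<rho> \<longleftrightarrow> finite_measure \<rho> \<and> sets \<rho> = sets (restrict_space borel D)"

definition full_support :: "'a::topological_space set \<Rightarrow> 'a measure \<Rightarrow> bool" where
  "full_support D \<rho> \<longleftrightarrow> (\<forall>U. open U \<longrightarrow> U \<inter> D \<noteq> {} \<longrightarrow> 0 < emeasure \<rho> (U \<inter> D))"

definition L2_inner :: "'a measure \<Rightarrow> ('a \<Rightarrow> complex) \<Rightarrow> ('a \<Rightarrow> complex) \<Rightarrow> complex" where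
  "L2_inner \<rho> f g = (LINT x|\<rho>. f x * cnj (g x))"

text \<open>
  The adjoint of the embedding \<open>H \<rightarrow> L\<^sub>2(\<rho>)\<close>, evaluated at the class of the square-integrable
  function \<open>g\<close>. For \<open>g \<in> H\<close> this is \<open>Id\<^sup>* (Id g)\<close>, since \<open>Id\<close> sends \<open>g\<close> to its own class.
\<close>

definition embedding_adjoint ::
  "('a \<Rightarrow> complex) set \<Rightarrow> (('a \<Rightarrow> complex) \<Rightarrow> ('a \<Rightarrow> complex) \<Rightarrow> complex) \<Rightarrow> 'a measure \<Rightarrow>
   ('a \<Rightarrow> complex) \<Rightarrow> ('a \<Rightarrow> complex)" where
  "embedding_adjoint H ip \<rho> g = (THE h. h \<in> H \<and> (\<forall>f\<in>H. L2_inner \<rho> f g = ip f h))"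

text \<open>
  \<open>lam 1 \<ge> lam 2 \<ge> \<dots> > 0\<close> lists the positive eigenvalues of \<open>Id\<^sup>* \<circ> Id\<close> and \<open>e 1, e 2, \<dots>\<close> are
  corresponding orthonormal eigenfunctions; the values at index 0 are irrelevant. The last clause
  says that every positive eigenvalue is listed with its full multiplicity.
\<close>

definition spectral_data ::
  "('a \<Rightarrow> complex) set \<Rightarrow> (('a \<Rightarrow> complex) \<Rightarrow> ('a \<Rightarrow> complex) \<Rightarrow> complex) \<Rightarrow> 'a measure \<Rightarrow>
   (nat \<Rightarrow> real) \<Rightarrow> (nat \<Rightarrow> 'a \<Rightarrow> complex) \<Rightarrow> bool" where
  "spectral_data H ip \<rho> lam e \<longleftrightarrow>
     (\<forall>k\<ge>1. 0 < lam k) \<and> (\<forall>j\<ge>1. \<forall>k\<ge>j. lam k \<le> lam j) \<and>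
     (\<forall>k\<ge>1. e k \<in> H) \<and> (\<forall>j\<ge>1. \<forall>k\<ge>1. ip (e j) (e k) = (if j = k then 1 else 0)) \<and>
     (\<forall>k\<ge>1. embedding_adjoint H ip \<rho> (e k) = cscale (of_real (lam k)) (e k)) \<and>
     (\<forall>\<nu>>0. \<forall>f\<in>H. embedding_adjoint H ip \<rho> f = cscale (of_real \<nu>) f \<longrightarrow>
        f \<in> cfun.span {e k | k. 1 \<le> k \<and> lam k = \<nu>})"

definition sing_num :: "(nat \<Rightarrow> real) \<Rightarrow> nat \<Rightarrow> real" where
  "sing_num lam k = sqrt (lam k)"

definition eta :: "(nat \<Rightarrow> real) \<Rightarrow> (nat \<Rightarrow> 'a \<Rightarrow> complex) \<Rightarrow> nat \<Rightarrow> 'a \<Rightarrow> complex" where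
  "eta lam e k = (\<lambda>x. e k x / of_real (sing_num lam k))"

definition N_fun ::
  "'a set \<Rightarrow> (nat \<Rightarrow> real) \<Rightarrow> (nat \<Rightarrow> 'a \<Rightarrow> complex) \<Rightarrow> nat \<Rightarrow> ennreal" where
  "N_fun D lam e m = (SUP x\<in>D. ennreal (\<Sum>k=1..<m. (cmod (eta lam e k x))\<^sup>2))"


subsection \<open>Sampling numbers\<close>

definition linf_norm :: "'a set \<Rightarrow> ('a \<Rightarrow> complex) \<Rightarrow> ennreal" where
  "linf_norm D f = (SUP x\<in>D. ennreal (cmod (f x)))"

definition linf_space :: "'a set \<Rightarrow> ('a \<Rightarrow> complex) set" where
  "linf_space D = {f. (\<forall>x. x \<notin> D \<longrightarrow> f x = 0) \<and> linf_norm D f < \<infinity>}"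

text \<open>\<open>\<complex>\<^sup>n\<close> is modelled by the sequences \<open>v\<close> with \<open>v i = 0\<close> for \<open>i \<ge> n\<close>.\<close>

definition cvec :: "nat \<Rightarrow> (nat \<Rightarrow> complex) set" where
  "cvec n = {v. \<forall>i\<ge>n. v i = 0}"

definition linear_maps ::
  "nat \<Rightarrow> ('a \<Rightarrow> complex) set \<Rightarrow> ((nat \<Rightarrow> complex) \<Rightarrow> ('a \<Rightarrow> complex)) set" where
  "linear_maps n F = {R. (\<forall>v\<in>cvec n. R v \<in> F) \<and>
     (\<forall>u\<in>cvec n. \<forall>v\<in>cvec n. R (u + v) = R u + R v) \<and>
     (\<forall>c. \<forall>v\<in>cvec n. R (cscale c v) = cscale c (R v))}"

definition samples :: "nat \<Rightarrow> (nat \<Rightarrow> 'a) \<Rightarrow> ('a \<Rightarrow> complex) \<Rightarrow> (nat \<Rightarrow> complex)" where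
  "samples n X f = (\<lambda>i. if i < n then f (X i) else 0)"

definition sampling_number ::
  "'a set \<Rightarrow> ('a \<Rightarrow> complex) set \<Rightarrow> (('a \<Rightarrow> complex) \<Rightarrow> ('a \<Rightarrow> complex) \<Rightarrow> complex) \<Rightarrow>
   ('a \<Rightarrow> complex) set \<Rightarrow> (('a \<Rightarrow> complex) \<Rightarrow> ennreal) \<Rightarrow> nat \<Rightarrow> ennreal" where
  "sampling_number D H ip F normF n =
     (INF X\<in>{X. \<forall>i<n. X i \<in> D}. INF R\<in>linear_maps n F.
        SUP f\<in>{f\<in>H. ip_norm ip f \<le> 1}. normF (f - R (samples n X f)))"

abbreviation sampling_number_linf ::
  "'a set \<Rightarrow> ('a \<Rightarrow> complex) set \<Rightarrow> (('a \<Rightarrow> complex) \<Rightarrow> ('a \<Rightarrow> complex) \<Rightarrow> complex) \<Rightarrow>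
   nat \<Rightarrow> ennreal" where
  "sampling_number_linf D H ip n \<equiv> sampling_number D H ip (linf_space D) (linf_norm D) n"

text \<open>
  The two tail sums. They take values in \<^typ>\<open>ennreal\<close> because the second one may diverge; the
  bounds are then trivially true.
\<close>

definition sigma_tail :: "(nat \<Rightarrow> real) \<Rightarrow> nat \<Rightarrow> ennreal" where
  "sigma_tail lam n = (\<Sum>\<^sub>\<infinity>k\<in>{k. 1 \<le> k \<and> n \<le> k}. ennreal ((sing_num lam k)\<^sup>2))"

definition N_sigma_tail ::
  "'a set \<Rightarrow> (nat \<Rightarrow> real) \<Rightarrow> (nat \<Rightarrow> 'a \<Rightarrow> complex) \<Rightarrow> nat \<Rightarrow> ennreal" where
  "N_sigma_tail D lam e n =
     (\<Sum>\<^sub>\<infinity>k\<in>{k. 1 \<le> k \<and> n \<le> k}. N_fun D lam e (4 * k) * ennreal ((sing_num lam k)\<^sup>2) / of_nat k)"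

end

theory Submission
  imports Defs
begin

text \<open>
  The points come from a one-sided variant of the Batson--Spielman--Srivastava barrier argument,
  carried out on \<open>H\<close> itself. Let \<open>T = Id\<^sup>* Id\<close> and \<open>\<mu> = (\<lambda>\<^sub>p + \<lambda>\<^sub>p\<^sub>+\<^sub>1 + \<dots>) / p\<close>. On the space of
  functions vanishing at the points chosen so far, consider the quadratic form of \<open>a T + \<mu>\<close>. At the
  start \<open>a = 1\<close>, and the trace of \<open>T\<close> relative to this form is at most \<open>2 p\<close>. Lowering \<open>a\<close> by
  \<open>1 / (8 p)\<close> increases this trace, but an averaging argument over \<open>\<rho>\<close> yields a point whose
  addition undoes the increase. After \<open>16 p\<close> steps \<open>a = -1\<close>, hence \<open>\<parallel>f\<parallel>\<^sub>2\<^sup>2 \<le> \<mu> \<parallel>f\<parallel>\<^sub>H\<^sup>2\<close> for every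
  \<open>f \<in> H\<close> that vanishes at all \<open>16 p\<close> points.

  Minimal norm interpolation at these points leaves an error \<open>f\<close> of this kind. Its component in the
  span of the first \<open>p - 1\<close> eigenfunctions is bounded in the supremum norm through \<open>N(p)\<close> and
  \<open>\<parallel>f\<parallel>\<^sub>2\<close>, the remaining one through \<open>\<Sum>\<^sub>k\<^sub>\<ge>\<^sub>p |e\<^sub>k(x)|\<^sup>2\<close>, where the completeness of the eigenfunctions
  enters. No logarithm is lost, so both parts of the theorem follow.
\<close>

subsection \<open>Hilbert spaces of functions\<close>

text \<open>Only the L2 norm of functions that vanish at the points has to be controlled, not a
  weighted sum of samples of arbitrary functions. One barrier therefore suffices, and a point may
  enter with infinite weight, as the linear constraint \<open>f x = 0\<close>. The obstacle is the
  infinite dimension: points adapted to the first eigenfunctions alone say nothing about the tail.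
  The shift by \<mu> treats both at once. Each of the first \<open>p - 1\<close> directions
  contributes at most 1 to the trace, and the whole tail at most its eigenvalue sum divided by
  \<mu>, which is \<open>p\<close>; so \<open>2 p\<close> plays the role of the dimension. The
  barrier asks for the inverse of a form on a subspace that shrinks with every point. Instead of
  inverting, the proof carries an operator \<open>A\<close> on all of \<open>H\<close> that bounds
  this inverse from above. Lowering \<open>a\<close> and adding a point are then explicit updates of
  \<open>A\<close>, and neither square roots nor a functional calculus occur. The step
  \<open>1 / (8 p)\<close> is a quarter of the reciprocal of the trace bound: small enough for a
  first order update with doubled coefficient to bound the true inverse, and for one point to pay
  for the increase.\<close>

lemma psd_cauchy_schwarz:
  assumes H: "cfun.subspace H"
    and add: "\<And>f g h. f \<in> H \<Longrightarrow> g \<in> H \<Longrightarrow> h \<in> H \<Longrightarrow> B (f + g) h = B f h + B g h"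
    and scale: "\<And>c f g. f \<in> H \<Longrightarrow> g \<in> H \<Longrightarrow> B (cscale c f) g = c * B f g"
    and herm: "\<And>f g. f \<in> H \<Longrightarrow> g \<in> H \<Longrightarrow> B g f = cnj (B f g)"
    and nonneg: "\<And>f. f \<in> H \<Longrightarrow> 0 \<le> Re (B f f)"
    and f: "f \<in> H" and g: "g \<in> H"
  shows "(cmod (B f g))\<^sup>2 \<le> Re (B f f) * Re (B g g)"
proof -
  define a where "a = Re (B f f)"
  define b where "b = Re (B g g)"
  define z where "z = B f g"
  have a0: "0 \<le> a" and b0: "0 \<le> b" using nonneg f g by (auto simp: a_def b_def)
  have ff: "B f f = of_real a" and gg: "B g g = of_real b"
    using herm[OF f f] herm[OF g g] by (auto simp: a_def b_def complex_eq_iff)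
  have expand: "0 \<le> (cmod c)\<^sup>2 * a + 2 * Re (c * z) + b" for c
  proof -
    let ?h = "cscale c f + g"
    have cf: "cscale c f \<in> H" using H f by (rule cfun.subspace_scale)
    have h: "?h \<in> H" using H cf g by (rule cfun.subspace_add)
    have fh: "B f ?h = cnj c * of_real a + z"
      using herm[OF h f] add[OF cf g f] scale[OF f f] herm[OF f g]
      by (simp add: ff z_def)
    have gh: "B g ?h = cnj (c * z) + of_real b"
      using herm[OF h g] add[OF cf g g] scale[OF f g]
      by (simp add: gg z_def)
    have "B ?h ?h = c * (cnj c * of_real a + z) + (cnj (c * z) + of_real b)"
      using add[OF cf g h] scale[OF f h] by (simp add: fh gh)
    moreover have "0 \<le> Re (B ?h ?h)" by (rule nonneg[OF h])
    moreover have "Re (c * (cnj c * of_real a + z) + (cnj (c * z) + of_real b)) =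
        (cmod c)\<^sup>2 * a + 2 * Re (c * z) + b"
      unfolding cmod_power2 by (simp add: algebra_simps power2_eq_square)
    ultimately show ?thesis by simp
  qed
  have key: "0 \<le> t\<^sup>2 * (cmod z)\<^sup>2 * a - 2 * t * (cmod z)\<^sup>2 + b" for t
  proof -
    have "Re (- (of_real t * cnj z) * z) = - t * (cmod z)\<^sup>2"
      unfolding cmod_power2 by (simp add: algebra_simps power2_eq_square)
    moreover have "(cmod (- (of_real t * cnj z)))\<^sup>2 = t\<^sup>2 * (cmod z)\<^sup>2"
      by (simp add: norm_mult power_mult_distrib)
    ultimately show ?thesis using expand[of "- (of_real t * cnj z)"] by simp
  qed
  have "(cmod z)\<^sup>2 \<le> a * b"
  \<comment> \<open>The degenerate case does occur: the lemma is also applied to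
    \<open>ip (A f) g\<close>, where \<open>A\<close> annihilates directions once points have been
    added. There \<open>key\<close> is affine in \<open>t\<close>, and
    \<open>t = (b + 1) / (cmod z)\<^sup>2\<close> makes it negative unless \<open>z = 0\<close>;
    otherwise \<open>t = 1 / a\<close> is the optimal choice.\<close>
  proof (cases "a = 0")
    case True
    show ?thesis
    proof (rule ccontr)
      assume "\<not> ?thesis"
      then have z: "(cmod z)\<^sup>2 > 0" using True by simp
      have "(b + 1) / (cmod z)\<^sup>2 * (cmod z)\<^sup>2 = b + 1" using z by simp
      moreover have "0 \<le> - 2 * ((b + 1) / (cmod z)\<^sup>2 * (cmod z)\<^sup>2) + b"
        using key[of "(b + 1) / (cmod z)\<^sup>2"] True by (simp only: mult.assoc mult_zero_right add_0 diff_0 mult_minus_left)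
      ultimately show False using b0 by linarith
    qed
  next
    case False
    then have "a > 0" using a0 by simp
    then show ?thesis using key[of "1 / a"]
      by (simp add: field_simps power2_eq_square)
  qed
  then show ?thesis by (simp add: a_def b_def z_def)
qed

lemma tendsto_of_dist_bound:
  fixes X :: "nat \<Rightarrow> 'b::real_normed_vector"
  assumes "\<And>n. norm (X n - l) \<le> Y n" and "Y \<longlonglongrightarrow> 0"
  shows "X \<longlonglongrightarrow> l"
  using Lim_null_comparison[of "\<lambda>n. X n - l" Y sequentially] assms LIM_zero_cancel by fastforce

locale hilbert_functions =
  fixes D :: "'a set" and H :: "('a \<Rightarrow> complex) set"
    and ip :: "('a \<Rightarrow> complex) \<Rightarrow> ('a \<Rightarrow> complex) \<Rightarrow> complex"
  assumes hfs: "hilbert_function_space D H ip"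
begin

abbreviation nrm where "nrm \<equiv> ip_norm ip"

lemma subspace_H: "cfun.subspace H"
  using hfs unfolding hilbert_function_space_def by blast

lemma H_closed [simp, intro]:
  "0 \<in> H"
  "f \<in> H \<Longrightarrow> g \<in> H \<Longrightarrow> f + g \<in> H"
  "f \<in> H \<Longrightarrow> g \<in> H \<Longrightarrow> f - g \<in> H"
  "f \<in> H \<Longrightarrow> cscale c f \<in> H"
  using subspace_H cfun.subspace_0 cfun.subspace_add cfun.subspace_diff cfun.subspace_scale
  by blast+

lemma H_sum [simp, intro]: "(\<And>i. i \<in> I \<Longrightarrow> f i \<in> H) \<Longrightarrow> (\<Sum>i\<in>I. f i) \<in> H"
  using subspace_H by (rule cfun.subspace_sum)

lemma H_outside: "f \<in> H \<Longrightarrow> x \<notin> D \<Longrightarrow> f x = 0"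
  by (rule hfs[unfolded hilbert_function_space_def, THEN conjunct2, THEN conjunct1, rule_format])

lemma ip_add_left [simp]: "f \<in> H \<Longrightarrow> g \<in> H \<Longrightarrow> h \<in> H \<Longrightarrow> ip (f + g) h = ip f h + ip g h"
  by (rule hfs[unfolded hilbert_function_space_def, THEN conjunct2, THEN conjunct2, THEN conjunct1, rule_format])

lemma ip_scale_left [simp]: "f \<in> H \<Longrightarrow> g \<in> H \<Longrightarrow> ip (cscale c f) g = c * ip f g"
  by (rule hfs[unfolded hilbert_function_space_def, THEN conjunct2, THEN conjunct2, THEN conjunct2, THEN conjunct1, rule_format])

lemma ip_cnj: "f \<in> H \<Longrightarrow> g \<in> H \<Longrightarrow> ip g f = cnj (ip f g)"
  by (rule hfs[unfolded hilbert_function_space_def, THEN conjunct2, THEN conjunct2, THEN conjunct2, THEN conjunct2, THEN conjunct1, rule_format])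

lemma ip_nonneg [simp]: "f \<in> H \<Longrightarrow> 0 \<le> Re (ip f f)"
  by (rule hfs[unfolded hilbert_function_space_def, THEN conjunct2, THEN conjunct2, THEN conjunct2, THEN conjunct2, THEN conjunct2, THEN conjunct1, rule_format])

lemma ip_eq_0: "f \<in> H \<Longrightarrow> ip f f = 0 \<Longrightarrow> f = 0"
  by (rule hfs[unfolded hilbert_function_space_def, THEN conjunct2, THEN conjunct2, THEN conjunct2, THEN conjunct2, THEN conjunct2, THEN conjunct2, THEN conjunct1, rule_format])

lemma H_complete:
  assumes "\<And>n. F n \<in> H"
    and "\<And>\<epsilon>. \<epsilon> > 0 \<Longrightarrow> \<exists>M. \<forall>m\<ge>M. \<forall>n\<ge>M. nrm (F m - F n) < \<epsilon>"
  obtains f where "f \<in> H" "(\<lambda>n. nrm (F n - f)) \<longlonglongrightarrow> 0"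
  using assms hfs unfolding hilbert_function_space_def by metis

lemma ip_add_right [simp]: "f \<in> H \<Longrightarrow> g \<in> H \<Longrightarrow> h \<in> H \<Longrightarrow> ip h (f + g) = ip h f + ip h g"
  by (metis H_closed(2) complex_cnj_add ip_add_left ip_cnj)

lemma ip_scale_right [simp]: "f \<in> H \<Longrightarrow> g \<in> H \<Longrightarrow> ip g (cscale c f) = cnj c * ip g f"
  by (metis H_closed(4) complex_cnj_mult ip_scale_left ip_cnj)

lemma ip_diff_left [simp]:
  assumes "f \<in> H" "g \<in> H" "h \<in> H" shows "ip (f - g) h = ip f h - ip g h"
proof -
  have "ip f h = ip (f - g) h + ip g h"
    using ip_add_left[of "f - g" g h] assms by simp
  then show ?thesis by simp
qed

lemma ip_diff_right [simp]: "f \<in> H \<Longrightarrow> g \<in> H \<Longrightarrow> h \<in> H \<Longrightarrow> ip h (f - g) = ip h f - ip h g"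
  by (metis H_closed(3) complex_cnj_diff ip_diff_left ip_cnj)

lemma ip_zero [simp]: "f \<in> H \<Longrightarrow> ip 0 f = 0" "f \<in> H \<Longrightarrow> ip f 0 = 0"
  using ip_diff_left[of f f f] ip_diff_right[of f f f] by simp_all

lemma ip_sum_left:
  "(\<And>i. i \<in> I \<Longrightarrow> f i \<in> H) \<Longrightarrow> h \<in> H \<Longrightarrow> ip (\<Sum>i\<in>I. f i) h = (\<Sum>i\<in>I. ip (f i) h)"
  by (induction I rule: infinite_finite_induct) auto

lemma ip_self: "f \<in> H \<Longrightarrow> ip f f = of_real (Re (ip f f))"
  using ip_cnj[of f f] by (simp add: complex_eq_iff)

lemma nrm_sq: "f \<in> H \<Longrightarrow> (nrm f)\<^sup>2 = Re (ip f f)"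
  by (simp add: ip_norm_def)

lemma nrm_nonneg [simp]: "f \<in> H \<Longrightarrow> 0 \<le> nrm f"
  by (simp add: ip_norm_def)

lemma nrm_eq_0: "f \<in> H \<Longrightarrow> nrm f = 0 \<Longrightarrow> f = 0"
  using ip_self[of f] ip_eq_0[of f] by (simp add: ip_norm_def)

lemma cauchy_schwarz_sq:
  "f \<in> H \<Longrightarrow> g \<in> H \<Longrightarrow> (cmod (ip f g))\<^sup>2 \<le> Re (ip f f) * Re (ip g g)"
  by (rule psd_cauchy_schwarz[OF subspace_H ip_add_left ip_scale_left ip_cnj ip_nonneg])

lemma cauchy_schwarz: "f \<in> H \<Longrightarrow> g \<in> H \<Longrightarrow> cmod (ip f g) \<le> nrm f * nrm g"
  using cauchy_schwarz_sq[of f g] real_le_rsqrt real_sqrt_mult by (fastforce simp: ip_norm_def)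

lemma nrm_scale: "f \<in> H \<Longrightarrow> nrm (cscale c f) = cmod c * nrm f"
proof -
  assume f: "f \<in> H"
  have "c * cnj c = of_real ((cmod c)\<^sup>2)"
    by (metis complex_norm_square of_real_power)
  then have "ip (cscale c f) (cscale c f) = of_real ((cmod c)\<^sup>2) * ip f f"
    using f by (metis H_closed(4) ip_scale_left ip_scale_right mult.assoc mult.commute)
  then show ?thesis
    by (simp add: ip_norm_def real_sqrt_mult)
qed

lemma nrm_triangle: assumes f: "f \<in> H" and g: "g \<in> H" shows "nrm (f + g) \<le> nrm f + nrm g"
proof (rule power2_le_imp_le)
  have "Re (ip f g) \<le> nrm f * nrm g" "Re (ip g f) \<le> nrm g * nrm f"
    using cauchy_schwarz[OF f g] cauchy_schwarz[OF g f] complex_Re_le_cmod order_trans by blast+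
  then show "(nrm (f + g))\<^sup>2 \<le> (nrm f + nrm g)\<^sup>2"
    using f g by (simp add: power2_sum) (simp add: nrm_sq algebra_simps)
qed (use f g in auto)

lemma nrm_minus_commute: "f \<in> H \<Longrightarrow> g \<in> H \<Longrightarrow> nrm (f - g) = nrm (g - f)"
  by (simp add: ip_norm_def algebra_simps)

lemma nrm_triangle3:
  "f \<in> H \<Longrightarrow> g \<in> H \<Longrightarrow> h \<in> H \<Longrightarrow> nrm (f - h) \<le> nrm (f - g) + nrm (g - h)"
  using nrm_triangle[of "f - g" "g - h"] by simp

lemma ip_tendsto:
  assumes F: "\<And>n. F n \<in> H" and f: "f \<in> H" and lim: "(\<lambda>n. nrm (F n - f)) \<longlonglongrightarrow> 0" and h: "h \<in> H"
  shows "(\<lambda>n. ip (F n) h) \<longlonglongrightarrow> ip f h"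
proof (rule tendsto_of_dist_bound)
  show "(\<lambda>n. nrm (F n - f) * nrm h) \<longlonglongrightarrow> 0"
    using tendsto_mult_left_zero[OF lim] by simp
  show "norm (ip (F n) h - ip f h) \<le> nrm (F n - f) * nrm h" for n
    using cauchy_schwarz[OF H_closed(3)[OF F f] h, of n] F f h by simp
qed

lemma nrm_tendsto:
  assumes F: "\<And>n. F n \<in> H" and f: "f \<in> H" and lim: "(\<lambda>n. nrm (F n - f)) \<longlonglongrightarrow> 0"
  shows "(\<lambda>n. nrm (F n)) \<longlonglongrightarrow> nrm f"
proof (rule tendsto_of_dist_bound[OF _ lim])
  show "norm (nrm (F n) - nrm f) \<le> nrm (F n - f)" for n
    using nrm_triangle[of "F n - f" f] nrm_triangle[of "f - F n" "F n"] F f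
      nrm_minus_commute[of "F n" f] by (auto simp: abs_le_iff)
qed

lemma nrm_add_scale_sq:
  assumes h: "h \<in> H" and g: "g \<in> H"
  shows "(nrm (h + cscale c g))\<^sup>2 = (nrm h)\<^sup>2 + 2 * Re (c * ip g h) + (cmod c)\<^sup>2 * (nrm g)\<^sup>2"
proof -
  have "ip g g = of_real ((nrm g)\<^sup>2)" using ip_self[OF g] g by (simp add: nrm_sq)
  moreover have "ip h h = of_real ((nrm h)\<^sup>2)" using ip_self[OF h] h by (simp add: nrm_sq)
  moreover have "Re (ip (h + cscale c g) (h + cscale c g)) =
      Re (ip h h + (c * ip g h + cnj (c * ip g h)) + c * cnj c * ip g g)"
    using h g by (simp add: ip_cnj[OF g h] algebra_simps del: cfun.scale_right_distrib)
  moreover have "(nrm (h + cscale c g))\<^sup>2 = Re (ip (h + cscale c g) (h + cscale c g))"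
    using h g by (simp add: nrm_sq)
  ultimately show ?thesis
    by (simp add: complex_norm_square[symmetric] del: of_real_power)
qed

text \<open>The representer is the minimizer of the convex functional \<open>J\<close>. Minimizing
  sequences are Cauchy by the parallelogram law, which replaces the usual argument through the
  orthogonal complement of the kernel of \<open>\<phi>\<close>.\<close>

lemma riesz:
  assumes add: "\<And>f g. f \<in> H \<Longrightarrow> g \<in> H \<Longrightarrow> \<phi> (f + g) = \<phi> f + \<phi> g"
    and scale: "\<And>c f. f \<in> H \<Longrightarrow> \<phi> (cscale c f) = c * \<phi> f"
    and bound: "\<And>f. f \<in> H \<Longrightarrow> cmod (\<phi> f) \<le> C * nrm f"
  obtains h where "h \<in> H" "\<And>f. f \<in> H \<Longrightarrow> \<phi> f = ip f h"
proof -
  define J where "J f = (nrm f)\<^sup>2 - 2 * Re (\<phi> f)" for f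
  define J0 where "J0 = Inf (J ` H)"
  have below: "- C\<^sup>2 \<le> J f" if "f \<in> H" for f
  proof -
    have "0 \<le> (nrm f - C)\<^sup>2" by simp
    moreover have "Re (\<phi> f) \<le> C * nrm f"
      using bound[OF that] complex_Re_le_cmod order_trans by blast
    ultimately show ?thesis by (simp add: J_def power2_diff algebra_simps)
  qed
  then have bdd: "bdd_below (J ` H)" by (auto simp: bdd_below_def)
  have J0: "J0 \<le> J f" if "f \<in> H" for f
    unfolding J0_def using bdd that by (auto intro: cInf_lower)
  define r :: "nat \<Rightarrow> real" where "r n = inverse (real (Suc n))" for n
  have r_pos: "r n > 0" for n by (simp add: r_def)
  have "\<exists>f\<in>H. J f < J0 + r n" for n
    using cInf_lessD[of "J ` H" "J0 + r n"] H_closed(1)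
    r_pos[of n]
    by (force simp: J0_def)
  then obtain F where F: "\<And>n. F n \<in> H" and JF: "\<And>n. J (F n) < J0 + r n"
    by metis
  \<comment> \<open>The midpoint of \<open>f\<close> and \<open>g\<close> has value at least
    \<open>J0\<close>, so the parallelogram law forces two near-minimizers to be close.\<close>
  have par: "(nrm (f - g))\<^sup>2 \<le> 2 * (J f - J0) + 2 * (J g - J0)" if "f \<in> H" "g \<in> H" for f g
  proof -
    have "4 * J0 \<le> 4 * J (cscale (1/2) (f + g))" using J0 that by simp
    also have "\<dots> = (nrm (f + g))\<^sup>2 - 4 * Re (\<phi> f + \<phi> g)"
      using that by (simp add: J_def scale add nrm_scale power_divide add_divide_distrib)
    also have "\<dots> = 2 * (nrm f)\<^sup>2 + 2 * (nrm g)\<^sup>2 - (nrm (f - g))\<^sup>2 - 4 * Re (\<phi> f + \<phi> g)"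
      using that by (simp add: nrm_sq algebra_simps)
    finally show ?thesis by (simp add: J_def)
  qed
  obtain h where h: "h \<in> H" and lim: "(\<lambda>n. nrm (F n - h)) \<longlonglongrightarrow> 0"
  proof (rule H_complete[OF F])
    fix \<epsilon> :: real assume "\<epsilon> > 0"
    then obtain M where M: "r M < \<epsilon>\<^sup>2 / 4"
      using reals_Archimedean[of "\<epsilon>\<^sup>2 / 4"] by (auto simp: r_def)
    have "nrm (F m - F n) < \<epsilon>" if "m \<ge> M" "n \<ge> M" for m n
    proof (rule power2_less_imp_less)
      have "r m \<le> r M" "r n \<le> r M" using that by (auto simp: r_def)
      then have "J (F m) - J0 < \<epsilon>\<^sup>2 / 4" "J (F n) - J0 < \<epsilon>\<^sup>2 / 4"
        using JF[of m] JF[of n] M by linarith+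
      then have "2 * (J (F m) - J0) + 2 * (J (F n) - J0) < \<epsilon>\<^sup>2" by argo
      then show "(nrm (F m - F n))\<^sup>2 < \<epsilon>\<^sup>2"
        by (rule le_less_trans[OF par[OF F F]])
    qed (use \<open>\<epsilon> > 0\<close> in simp)
    then show "\<exists>M. \<forall>m\<ge>M. \<forall>n\<ge>M. nrm (F m - F n) < \<epsilon>" by blast
  qed
  have diff: "\<phi> (f - g) = \<phi> f - \<phi> g" if "f \<in> H" "g \<in> H" for f g
    using add[of "f - g" g] that by simp
  have philim: "(\<lambda>n. \<phi> (F n)) \<longlonglongrightarrow> \<phi> h"
  proof (rule tendsto_of_dist_bound)
    show "(\<lambda>n. C * nrm (F n - h)) \<longlonglongrightarrow> 0"
      using tendsto_mult_right_zero[OF lim] by simp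
    show "norm (\<phi> (F n) - \<phi> h) \<le> C * nrm (F n - h)" for n
      using bound[OF H_closed(3)[OF F h], of n] diff[OF F h] by simp
  qed
  have Jlim: "(\<lambda>n. J (F n)) \<longlonglongrightarrow> J h"
    unfolding J_def by (intro tendsto_intros nrm_tendsto F h lim philim)
  have "(\<lambda>n. J0 + r n) \<longlonglongrightarrow> J0 + 0"
    unfolding r_def by (intro tendsto_intros LIMSEQ_inverse_real_of_nat)
  then have "J h \<le> J0 + 0"
    using JF by (intro LIMSEQ_le[OF Jlim]) (auto intro: less_imp_le)
  then have Jmin: "J h \<le> J f" if "f \<in> H" for f using J0[OF that] by simp
  have "\<phi> g = ip g h" if g: "g \<in> H" for g
  proof (rule ccontr)
    define z where "z = ip g h - \<phi> g"
    assume "\<phi> g \<noteq> ip g h"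
    then have z: "(cmod z)\<^sup>2 > 0" by (simp add: z_def)
    \<comment> \<open>Moving from \<open>h\<close> along \<open>g\<close> by
      \<open>- t * cnj z\<close> changes \<open>J\<close> by \<open>t\<close> times
      \<open>(cmod z)\<^sup>2\<close> times \<open>t * (nrm g)\<^sup>2 - 2\<close>. This
      \<open>t\<close> keeps \<open>t * (nrm g)\<^sup>2\<close> at most 1, also for
      \<open>g = 0\<close>, so \<open>J\<close> would fall below its minimum.\<close>
    define t where "t = 1 / ((nrm g)\<^sup>2 + 1)"
    have t: "t > 0" by (simp add: t_def add_nonneg_pos)
    define c where "c = - (of_real t * cnj z)"
    have "J (h + cscale c g) = J h + 2 * Re (c * z) + (cmod c)\<^sup>2 * (nrm g)\<^sup>2"
      using h g by (simp add: J_def nrm_add_scale_sq add scale z_def right_diff_distrib)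
    also have "Re (c * z) = - t * (cmod z)\<^sup>2"
      unfolding cmod_power2 by (simp add: c_def algebra_simps power2_eq_square)
    also have "(cmod c)\<^sup>2 = t\<^sup>2 * (cmod z)\<^sup>2"
      by (simp add: c_def norm_mult power_mult_distrib)
    finally have "J (h + cscale c g) =
        J h + 2 * (- t * (cmod z)\<^sup>2) + t\<^sup>2 * (cmod z)\<^sup>2 * (nrm g)\<^sup>2" .
    moreover have "J h \<le> J (h + cscale c g)" by (intro Jmin H_closed h g)
    ultimately have "0 \<le> 2 * (- t * (cmod z)\<^sup>2) + t\<^sup>2 * (cmod z)\<^sup>2 * (nrm g)\<^sup>2"
      by linarith
    also have "\<dots> = (cmod z)\<^sup>2 * (t * (t * (nrm g)\<^sup>2 - 2))"
      by (simp add: algebra_simps power2_eq_square)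
    finally have "0 \<le> (cmod z)\<^sup>2 * (t * (t * (nrm g)\<^sup>2 - 2))" .
    then have "0 \<le> t * (nrm g)\<^sup>2 - 2"
      using z t by (simp add: zero_le_mult_iff)
    moreover have "t * (nrm g)\<^sup>2 \<le> 1"
      by (simp add: t_def divide_simps add_nonneg_pos)
    ultimately show False by simp
  qed
  then show ?thesis using that h by blast
qed

lemma ip_ext:
  assumes f: "f \<in> H" and g: "g \<in> H" and eq: "\<And>h. h \<in> H \<Longrightarrow> ip h f = ip h g"
  shows "f = g"
proof -
  have "ip (f - g) (f - g) = 0" using eq[of "f - g"] f g by simp
  then have "f - g = 0" using ip_eq_0[of "f - g"] f g by blast
  then show ?thesis by simp
qed

lemma nrm_triangle_diff: "f \<in> H \<Longrightarrow> g \<in> H \<Longrightarrow> nrm (f - g) \<le> nrm f + nrm g"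
  using nrm_triangle3[of f 0 g] nrm_minus_commute[of 0 g] by simp

section \<open>Bounded positive operators on \<open>H\<close>\<close>

text \<open>Linearity is not required, since it follows from symmetry.\<close>

definition pos_op :: "(('a \<Rightarrow> complex) \<Rightarrow> ('a \<Rightarrow> complex)) \<Rightarrow> bool" where
  "pos_op A \<longleftrightarrow> (\<forall>f\<in>H. A f \<in> H) \<and> (\<forall>f\<in>H. \<forall>g\<in>H. ip (A f) g = ip f (A g)) \<and>
     (\<forall>f\<in>H. 0 \<le> Re (ip (A f) f)) \<and> (\<exists>C\<ge>0. \<forall>f\<in>H. nrm (A f) \<le> C * nrm f)"

lemma pos_op_closed [intro]: "pos_op A \<Longrightarrow> f \<in> H \<Longrightarrow> A f \<in> H"
  by (simp add: pos_op_def)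

lemma pos_op_sym: "pos_op A \<Longrightarrow> f \<in> H \<Longrightarrow> g \<in> H \<Longrightarrow> ip (A f) g = ip f (A g)"
  unfolding pos_op_def by blast

lemma pos_op_nonneg: "pos_op A \<Longrightarrow> f \<in> H \<Longrightarrow> 0 \<le> Re (ip (A f) f)"
  unfolding pos_op_def by blast

lemma pos_op_nonneg': "pos_op A \<Longrightarrow> f \<in> H \<Longrightarrow> 0 \<le> Re (ip f (A f))"
  using pos_op_nonneg pos_op_sym by metis

lemma pos_op_bounded:
  assumes "pos_op A" obtains C where "C \<ge> 0" "\<And>f. f \<in> H \<Longrightarrow> nrm (A f) \<le> C * nrm f"
  using assms unfolding pos_op_def by blast

lemma pos_op_add: "pos_op A \<Longrightarrow> f \<in> H \<Longrightarrow> g \<in> H \<Longrightarrow> A (f + g) = A f + A g"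
  by (rule ip_ext) (auto simp: pos_op_sym[symmetric] pos_op_closed)

lemma pos_op_diff: "pos_op A \<Longrightarrow> f \<in> H \<Longrightarrow> g \<in> H \<Longrightarrow> A (f - g) = A f - A g"
  by (rule ip_ext) (auto simp: pos_op_sym[symmetric] pos_op_closed)

lemma pos_op_scale: "pos_op A \<Longrightarrow> f \<in> H \<Longrightarrow> A (cscale c f) = cscale c (A f)"
  by (rule ip_ext) (auto simp: pos_op_sym[symmetric] pos_op_closed)

lemma pos_op_cauchy_schwarz:
  assumes A: "pos_op A" and f: "f \<in> H" and g: "g \<in> H"
  shows "(cmod (ip (A f) g))\<^sup>2 \<le> Re (ip (A f) f) * Re (ip (A g) g)"
proof (rule psd_cauchy_schwarz[OF subspace_H _ _ _ _ f g, of "\<lambda>f g. ip (A f) g"])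
  show "ip (A g) f = cnj (ip (A f) g)" if "f \<in> H" "g \<in> H" for f g
    using that A by (metis ip_cnj pos_op_closed pos_op_sym)
next
  show "ip (A (f + g)) h = ip (A f) h + ip (A g) h" if "f \<in> H" "g \<in> H" "h \<in> H" for f g h
    using that by (simp add: pos_op_add[OF A] pos_op_closed[OF A])
  show "ip (A (cscale c f)) g = c * ip (A f) g" if "f \<in> H" "g \<in> H" for c f g
    using that by (simp add: pos_op_scale[OF A] pos_op_closed[OF A])
  show "0 \<le> Re (ip (A f) f)" if "f \<in> H" for f
    using that A by (rule pos_op_nonneg[rotated])
qed

lemma pos_op_plus:
  assumes A: "pos_op A" and B: "pos_op B" shows "pos_op (\<lambda>f. A f + B f)"
proof -
  obtain a where a: "a \<ge> 0" "\<And>f. f \<in> H \<Longrightarrow> nrm (A f) \<le> a * nrm f"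
    using pos_op_bounded[OF A] by metis
  obtain b where b: "b \<ge> 0" "\<And>f. f \<in> H \<Longrightarrow> nrm (B f) \<le> b * nrm f"
    using pos_op_bounded[OF B] by metis
  note cl = pos_op_closed[OF A] pos_op_closed[OF B]
  have "nrm (A f + B f) \<le> (a + b) * nrm f" if f: "f \<in> H" for f
    using nrm_triangle[OF cl(1)[OF f] cl(2)[OF f]] a(2)[OF f] b(2)[OF f] unfolding distrib_right by linarith
  then show ?thesis
    unfolding pos_op_def using a(1) b(1)
    by (intro conjI ballI exI[of _ "a + b"])
      (auto simp: cl pos_op_sym[OF A] pos_op_sym[OF B] pos_op_nonneg'[OF A] pos_op_nonneg'[OF B])
qed

lemma pos_op_cscale:
  assumes A: "pos_op A" and c: "0 \<le> c" shows "pos_op (\<lambda>f. cscale (of_real c) (A f))"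
proof -
  obtain a where a: "a \<ge> 0" "\<And>f. f \<in> H \<Longrightarrow> nrm (A f) \<le> a * nrm f"
    using pos_op_bounded[OF A] by metis
  have "nrm (cscale (of_real c) (A f)) \<le> (c * a) * nrm f" if f: "f \<in> H" for f
    using mult_left_mono[OF a(2)[OF f] c] c by (simp add: nrm_scale pos_op_closed[OF A] f)
  then show ?thesis
    unfolding pos_op_def using a(1) c
    by (intro conjI ballI exI[of _ "c * a"])
      (auto simp: pos_op_closed[OF A] pos_op_sym[OF A] pos_op_nonneg'[OF A])
qed

lemma pos_op_sandwich:
  assumes A: "pos_op A" and T: "pos_op T" shows "pos_op (\<lambda>f. A (T (A f)))"
proof -
  obtain a where a: "a \<ge> 0" "\<And>f. f \<in> H \<Longrightarrow> nrm (A f) \<le> a * nrm f"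
    using pos_op_bounded[OF A] by metis
  obtain t where t: "t \<ge> 0" "\<And>f. f \<in> H \<Longrightarrow> nrm (T f) \<le> t * nrm f"
    using pos_op_bounded[OF T] by metis
  note cl = pos_op_closed[OF A] pos_op_closed[OF T]
  have "nrm (A (T (A f))) \<le> (a * (t * a)) * nrm f" if f: "f \<in> H" for f
  proof -
    have "nrm (A (T (A f))) \<le> a * (t * (a * nrm f))"
      using a(2)[OF cl(2)[OF cl(1)[OF f]]] t(2)[OF cl(1)[OF f]] a(2)[OF f] a(1) t(1)
      by (meson mult_left_mono order_trans)
    then show ?thesis by (simp add: mult.assoc)
  qed
  moreover have "0 \<le> Re (ip (T (A f)) (A f))" if "f \<in> H" for f
    by (rule pos_op_nonneg[OF T cl(1)[OF that]])
  ultimately show ?thesis unfolding pos_op_def using a(1) t(1)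
    by (intro conjI ballI exI[of _ "a * (t * a)"])
      (auto simp: cl pos_op_sym[OF A] pos_op_sym[OF T])
qed

lemma pos_op_add_sandwich:
  "pos_op A \<Longrightarrow> pos_op T \<Longrightarrow> 0 \<le> c \<Longrightarrow> pos_op (\<lambda>f. A f + cscale (of_real c) (A (T (A f))))"
  using pos_op_plus[of A, OF _ pos_op_cscale[OF pos_op_sandwich]] by blast

text \<open>Sherman-Morrison with infinite weight: if \<open>A\<close> inverts a form
  \<open>G\<close>, the new operator is the limit, as t tends to infinity, of the inverse of
  \<open>G\<close> plus t times the square of \<open>cmod (ip f k)\<close>. It thus encodes the
  constraint \<open>ip f k = 0\<close>. The subtracted term is at most the form of \<open>A\<close>
  by Cauchy-Schwarz, so positivity survives.\<close>

lemma pos_op_deflate: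
  assumes A: "pos_op A" and k: "k \<in> H" and pos: "0 < Re (ip (A k) k)"
  shows "pos_op (\<lambda>f. A (f - cscale (ip (A f) k / ip (A k) k) k))"
    and "h \<in> H \<Longrightarrow> Re (ip (A (h - cscale (ip (A h) k / ip (A k) k) k)) h) =
      Re (ip (A h) h) - (cmod (ip (A h) k))\<^sup>2 / Re (ip (A k) k)"
    and "h \<in> H \<Longrightarrow> ip (A (h - cscale (ip (A h) k / ip (A k) k) k)) k = 0"
proof -
  define R where "R = Re (ip (A k) k)"
  have Ak: "A k \<in> H" using A k by blast
  note cl = pos_op_closed[OF A]
  have R: "ip (A k) k = of_real R"
    unfolding R_def using ip_cnj[OF Ak k] pos_op_sym[OF A k k] by (simp add: complex_eq_iff)
  have R0: "R > 0" using pos by (simp add: R_def)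
  \<comment> \<open>\<open>P f\<close> is the part of \<open>f\<close> orthogonal to
    \<open>k\<close> in the form of \<open>A\<close>. Hence the composition of \<open>A\<close> with
    \<open>P\<close> is symmetric, although \<open>P\<close> itself need not be.\<close>
  define P where "P f = f - cscale (ip (A f) k / of_real R) k" for f
  have P: "P f \<in> H" if "f \<in> H" for f using that k by (simp add: P_def)
  have AP: "A (P f) = A f - cscale (ip (A f) k / of_real R) (A k)" if "f \<in> H" for f
    using that k by (simp add: P_def pos_op_diff[OF A] pos_op_scale[OF A])
  have swap: "ip (A k) g = cnj (ip (A g) k)" if "g \<in> H" for g
    using that k A by (metis ip_cnj pos_op_closed pos_op_sym)
  have form: "ip (A (P f)) g = ip (A f) g - ip (A f) k * cnj (ip (A g) k) / of_real R"
    if "f \<in> H" "g \<in> H" for f g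
    using that k by (simp add: AP cl Ak swap)
  have herm: "ip (A f) g = cnj (ip (A g) f)" if "f \<in> H" "g \<in> H" for f g
    using that A by (metis ip_cnj pos_op_closed pos_op_sym)
  show re: "Re (ip (A (h - cscale (ip (A h) k / ip (A k) k) k)) h) =
      Re (ip (A h) h) - (cmod (ip (A h) k))\<^sup>2 / Re (ip (A k) k)" if h: "h \<in> H" for h
  proof -
    have "ip (A h) k * cnj (ip (A h) k) / of_real R = of_real ((cmod (ip (A h) k))\<^sup>2 / R)"
      by (metis complex_norm_square of_real_divide)
    then have "Re (ip (A (P h)) h) = Re (ip (A h) h) - (cmod (ip (A h) k))\<^sup>2 / R"
      unfolding form[OF h h] by (simp only: minus_complex.sel Re_complex_of_real)
    then show ?thesis by (simp add: P_def R)
  qed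
  show "ip (A (h - cscale (ip (A h) k / ip (A k) k) k)) k = 0" if h: "h \<in> H" for h
    using form[OF h k] R0 by (simp add: P_def R)
  obtain a where a: "a \<ge> 0" "\<And>f. f \<in> H \<Longrightarrow> nrm (A f) \<le> a * nrm f"
    using pos_op_bounded[OF A] by metis
  have "pos_op (\<lambda>f. A (P f))"
    unfolding pos_op_def
  proof (intro conjI ballI exI[of _ "a + a * nrm k / R * nrm (A k)"])
    fix f g assume f: "f \<in> H" and g: "g \<in> H"
    have "ip f (A (P g)) = cnj (ip (A (P g)) f)" using f g by (intro ip_cnj cl P)
    then show "ip (A (P f)) g = ip f (A (P g))"
      using form[OF f g] form[OF g f] herm[OF f g] by (simp add: mult.commute)
  next
    fix f assume f: "f \<in> H"
    have "(cmod (ip (A f) k))\<^sup>2 \<le> Re (ip (A f) f) * R"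
      using pos_op_cauchy_schwarz[OF A f k] by (simp add: R_def)
    then have "(cmod (ip (A f) k))\<^sup>2 / R \<le> Re (ip (A f) f)"
      using R0 by (simp add: divide_le_eq)
    then show "0 \<le> Re (ip (A (P f)) f)"
      using re[OF f] by (simp add: P_def R)
  next
    fix f assume f: "f \<in> H"
    have "nrm (A (P f)) \<le> nrm (A f) + nrm (cscale (ip (A f) k / of_real R) (A k))"
      using f by (simp add: AP cl Ak nrm_triangle_diff)
    also have "\<dots> \<le> a * nrm f + (a * nrm f * nrm k / R) * nrm (A k)"
    proof (intro add_mono a(2) f)
      have "cmod (ip (A f) k) \<le> a * nrm f * nrm k"
        using cauchy_schwarz[OF cl[OF f] k] mult_right_mono[OF a(2)[OF f] nrm_nonneg[OF k]]
        by linarith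
      then show "nrm (cscale (ip (A f) k / of_real R) (A k)) \<le> (a * nrm f * nrm k / R) * nrm (A k)"
        using R0 Ak by (simp add: nrm_scale norm_divide divide_right_mono mult_right_mono)
    qed
    finally show "nrm (A (P f)) \<le> (a + a * nrm k / R * nrm (A k)) * nrm f"
      by (simp add: algebra_simps)
  qed (use a R0 k Ak cl P in auto)
  then show "pos_op (\<lambda>f. A (f - cscale (ip (A f) k / ip (A k) k) k))"
    by (simp add: P_def R)
qed

lemma pos_op_rank_one:
  assumes u: "u \<in> H" shows "pos_op (\<lambda>f. cscale (ip f u) u)"
  unfolding pos_op_def
proof (intro conjI ballI exI[of _ "nrm u * nrm u"])
  fix f assume f: "f \<in> H"
  show "nrm (cscale (ip f u) u) \<le> nrm u * nrm u * nrm f"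
    using mult_right_mono[OF cauchy_schwarz[OF f u] nrm_nonneg[OF u]] u
    by (simp add: nrm_scale mult.commute mult.left_commute)
  have "ip f u * ip u f = of_real ((cmod (ip f u))\<^sup>2)"
    unfolding complex_norm_square using ip_cnj[OF f u] by simp
  then show "0 \<le> Re (ip (cscale (ip f u) u) f)" using f u by simp
  fix g assume g: "g \<in> H"
  show "ip (cscale (ip f u) u) g = ip f (cscale (ip g u) u)"
    using f g u by (simp add: ip_cnj[OF g u])
qed (use u in auto)

lemma pos_op_zero: "pos_op (\<lambda>f. 0)"
  unfolding pos_op_def by (auto simp: ip_norm_def intro!: exI[of _ 0])

lemma pos_op_sum: "(\<And>i. i \<in> I \<Longrightarrow> pos_op (A i)) \<Longrightarrow> pos_op (\<lambda>f. \<Sum>i\<in>I. A i f)"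
  by (induction I rule: infinite_finite_induct) (auto intro: pos_op_zero pos_op_plus)

end

lemma sum_fun_apply:
  fixes f :: "'i \<Rightarrow> 'b \<Rightarrow> 'c::comm_monoid_add"
  shows "(\<Sum>i\<in>I. f i) x = (\<Sum>i\<in>I. f i x)"
  by (induction I rule: infinite_finite_induct) simp_all

subsection \<open>The embedding of a reproducing kernel Hilbert space into \<open>L\<^sub>2\<close>\<close>

text \<open>The ambient space enters only as a metric space with countable base. No dimension
  occurs, so the constants obtained here cannot depend on it.\<close>

locale rkhs_embedding = hilbert_functions D H ip
  for D :: "'a::{metric_space,second_countable_topology} set" and H ip +
  fixes K :: "'a \<Rightarrow> 'a \<Rightarrow> complex" and \<rho> :: "'a measure"
  assumes compact_D: "compact D" and nonempty_D: "D \<noteq> {}"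
    and continuous_K: "continuous_on (D \<times> D) (\<lambda>(x, y). K x y)"
    and rkhs: "is_rkhs D K H ip"
    and finite_borel: "finite_borel_measure_on D \<rho>"
    and support: "full_support D \<rho>"
begin

sublocale finite_measure \<rho>
  using finite_borel by (simp add: finite_borel_measure_on_def)

abbreviation k where "k \<equiv> kernel_section D K"

lemma k_in [simp, intro]: "x \<in> D \<Longrightarrow> k x \<in> H"
  using rkhs by (simp add: is_rkhs_def)

lemma ip_k [simp]: "f \<in> H \<Longrightarrow> x \<in> D \<Longrightarrow> ip f (k x) = f x"
  using rkhs unfolding is_rkhs_def by metis

lemma k_apply: "y \<in> D \<Longrightarrow> k x y = K y x"
  by (simp add: kernel_section_def)

lemma continuous_K_comp:
  "continuous_on S u \<Longrightarrow> continuous_on S v \<Longrightarrow> u ` S \<subseteq> D \<Longrightarrow> v ` S \<subseteq> D \<Longrightarrow>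
    continuous_on S (\<lambda>x. K (u x) (v x))"
  using continuous_on_compose2[OF continuous_K, of S "\<lambda>x. (u x, v x)"]
  by (auto intro: continuous_on_Pair)

text \<open>Expanding the squared distance of two sections into four values of \<open>K\<close>
  reduces continuity of the feature map into \<open>H\<close> to continuity of
  \<open>K\<close>.\<close>

lemma k_tendsto:
  assumes x: "x \<in> D" shows "((\<lambda>y. nrm (k y - k x)) \<longlongrightarrow> 0) (at x within D)"
proof -
  define g where "g y = sqrt (Re (K y y - K y x - K x y + K x x))" for y
  have "continuous_on D g"
    unfolding g_def using x by (intro continuous_intros continuous_K_comp) auto
  then have "(g \<longlongrightarrow> g x) (at x within D)"
    using x by (simp add: continuous_on_def)
  moreover have "g x = 0" by (simp add: g_def)
  moreover have "\<forall>\<^sub>F y in at x within D. g y = nrm (k y - k x)"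
    using x by (auto simp: eventually_at_filter g_def ip_norm_def k_apply algebra_simps)
  ultimately show ?thesis by (simp add: filterlim_cong)
qed

lemma k_bounded: obtains \<kappa> where "\<kappa> \<ge> 0" "\<And>x. x \<in> D \<Longrightarrow> nrm (k x) \<le> \<kappa>"
proof -
  have "compact ((\<lambda>x. K x x) ` D)"
    by (intro compact_continuous_image continuous_K_comp compact_D continuous_intros) auto
  then have "bounded ((\<lambda>x. K x x) ` D)" by (rule compact_imp_bounded)
  then obtain B where B: "\<And>x. x \<in> D \<Longrightarrow> cmod (K x x) \<le> B"
    by (auto simp: bounded_iff)
  have "nrm (k x) \<le> sqrt \<bar>B\<bar>" if "x \<in> D" for x
    using B[OF that] that complex_Re_le_cmod[of "K x x"]
    by (auto simp: ip_norm_def k_apply intro!: real_sqrt_le_mono)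
  then show ?thesis using that[of "sqrt \<bar>B\<bar>"] by simp
qed

lemma eval_bound: "f \<in> H \<Longrightarrow> x \<in> D \<Longrightarrow> cmod (f x) \<le> nrm f * nrm (k x)"
  using cauchy_schwarz[of f "k x"] by simp

lemma continuous_H [intro]: assumes f: "f \<in> H" shows "continuous_on D f"
  unfolding continuous_on_def
proof
  fix x assume x: "x \<in> D"
  show "(f \<longlongrightarrow> f x) (at x within D)"
  proof (rule LIM_zero_cancel, rule Lim_null_comparison)
    show "((\<lambda>y. nrm f * nrm (k y - k x)) \<longlongrightarrow> 0) (at x within D)"
      by (intro tendsto_mult_right_zero k_tendsto x)
    show "\<forall>\<^sub>F y in at x within D. norm (f y - f x) \<le> nrm f * nrm (k y - k x)"
      unfolding eventually_at_filter
    proof (rule always_eventually, intro allI impI)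
      fix y assume "y \<in> D"
      then show "norm (f y - f x) \<le> nrm f * nrm (k y - k x)"
        using cauchy_schwarz[OF f, of "k y - k x"] f x by simp
    qed
  qed
qed

text \<open>Continuity, rather than mere measurability, matters because the greedy step must pass
  from a vanishing integral to vanishing at every point of \<open>D\<close>.\<close>

lemma continuous_op:
  assumes A: "pos_op A" shows "continuous_on D (\<lambda>x. Re (ip (A (k x)) (k x)))"
  unfolding continuous_on_def
proof
  fix x assume x: "x \<in> D"
  obtain a where a: "a \<ge> 0" "\<And>f. f \<in> H \<Longrightarrow> nrm (A f) \<le> a * nrm f"
    using pos_op_bounded[OF A] by metis
  obtain \<kappa> where \<kappa>: "\<kappa> \<ge> 0" "\<And>x. x \<in> D \<Longrightarrow> nrm (k x) \<le> \<kappa>" using k_bounded by metis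
  show "((\<lambda>x. Re (ip (A (k x)) (k x))) \<longlongrightarrow> Re (ip (A (k x)) (k x))) (at x within D)"
  proof (rule LIM_zero_cancel, rule Lim_null_comparison)
    show "((\<lambda>y. (2 * a * \<kappa>) * nrm (k y - k x)) \<longlongrightarrow> 0) (at x within D)"
      by (intro tendsto_mult_right_zero k_tendsto x)
    show "\<forall>\<^sub>F y in at x within D. norm (Re (ip (A (k y)) (k y)) - Re (ip (A (k x)) (k x)))
        \<le> (2 * a * \<kappa>) * nrm (k y - k x)"
      unfolding eventually_at_filter
    proof (rule always_eventually, intro allI impI)
      fix y assume y: "y \<in> D"
      let ?d = "k y - k x"
      have d: "?d \<in> H" using x y by blast
      have "cmod (ip (A ?d) (k y)) \<le> nrm (A ?d) * nrm (k y)"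
        using d y A by (intro cauchy_schwarz) auto
      also have "\<dots> \<le> (a * nrm ?d) * \<kappa>"
        using a \<kappa> d y A by (intro mult_mono) auto
      finally have 1: "cmod (ip (A ?d) (k y)) \<le> a * nrm ?d * \<kappa>" .
      have "cmod (ip (A (k x)) ?d) \<le> nrm (A (k x)) * nrm ?d"
        using d x A by (intro cauchy_schwarz) auto
      also have "\<dots> \<le> (a * \<kappa>) * nrm ?d"
      proof (rule mult_right_mono)
        show "nrm (A (k x)) \<le> a * \<kappa>"
          using a(2)[of "k x"] mult_left_mono[OF \<kappa>(2)[OF x] a(1)] x by auto
      qed (use d in simp)
      finally have 2: "cmod (ip (A (k x)) ?d) \<le> a * \<kappa> * nrm ?d" .
      have "ip (A (k y)) (k y) - ip (A (k x)) (k x) = ip (A ?d) (k y) + ip (A (k x)) ?d"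
        using x y by (simp add: pos_op_diff[OF A] pos_op_closed[OF A] del: ip_k)
      then have "norm (Re (ip (A (k y)) (k y)) - Re (ip (A (k x)) (k x))) \<le>
          cmod (ip (A ?d) (k y) + ip (A (k x)) ?d)"
        by (metis abs_Re_le_cmod minus_complex.sel(1) real_norm_def)
      also have "\<dots> \<le> cmod (ip (A ?d) (k y)) + cmod (ip (A (k x)) ?d)"
        by (rule norm_triangle_ineq)
      finally show "norm (Re (ip (A (k y)) (k y)) - Re (ip (A (k x)) (k x)))
          \<le> (2 * a * \<kappa>) * nrm ?d"
        using 1 2 by (simp add: algebra_simps)
    qed
  qed
qed

lemma space_\<rho> [simp]: "space \<rho> = D"
  using finite_borel sets_eq_imp_space_eq[of \<rho> "restrict_space borel D"]
  by (simp add: finite_borel_measure_on_def space_restrict_space)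

lemma measurable_continuous:
  fixes g :: "'a \<Rightarrow> 'b::topological_space"
  assumes "continuous_on D g" shows "g \<in> borel_measurable \<rho>"
  using borel_measurable_continuous_on_restrict[OF assms] finite_borel
  by (simp add: finite_borel_measure_on_def cong: measurable_cong_sets)

lemma integrable_continuous:
  fixes g :: "'a \<Rightarrow> 'b::{banach,second_countable_topology}"
  assumes g: "continuous_on D g" shows "integrable \<rho> g"
proof -
  obtain B where "\<And>x. x \<in> D \<Longrightarrow> norm (g x) \<le> B"
    using compact_imp_bounded[OF compact_continuous_image[OF g compact_D]]
    by (auto simp: bounded_iff)
  then show ?thesis
    by (intro integrable_const_bound[of _ B] AE_I2 measurable_continuous g) auto
qed

lemma integral_mono_D:
  fixes f g :: "'a \<Rightarrow> real"
  assumes "continuous_on D f" "continuous_on D g" "\<And>x. x \<in> D \<Longrightarrow> f x \<le> g x"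
  shows "(LINT x|\<rho>. f x) \<le> (LINT x|\<rho>. g x)"
  using assms by (intro integral_mono integrable_continuous) auto

text \<open>This is where full support enters: a positive value of a continuous function persists on
  a relatively open set, which has positive measure.\<close>

lemma integral_eq_0_D:
  fixes g :: "'a \<Rightarrow> real"
  assumes g: "continuous_on D g" and nonneg: "\<And>x. x \<in> D \<Longrightarrow> 0 \<le> g x"
    and zero: "(LINT x|\<rho>. g x) = 0" and x: "x \<in> D"
  shows "g x = 0"
proof (rule ccontr)
  assume "g x \<noteq> 0"
  then have pos: "g x > 0" using nonneg[OF x] by simp
  have "open {g x / 2<..}" by simp
  then obtain U where U: "open U" "U \<inter> D = g -` {g x / 2<..} \<inter> D"
    using g unfolding continuous_on_open_invariant by metis
  have "x \<in> U \<inter> D" using U pos x by auto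
  then have m: "emeasure \<rho> (U \<inter> D) > 0" using support U(1) unfolding full_support_def by blast
  have "AE y in \<rho>. 0 \<le> g y" using nonneg by (intro AE_I2) simp
  then have "AE y in \<rho>. g y = 0"
    using integral_nonneg_eq_0_iff_AE[OF integrable_continuous[OF g]] zero by simp
  then have "AE y in \<rho>. y \<notin> U \<inter> D"
  proof (rule AE_mp, intro AE_I2 impI notI)
    fix y assume "g y = 0" "y \<in> U \<inter> D"
    then show False using U pos by auto
  qed
  moreover have "U \<inter> D \<in> sets \<rho>"
    using finite_borel U(1)
    by (auto simp: finite_borel_measure_on_def sets_restrict_space)
  ultimately have "emeasure \<rho> (U \<inter> D) = 0"
    using AE_iff_measurable[of "U \<inter> D" \<rho> "\<lambda>y. y \<notin> U \<inter> D"] by auto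
  then show False using m by simp
qed

section \<open>The L2 form on \<open>H\<close> and the adjoint of the embedding\<close>

abbreviation l2 where "l2 \<equiv> L2_inner \<rho>"

lemma integrable_l2: "f \<in> H \<Longrightarrow> g \<in> H \<Longrightarrow> integrable \<rho> (\<lambda>x. f x * cnj (g x))"
  by (intro integrable_continuous continuous_intros continuous_H)

lemma l2_add: "f \<in> H \<Longrightarrow> g \<in> H \<Longrightarrow> h \<in> H \<Longrightarrow> l2 (f + g) h = l2 f h + l2 g h"
  by (simp add: L2_inner_def ring_distribs integrable_l2)

lemma l2_scale: "l2 (cscale c f) g = c * l2 f g"
  by (simp add: L2_inner_def cscale_def mult.assoc)

lemma l2_cnj: "l2 g f = cnj (l2 f g)"
  unfolding L2_inner_def Bochner_Integration.integral_cnj[symmetric]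
  by (simp add: mult.commute del: Bochner_Integration.integral_cnj)

lemma l2_self: "l2 f f = of_real (LINT x|\<rho>. (cmod (f x))\<^sup>2)"
  unfolding L2_inner_def integral_complex_of_real[symmetric] complex_norm_square ..

lemma Re_l2_self: "Re (l2 f f) = (LINT x|\<rho>. (cmod (f x))\<^sup>2)"
  by (simp add: l2_self)

lemma l2_nonneg [simp]: "0 \<le> Re (l2 f f)"
  by (simp add: l2_self)

lemma l2_cauchy_schwarz:
  "f \<in> H \<Longrightarrow> g \<in> H \<Longrightarrow> (cmod (l2 f g))\<^sup>2 \<le> Re (l2 f f) * Re (l2 g g)"
  by (rule psd_cauchy_schwarz[OF subspace_H l2_add l2_scale l2_cnj l2_nonneg])

lemma continuous_cmod_sq: "f \<in> H \<Longrightarrow> continuous_on D (\<lambda>x. (cmod (f x))\<^sup>2)"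
  by (intro continuous_intros continuous_H)

lemma l2_bound: obtains C where "C \<ge> 0" "\<And>f. f \<in> H \<Longrightarrow> Re (l2 f f) \<le> (C * nrm f)\<^sup>2"
proof -
  obtain \<kappa> where \<kappa>: "\<kappa> \<ge> 0" "\<And>x. x \<in> D \<Longrightarrow> nrm (k x) \<le> \<kappa>" using k_bounded by metis
  define C where "C = \<kappa> * sqrt (measure \<rho> D)"
  have "Re (l2 f f) \<le> (C * nrm f)\<^sup>2" if f: "f \<in> H" for f
  proof -
    have "Re (l2 f f) \<le> (LINT x|\<rho>. (\<kappa> * nrm f)\<^sup>2)"
      unfolding Re_l2_self
    proof (rule integral_mono_D[OF continuous_cmod_sq[OF f]])
      fix x assume x: "x \<in> D"
      have "cmod (f x) \<le> nrm f * \<kappa>"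
        using eval_bound[OF f x] mult_left_mono[OF \<kappa>(2)[OF x] nrm_nonneg[OF f]] by linarith
      then show "(cmod (f x))\<^sup>2 \<le> (\<kappa> * nrm f)\<^sup>2"
        by (intro power_mono) (auto simp: mult.commute)
    qed simp
    also have "\<dots> = (C * nrm f)\<^sup>2"
      by (simp add: C_def power_mult_distrib)
    finally show ?thesis .
  qed
  then show ?thesis using that[of C] \<kappa>(1) by (simp add: C_def)
qed

abbreviation T where "T \<equiv> embedding_adjoint H ip \<rho>"

text \<open>Gives meaning to the definite description in \<open>embedding_adjoint\<close>. For fixed
  \<open>g\<close> the L2 form is a functional of \<open>f\<close> bounded in the norm of
  \<open>H\<close>, so \<open>riesz\<close> applies.\<close>

lemma T_ex: assumes g: "g \<in> H" shows "\<exists>!h. h \<in> H \<and> (\<forall>f\<in>H. l2 f g = ip f h)"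
proof -
  obtain C where C: "C \<ge> 0" "\<And>f. f \<in> H \<Longrightarrow> Re (l2 f f) \<le> (C * nrm f)\<^sup>2" using l2_bound by metis
  obtain h where "h \<in> H" "\<And>f. f \<in> H \<Longrightarrow> l2 f g = ip f h"
  proof (rule riesz[of "\<lambda>f. l2 f g" "C * sqrt (Re (l2 g g))"])
    show "cmod (l2 f g) \<le> C * sqrt (Re (l2 g g)) * nrm f" if f: "f \<in> H" for f
    proof (rule power2_le_imp_le)
      have "(cmod (l2 f g))\<^sup>2 \<le> (C * nrm f)\<^sup>2 * Re (l2 g g)"
        using l2_cauchy_schwarz[OF f g] mult_right_mono[OF C(2)[OF f] l2_nonneg[of g]] by linarith
      then show "(cmod (l2 f g))\<^sup>2 \<le> (C * sqrt (Re (l2 g g)) * nrm f)\<^sup>2"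
        by (simp add: power_mult_distrib algebra_simps)
    qed (use C f in auto)
  qed (use g in \<open>auto simp: l2_add l2_scale\<close>)
  then show ?thesis by (metis ip_ext)
qed

lemma T_props: "g \<in> H \<Longrightarrow> T g \<in> H \<and> (\<forall>f\<in>H. l2 f g = ip f (T g))"
  unfolding embedding_adjoint_def by (rule theI'[OF T_ex])

lemma T_in [simp, intro]: "g \<in> H \<Longrightarrow> T g \<in> H"
  and T_ip: "g \<in> H \<Longrightarrow> f \<in> H \<Longrightarrow> ip f (T g) = l2 f g"
  using T_props by simp_all

lemma T_ip': "g \<in> H \<Longrightarrow> f \<in> H \<Longrightarrow> ip (T g) f = l2 g f"
  using T_ip l2_cnj by (metis T_in ip_cnj)

text \<open>The bound with \<open>C\<close> is assumed at \<open>T g\<close> only, because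
  \<open>eigenvector_exists\<close> applies the lemma with a sharp constant that is valid just on an
  invariant subset of \<open>H\<close>.\<close>

lemma T_norm_le:
  assumes g: "g \<in> H" and C: "C \<ge> 0" "Re (l2 (T g) (T g)) \<le> (C * nrm (T g))\<^sup>2"
  shows "nrm (T g) \<le> C * sqrt (Re (l2 g g))"
proof (cases "nrm (T g) = 0")
  case True then show ?thesis using C by simp
next
  case False
  then have pos: "(nrm (T g))\<^sup>2 > 0" by simp
  have "((nrm (T g))\<^sup>2)\<^sup>2 = (cmod (l2 (T g) g))\<^sup>2"
    using ip_self[of "T g"] g by (metis T_in T_ip nrm_sq norm_of_real power2_abs)
  also have "\<dots> \<le> Re (l2 (T g) (T g)) * Re (l2 g g)"
    using g by (intro l2_cauchy_schwarz) auto
  also have "\<dots> \<le> (C * nrm (T g))\<^sup>2 * Re (l2 g g)"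
    using g by (intro mult_right_mono C) auto
  finally have "(nrm (T g))\<^sup>2 * (nrm (T g))\<^sup>2 \<le> (C\<^sup>2 * Re (l2 g g)) * (nrm (T g))\<^sup>2"
    by (simp add: power_mult_distrib power2_eq_square algebra_simps)
  then have "(nrm (T g))\<^sup>2 \<le> C\<^sup>2 * Re (l2 g g)" using pos by (rule mult_right_le_imp_le)
  also have "\<dots> = (C * sqrt (Re (l2 g g)))\<^sup>2" by (simp add: power_mult_distrib)
  finally show ?thesis by (rule power2_le_imp_le) (use C in simp)
qed

lemma pos_op_T: "pos_op T"
proof -
  obtain C where C: "C \<ge> 0" "\<And>f. f \<in> H \<Longrightarrow> Re (l2 f f) \<le> (C * nrm f)\<^sup>2" using l2_bound by metis
  have "nrm (T f) \<le> C * C * nrm f" if f: "f \<in> H" for f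
  proof -
    have "sqrt (Re (l2 f f)) \<le> C * nrm f"
      using C(2)[OF f] C(1) f by (intro real_le_lsqrt) auto
    then show ?thesis using T_norm_le[OF f C(1) C(2)[OF T_in[OF f]]] mult_left_mono[of _ "C * nrm f" C] C(1)
      by (fastforce simp: mult.assoc)
  qed
  then show ?thesis
    unfolding pos_op_def using C(1)
    by (intro conjI ballI exI[of _ "C * C"]) (auto simp: T_ip T_ip')
qed

lemma T_diff: "f \<in> H \<Longrightarrow> g \<in> H \<Longrightarrow> T (f - g) = T f - T g"
  by (rule pos_op_diff[OF pos_op_T])

lemma l2_scale_self: "Re (l2 (cscale c f) (cscale c f)) = (cmod c)\<^sup>2 * Re (l2 f f)"
  by (simp add: Re_l2_self cscale_def norm_mult power_mult_distrib)

section \<open>Compactness of the embedding and existence of eigenvectors\<close>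

text \<open>An Arzela-Ascoli argument: convergence on a countable dense set extends to all of
  \<open>D\<close>, because a norm bound in \<open>H\<close> and \<open>k_tendsto\<close> make the
  functions equicontinuous.\<close>

lemma pointwise_convergent_subsequence:
  fixes F :: "nat \<Rightarrow> 'a \<Rightarrow> complex"
  assumes F: "\<And>n. F n \<in> H" and B: "\<And>n. nrm (F n) \<le> B"
  obtains r :: "nat \<Rightarrow> nat" and g where "strict_mono r" "\<And>x. x \<in> D \<Longrightarrow> (\<lambda>n. F (r n) x) \<longlonglongrightarrow> g x"
proof -
  obtain \<kappa> where \<kappa>: "\<kappa> \<ge> 0" "\<And>x. x \<in> D \<Longrightarrow> nrm (k x) \<le> \<kappa>" using k_bounded by metis
  obtain Z where Z: "countable Z" "Z \<subseteq> D" "D \<subseteq> closure Z" using separable[of D] by metis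
  have "Z \<noteq> {}" using Z(3) nonempty_D by auto
  define z where "z = from_nat_into Z"
  have range_z: "range z = Z" unfolding z_def by (rule range_from_nat_into) fact+
  have zD: "z i \<in> D" for i using range_z Z by blast
  \<comment> \<open>Sequential compactness of a countable product of closed discs takes the place of
    a diagonal extraction over the dense points \<open>z i\<close>.\<close>
  define V where "V = PiE UNIV (\<lambda>_::nat. cball (0::complex) (B * \<kappa>))"
  have "compactin (product_topology (\<lambda>_::nat. euclidean) UNIV) V"
    unfolding V_def compactin_PiE by (simp add: compactin_euclidean_iff)
  then have "compact V"
    by (simp add: euclidean_product_topology compactin_euclidean_iff)
  then have "seq_compact V" by (rule compact_imp_seq_compact)
  moreover have "\<forall>n. (\<lambda>i. F n (z i)) \<in> V"
  proof
    fix n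
    have "cmod (F n (z i)) \<le> B * \<kappa>" for i
    proof -
      have "cmod (F n (z i)) \<le> nrm (F n) * nrm (k (z i))" by (intro eval_bound F zD)
      also have "\<dots> \<le> B * \<kappa>"
        using order_trans[OF nrm_nonneg[OF F] B] by (intro mult_mono B \<kappa> zD) (auto simp: zD)
      finally show ?thesis .
    qed
    then show "(\<lambda>i. F n (z i)) \<in> V" by (auto simp: V_def PiE_def extensional_def)
  qed
  ultimately obtain l r where r: "strict_mono (r :: nat \<Rightarrow> nat)"
    and l: "((\<lambda>n i. F n (z i)) \<circ> r) \<longlonglongrightarrow> l"
    using seq_compactE by metis
  have lz: "(\<lambda>n. F (r n) (z i)) \<longlonglongrightarrow> l i" for i
  proof -
    have "isCont (\<lambda>x::nat \<Rightarrow> complex. x i) l"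
      using iffD1[OF continuous_on_eq_continuous_at[OF open_UNIV] continuous_on_product_coordinates]
      by blast
    from isCont_tendsto_compose[OF this l] show ?thesis by (simp add: o_def)
  qed
  have "Cauchy (\<lambda>n. F (r n) x)" if x: "x \<in> D" for x
  proof (rule CauchyI)
    fix \<epsilon> :: real assume \<epsilon>: "\<epsilon> > 0"
    have B0: "B \<ge> 0" using order_trans[OF nrm_nonneg[OF F] B] .
    define \<epsilon>' where "\<epsilon>' = \<epsilon> / (4 * (B + 1))"
    have \<epsilon>': "\<epsilon>' > 0" using \<epsilon> B0 by (simp add: \<epsilon>'_def)
    have "\<forall>\<^sub>F y in at x within D. nrm (k y - k x) < \<epsilon>'"
      using k_tendsto[OF x] \<epsilon>' by (rule order_tendstoD)
    then obtain d where d: "d > 0" "\<And>y. y \<in> D \<Longrightarrow> y \<noteq> x \<Longrightarrow> dist y x < d \<Longrightarrow> nrm (k y - k x) < \<epsilon>'"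
      unfolding eventually_at by blast
    have "\<exists>y\<in>Z. dist y x < d"
      using x Z(3) d(1) closure_approachable by blast
    then obtain i where i: "dist (z i) x < d" using range_z by blast
    have near: "nrm (k (z i) - k x) < \<epsilon>'"
    proof (cases "z i = x")
      case True
      then show ?thesis using \<epsilon>' by (simp add: ip_norm_def x)
    next
      case False then show ?thesis using d(2) zD i by blast
    qed
    have close: "cmod (F n x - F n (z i)) \<le> \<epsilon> / 4" for n
    proof -
      have "cmod (F n x - F n (z i)) \<le> nrm (F n) * nrm (k (z i) - k x)"
        using cauchy_schwarz[OF F, of "k (z i) - k x" n] x zD F
        by (simp add: norm_minus_commute)
      also have "\<dots> \<le> B * \<epsilon>'"
        using near B0 x zD by (intro mult_mono B) auto
      also have "\<dots> \<le> \<epsilon> / 4"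
        using B0 \<epsilon> by (simp add: \<epsilon>'_def divide_simps)
      finally show ?thesis .
    qed
    obtain M where M: "\<And>m n. m \<ge> M \<Longrightarrow> n \<ge> M \<Longrightarrow> cmod (F (r m) (z i) - F (r n) (z i)) < \<epsilon> / 4"
      using CauchyD[OF LIMSEQ_imp_Cauchy[OF lz[of i]], of "\<epsilon> / 4"] \<epsilon> by auto
    have "cmod (F (r m) x - F (r n) x) < \<epsilon>" if "m \<ge> M" "n \<ge> M" for m n
    proof -
      have eq: "F (r m) x - F (r n) x = (F (r m) x - F (r m) (z i)) +
          (F (r m) (z i) - F (r n) (z i)) - (F (r n) x - F (r n) (z i))" by simp
      have "cmod (a + b - c) \<le> cmod a + cmod b + cmod c" for a b c :: complex
        using norm_triangle_ineq4[of "a + b" c] norm_triangle_ineq[of a b] by linarith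
      then have "cmod (F (r m) x - F (r n) x) \<le> cmod (F (r m) x - F (r m) (z i)) +
          cmod (F (r m) (z i) - F (r n) (z i)) + cmod (F (r n) x - F (r n) (z i))"
        unfolding eq by blast
      then show ?thesis using close[of "r m"] close[of "r n"] M[OF that] \<epsilon> by linarith
    qed
    then show "\<exists>M. \<forall>m\<ge>M. \<forall>n\<ge>M. norm (F (r m) x - F (r n) x) < \<epsilon>" by blast
  qed
  then have "\<exists>y. (\<lambda>n. F (r n) x) \<longlonglongrightarrow> y" if "x \<in> D" for x
    using that Cauchy_convergent convergent_def by blast
  then obtain g where "\<And>x. x \<in> D \<Longrightarrow> (\<lambda>n. F (r n) x) \<longlonglongrightarrow> g x" by metis
  with r that show ?thesis by blast
qed

text \<open>Dominated convergence upgrades pointwise convergence to L2 convergence; this is the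
  compactness of the embedding. In Cauchy form, the pointwise limit does not have to be identified
  as an element of \<open>H\<close>.\<close>

lemma l2_Cauchy_subsequence:
  fixes F :: "nat \<Rightarrow> 'a \<Rightarrow> complex"
  assumes F: "\<And>n. F n \<in> H" and B: "\<And>n. nrm (F n) \<le> B"
  obtains r :: "nat \<Rightarrow> nat" where "strict_mono r"
    "\<And>\<epsilon>. \<epsilon> > 0 \<Longrightarrow> \<exists>M. \<forall>m\<ge>M. \<forall>n\<ge>M. Re (l2 (F (r m) - F (r n)) (F (r m) - F (r n))) < \<epsilon>"
proof -
  obtain \<kappa> where \<kappa>: "\<kappa> \<ge> 0" "\<And>x. x \<in> D \<Longrightarrow> nrm (k x) \<le> \<kappa>" using k_bounded by metis
  obtain r g where r: "strict_mono r" and g: "\<And>x. x \<in> D \<Longrightarrow> (\<lambda>n. F (r n) x) \<longlonglongrightarrow> g x"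
    by (rule pointwise_convergent_subsequence[of F B, OF F B]) (rule that)
  have B0: "B \<ge> 0" using order_trans[OF nrm_nonneg[OF F] B] .
  have bound: "cmod (F n x) \<le> B * \<kappa>" if "x \<in> D" for n x
  proof -
    have "cmod (F n x) \<le> nrm (F n) * nrm (k x)" by (intro eval_bound F that)
    also have "\<dots> \<le> B * \<kappa>"
      using B0 that by (intro mult_mono B \<kappa>) auto
    finally show ?thesis .
  qed
  have gbound: "cmod (g x) \<le> B * \<kappa>" if "x \<in> D" for x
    using tendsto_norm[OF g[OF that]] bound[OF that] by (intro LIMSEQ_le_const2) auto
  have Fm: "F n \<in> borel_measurable \<rho>" for n by (intro measurable_continuous continuous_H F)
  have gm: "g \<in> borel_measurable \<rho>"
    by (rule borel_measurable_LIMSEQ_metric[of "\<lambda>n. F (r n)"]) (simp_all add: Fm g)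
  define u where "u n x = (cmod (F (r n) x - g x))\<^sup>2" for n x
  have um: "u n \<in> borel_measurable \<rho>" for n
    unfolding u_def using Fm gm by measurable
  have ub: "norm (u n x) \<le> (2 * B * \<kappa>)\<^sup>2" if "x \<in> D" for n x
  proof -
    have "cmod (F (r n) x - g x) \<le> 2 * B * \<kappa>"
      using norm_triangle_ineq4[of "F (r n) x" "g x"] bound[OF that, of "r n"] gbound[OF that]
      by linarith
    then show ?thesis unfolding u_def by (simp add: power_mono)
  qed
  have ui: "integrable \<rho> (u n)" for n
    using ub by (intro integrable_const_bound[of _ "(2 * B * \<kappa>)\<^sup>2"] um AE_I2) auto
  have lim: "(\<lambda>n. LINT x|\<rho>. u n x) \<longlonglongrightarrow> (LINT x|\<rho>. 0)"
  proof (rule integral_dominated_convergence[where w = "\<lambda>_. (2 * B * \<kappa>)\<^sup>2"])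
    show "AE x in \<rho>. (\<lambda>n. u n x) \<longlonglongrightarrow> 0"
    proof (rule AE_I2)
      fix x assume "x \<in> space \<rho>"
      then have "(\<lambda>n. (cmod (F (r n) x - g x))\<^sup>2) \<longlonglongrightarrow> (cmod (g x - g x))\<^sup>2"
        by (intro tendsto_intros g) simp
      then show "(\<lambda>n. u n x) \<longlonglongrightarrow> 0" by (simp add: u_def)
    qed
    show "AE x in \<rho>. norm (u n x) \<le> (2 * B * \<kappa>)\<^sup>2" for n
      using ub by (intro AE_I2) simp
  qed (use um in simp_all)
  have est: "Re (l2 (F (r m) - F (r n)) (F (r m) - F (r n))) \<le>
      2 * (LINT x|\<rho>. u m x) + 2 * (LINT x|\<rho>. u n x)" for m n
  proof -
    have "Re (l2 (F (r m) - F (r n)) (F (r m) - F (r n))) \<le> (LINT x|\<rho>. 2 * u m x + 2 * u n x)"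
      unfolding Re_l2_self
    proof (rule integral_mono)
      show "integrable \<rho> (\<lambda>x. (cmod ((F (r m) - F (r n)) x))\<^sup>2)"
        by (intro integrable_continuous continuous_cmod_sq H_closed F)
      show "integrable \<rho> (\<lambda>x. 2 * u m x + 2 * u n x)" using ui by simp
      fix x
      have "cmod ((F (r m) - F (r n)) x) \<le> cmod (F (r m) x - g x) + cmod (F (r n) x - g x)"
        using norm_triangle_ineq4[of "F (r m) x - g x" "F (r n) x - g x"] by simp
      then have "(cmod ((F (r m) - F (r n)) x))\<^sup>2 \<le>
          (cmod (F (r m) x - g x) + cmod (F (r n) x - g x))\<^sup>2"
        by (rule power_mono) simp
      also have "\<dots> \<le> 2 * u m x + 2 * u n x"
        using sum_squares_bound[of "cmod (F (r m) x - g x)" "cmod (F (r n) x - g x)"]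
        unfolding u_def power2_sum by linarith
      finally show "(cmod ((F (r m) - F (r n)) x))\<^sup>2 \<le> 2 * u m x + 2 * u n x" .
    qed
    also have "\<dots> = 2 * (LINT x|\<rho>. u m x) + 2 * (LINT x|\<rho>. u n x)"
      using ui by simp
    finally show ?thesis .
  qed
  have "\<exists>M. \<forall>m\<ge>M. \<forall>n\<ge>M. Re (l2 (F (r m) - F (r n)) (F (r m) - F (r n))) < \<epsilon>" if "\<epsilon> > 0" for \<epsilon>
  proof -
    have "\<epsilon> / 4 > 0" using that by simp
    then have "\<forall>\<^sub>F n in sequentially. (LINT x|\<rho>. u n x) < \<epsilon> / 4"
      using lim by (intro order_tendstoD) auto
    then obtain M where M: "\<And>n. n \<ge> M \<Longrightarrow> (LINT x|\<rho>. u n x) < \<epsilon> / 4"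
      unfolding eventually_sequentially by blast
    have "Re (l2 (F (r m) - F (r n)) (F (r m) - F (r n))) < \<epsilon>" if "m \<ge> M" "n \<ge> M" for m n
      using est[of m n] M[OF that(1)] M[OF that(2)] by linarith
    then show ?thesis by blast
  qed
  with r that show ?thesis by blast
qed

text \<open>Functions in \<open>H\<close> are continuous and the measure has full support, so the
  embedding is injective.\<close>

lemma l2_definite:
  assumes f: "f \<in> H" and zero: "Re (l2 f f) = 0" shows "f = 0"
proof
  fix x
  show "f x = 0 x"
  proof (cases "x \<in> D")
    case True
    have "(cmod (f x))\<^sup>2 = 0"
      by (rule integral_eq_0_D[OF continuous_cmod_sq[OF f] _ _ True]) (use zero in \<open>auto simp: Re_l2_self\<close>)
    then show ?thesis by simp
  next
    case False
    then show ?thesis using H_outside[OF f] by simp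
  qed
qed

text \<open>The Rayleigh quotient of \<open>T\<close> attains its supremum \<open>s\<close> on
  \<open>S\<close>. A maximizing sequence consists of approximate eigenvectors, and compactness
  makes its images under \<open>T\<close> converge along a subsequence; since \<open>s > 0\<close>,
  the sequence itself converges too. It is applied to the orthogonal complement of all listed
  eigenfunctions.\<close>

lemma eigenvector_exists:
  assumes S: "S \<subseteq> H" and scale: "\<And>c f. f \<in> S \<Longrightarrow> cscale c f \<in> S"
    and TS: "\<And>f. f \<in> S \<Longrightarrow> T f \<in> S"
    and closed: "\<And>F f. (\<And>n. F n \<in> S) \<Longrightarrow> f \<in> H \<Longrightarrow> (\<lambda>n. nrm (F n - f)) \<longlonglongrightarrow> 0 \<Longrightarrow> f \<in> S"
    and f0: "f0 \<in> S" "f0 \<noteq> 0"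
  obtains \<nu> g where "\<nu> > 0" "g \<in> S" "g \<noteq> 0" "T g = cscale (of_real \<nu>) g"
proof -
  note SH = subsetD[OF S]
  obtain C where C: "C \<ge> 0" "\<And>f. f \<in> H \<Longrightarrow> Re (l2 f f) \<le> (C * nrm f)\<^sup>2" using l2_bound by metis
  define U where "U = {f \<in> S. nrm f \<le> 1}"
  define s where "s = Sup ((\<lambda>f. Re (l2 f f)) ` U)"
  have UH: "f \<in> H" if "f \<in> U" for f using that S by (auto simp: U_def)
  have bdd: "bdd_above ((\<lambda>f. Re (l2 f f)) ` U)"
  proof (rule bdd_aboveI2)
    fix f assume f: "f \<in> U"
    have "(C * nrm f)\<^sup>2 \<le> (C * 1)\<^sup>2"
      using f UH C(1) by (intro power_mono mult_left_mono) (auto simp: U_def)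
    then show "Re (l2 f f) \<le> C\<^sup>2" using C(2)[OF UH[OF f]] by simp
  qed
  have s_upper: "Re (l2 f f) \<le> s" if "f \<in> U" for f
    unfolding s_def using that bdd by (auto intro: cSup_upper)
  have unit: "cscale (of_real (1 / nrm f)) f \<in> U" if "f \<in> S" "f \<noteq> 0" for f
  proof -
    have "nrm f \<noteq> 0" using that SH nrm_eq_0 by blast
    then have "nrm (cscale (of_real (1 / nrm f)) f) = 1"
      using that SH by (simp add: nrm_scale norm_divide)
    then show ?thesis using that scale by (simp add: U_def)
  qed
  have s_bound: "Re (l2 f f) \<le> s * (nrm f)\<^sup>2" if f: "f \<in> S" for f
  proof (cases "f = 0")
    case True
    then show ?thesis using C(2)[of 0] by (simp add: ip_norm_def)
  next
    case False
    then have n0: "nrm f \<noteq> 0" using f SH nrm_eq_0 by blast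
    have "(1 / nrm f)\<^sup>2 * Re (l2 f f) \<le> s"
      using s_upper[OF unit[OF f False]] f SH by (simp add: l2_scale_self del: of_real_divide)
    then show ?thesis using n0 by (simp add: field_simps)
  qed
  have s_pos: "s > 0"
  proof -
    have "Re (l2 f0 f0) \<noteq> 0" using l2_definite f0 SH by blast
    then have "0 < s * (nrm f0)\<^sup>2" using s_bound[OF f0(1)] l2_nonneg[of f0] by linarith
    then show ?thesis by (simp add: zero_less_mult_iff)
  qed
  define d :: "nat \<Rightarrow> real" where "d n = inverse (real (Suc n))" for n
  have d_pos: "d n > 0" for n by (simp add: d_def)
  have d_lim: "d \<longlonglongrightarrow> 0" unfolding d_def by (rule LIMSEQ_inverse_real_of_nat)
  have "\<exists>f\<in>U. s - d n < Re (l2 f f)" for n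
  proof -
    have "(\<lambda>f. Re (l2 f f)) ` U \<noteq> {}" using unit[OF f0] by blast
    then show ?thesis using less_cSupE[of "s - d n" "(\<lambda>f. Re (l2 f f)) ` U"] d_pos[of n]
      by (auto simp: s_def)
  qed
  then obtain F where FU: "\<And>n. F n \<in> U" and Fs: "\<And>n. s - d n < Re (l2 (F n) (F n))" by metis
  have FS: "F n \<in> S" and FH: "F n \<in> H" and F1: "nrm (F n) \<le> 1" for n
    using FU[of n] UH[of "F n"] by (auto simp: U_def)
  \<comment> \<open>Expand the square: both \<open>(nrm (T (F n)))\<^sup>2\<close> and
    \<open>s\<^sup>2 * (nrm (F n))\<^sup>2\<close> are at most \<open>s\<^sup>2\<close>, which
    leaves \<open>2 * s\<close> times the gap between \<open>s\<close> and the Rayleigh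
    value.\<close>
  have residual: "(nrm (T (F n) - cscale (of_real s) (F n)))\<^sup>2 \<le> 2 * s * d n" for n
  proof -
    let ?a = "Re (l2 (F n) (F n))"
    have a: "?a \<le> s" using s_upper FU by blast
    have "nrm (T (F n)) \<le> sqrt s * sqrt ?a"
    proof (rule T_norm_le[OF FH])
      show "Re (l2 (T (F n)) (T (F n))) \<le> (sqrt s * nrm (T (F n)))\<^sup>2"
        using s_bound[OF TS[OF FS]] s_pos by (simp add: power_mult_distrib)
    qed (use s_pos in simp)
    also have "\<dots> \<le> sqrt s * sqrt s"
      using a s_pos by (intro mult_left_mono) auto
    finally have "nrm (T (F n)) \<le> s" using s_pos by simp
    then have 1: "(nrm (T (F n)))\<^sup>2 \<le> s\<^sup>2" using FH by (intro power_mono) auto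
    have 2: "s\<^sup>2 * (nrm (F n))\<^sup>2 \<le> s\<^sup>2 * 1"
      using F1 FH by (intro mult_left_mono power_le_one) auto
    have "T (F n) - cscale (of_real s) (F n) = T (F n) + cscale (- of_real s) (F n)" by simp
    then have "(nrm (T (F n) - cscale (of_real s) (F n)))\<^sup>2 =
        (nrm (T (F n)))\<^sup>2 - 2 * s * ?a + s\<^sup>2 * (nrm (F n))\<^sup>2"
      using nrm_add_scale_sq[OF T_in[OF FH] FH, of n "- of_real s" n] FH s_pos
      by (simp add: T_ip)
    also have "\<dots> \<le> 2 * s * (s - ?a)"
      using 1 2 by (simp add: power2_eq_square algebra_simps)
    also have "\<dots> \<le> 2 * s * d n"
      using Fs[of n] s_pos by (intro mult_left_mono) auto
    finally show ?thesis .
  qed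
  define w where "w n = nrm (T (F n) - cscale (of_real s) (F n))" for n
  have w0: "w n \<ge> 0" for n using FH by (simp add: w_def)
  have w_lim: "w \<longlonglongrightarrow> 0"
  proof (rule tendsto_of_dist_bound)
    show "norm (w n - 0) \<le> sqrt (2 * s * d n)" for n
      using residual[of n] w0[of n] by (simp add: w_def real_le_rsqrt)
    have "(\<lambda>n. sqrt (2 * s * d n)) \<longlonglongrightarrow> sqrt (2 * s * 0)"
      by (intro tendsto_intros d_lim)
    then show "(\<lambda>n. sqrt (2 * s * d n)) \<longlonglongrightarrow> 0" by simp
  qed
  obtain r :: "nat \<Rightarrow> nat" where r: "strict_mono r" and
    cau: "\<And>\<epsilon>. \<epsilon> > 0 \<Longrightarrow> \<exists>M. \<forall>m\<ge>M. \<forall>n\<ge>M. Re (l2 (F (r m) - F (r n)) (F (r m) - F (r n))) < \<epsilon>"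
    by (rule l2_Cauchy_subsequence[of F 1, OF FH F1]) (rule that)
  have wr_lim: "(\<lambda>n. w (r n)) \<longlonglongrightarrow> 0"
    using LIMSEQ_subseq_LIMSEQ[OF w_lim r] by (simp add: o_def)
  obtain g where g: "g \<in> H" and g_lim: "(\<lambda>n. nrm (F (r n) - g)) \<longlonglongrightarrow> 0"
  proof (rule H_complete[of "\<lambda>n. F (r n)", OF FH])
    fix \<epsilon> :: real assume \<epsilon>: "\<epsilon> > 0"
    \<comment> \<open>A third for each of three terms: \<open>s\<close> times the difference
      \<open>?d\<close> equals \<open>T ?d\<close> minus the two residuals \<open>?u\<close> and
      \<open>?v\<close>, with signs, and all three become small.\<close>
    define \<epsilon>' where "\<epsilon>' = s * \<epsilon> / 3"
    have \<epsilon>': "\<epsilon>' > 0" using \<epsilon> s_pos by (simp add: \<epsilon>'_def)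
    obtain M1 where M1: "\<And>n. n \<ge> M1 \<Longrightarrow> w (r n) < \<epsilon>'"
      using order_tendstoD(2)[OF wr_lim \<epsilon>'] unfolding eventually_sequentially by blast
    have "(\<epsilon>' / (C + 1))\<^sup>2 > 0" using \<epsilon>' C(1) by simp
    then obtain M2 where M2: "\<And>m n. m \<ge> M2 \<Longrightarrow> n \<ge> M2 \<Longrightarrow>
        Re (l2 (F (r m) - F (r n)) (F (r m) - F (r n))) < (\<epsilon>' / (C + 1))\<^sup>2"
      using cau by meson
    have "nrm (F (r m) - F (r n)) < \<epsilon>" if "m \<ge> max M1 M2" "n \<ge> max M1 M2" for m n
    proof -
      let ?d = "F (r m) - F (r n)"
      have dH: "?d \<in> H" using FH by blast
      have "sqrt (Re (l2 ?d ?d)) \<le> \<epsilon>' / (C + 1)"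
        using M2[of m n] that \<epsilon>' C(1) by (intro real_le_lsqrt) auto
      then have "C * sqrt (Re (l2 ?d ?d)) \<le> C * (\<epsilon>' / (C + 1))" using C(1) by (rule mult_left_mono)
      also have "\<dots> \<le> \<epsilon>'" using C(1) \<epsilon>' by (simp add: field_simps)
      finally have Td: "nrm (T ?d) \<le> \<epsilon>'"
        using T_norm_le[OF dH C(1) C(2)[OF T_in[OF dH]]] by linarith
      let ?u = "T (F (r m)) - cscale (of_real s) (F (r m))"
      let ?v = "T (F (r n)) - cscale (of_real s) (F (r n))"
      have uv: "?u \<in> H" "?v \<in> H" using FH by auto
      have "cscale (of_real s) ?d = T ?d - (?u - ?v)"
        using FH by (simp add: T_diff cfun.scale_right_diff_distrib)
      then have "s * nrm ?d = nrm (T ?d - (?u - ?v))"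
        using nrm_scale[OF dH, of "of_real s"] s_pos by simp
      also have "\<dots> \<le> nrm (T ?d) + nrm (?u - ?v)"
        using dH uv by (intro nrm_triangle_diff) blast+
      also have "\<dots> \<le> nrm (T ?d) + (nrm ?u + nrm ?v)"
        using uv nrm_triangle_diff by auto
      also have "\<dots> < \<epsilon>' + (\<epsilon>' + \<epsilon>')"
        using Td M1[of m] M1[of n] that by (simp add: w_def)
      finally have "s * nrm ?d < s * \<epsilon>" by (simp add: \<epsilon>'_def mult.commute)
      then show ?thesis using s_pos by simp
    qed
    then show "\<exists>M. \<forall>m\<ge>M. \<forall>n\<ge>M. nrm (F (r m) - F (r n)) < \<epsilon>" by blast
  qed
  have gS: "g \<in> S" by (rule closed[OF FS g g_lim])
  obtain t where t: "t \<ge> 0" "\<And>f. f \<in> H \<Longrightarrow> nrm (T f) \<le> t * nrm f"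
    using pos_op_bounded[OF pos_op_T] by metis
  have eig: "T g = cscale (of_real s) g"
  proof -
    have "nrm (T g - cscale (of_real s) g) \<le> (t + s) * nrm (F (r n) - g) + w (r n)" for n
    proof -
      let ?d = "F (r n) - g"
      have dH: "?d \<in> H" using FH g by blast
      let ?u = "T (F (r n)) - cscale (of_real s) (F (r n))"
      have "T g - cscale (of_real s) g = ?u - (T ?d - cscale (of_real s) ?d)"
        using FH g by (simp add: T_diff cfun.scale_right_diff_distrib)
      then have "nrm (T g - cscale (of_real s) g) \<le> nrm ?u + nrm (T ?d - cscale (of_real s) ?d)"
        using FH dH by (simp add: nrm_triangle_diff)
      also have "nrm (T ?d - cscale (of_real s) ?d) \<le> nrm (T ?d) + nrm (cscale (of_real s) ?d)"
        using dH by (intro nrm_triangle_diff) auto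
      also have "\<dots> \<le> t * nrm ?d + s * nrm ?d"
        using t(2)[OF dH] nrm_scale[OF dH, of "of_real s"] s_pos by simp
      finally show ?thesis unfolding w_def distrib_right by linarith
    qed
    moreover have "(\<lambda>n. (t + s) * nrm (F (r n) - g) + w (r n)) \<longlonglongrightarrow> (t + s) * 0 + 0"
      by (intro tendsto_intros g_lim wr_lim)
    ultimately have "nrm (T g - cscale (of_real s) g) \<le> (t + s) * 0 + 0"
      by (intro LIMSEQ_le_const) auto
    then have "nrm (T g - cscale (of_real s) g) = 0"
      using nrm_nonneg[OF H_closed(3)[OF T_in[OF g] H_closed(4)[OF g]], of "of_real s"] by simp
    then have "T g - cscale (of_real s) g = 0"
      using nrm_eq_0 g by blast
    then show ?thesis by simp
  qed
  \<comment> \<open>If the limit were 0, the Rayleigh values, which approach \<open>s\<close>, would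
    tend to 0 together with the norms.\<close>
  have "g \<noteq> 0"
  proof
    assume "g = 0"
    then have "(\<lambda>n. (C * nrm (F (r n)))\<^sup>2 + d (r n)) \<longlonglongrightarrow> (C * 0)\<^sup>2 + 0"
      using g_lim LIMSEQ_subseq_LIMSEQ[OF d_lim r]
      by (intro tendsto_intros) (simp_all add: o_def)
    moreover have "s \<le> (C * nrm (F (r n)))\<^sup>2 + d (r n)" for n
      using Fs[of "r n"] C(2)[OF FH, of "r n"] by linarith
    ultimately have "s \<le> (C * 0)\<^sup>2 + 0"
      by (intro LIMSEQ_le_const) auto
    then show False using s_pos by simp
  qed
  then show ?thesis using that s_pos gS eig by blast
qed

subsection \<open>Greedy choice of sampling points\<close>

text \<open>\<open>trace A\<close> is the trace of \<open>T A\<close>, equivalently of the operator that \<open>A\<close> induces on \<open>L\<^sub>2\<close>.\<close>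

definition trace :: "(('a \<Rightarrow> complex) \<Rightarrow> ('a \<Rightarrow> complex)) \<Rightarrow> real" where
  "trace A = (LINT x|\<rho>. Re (ip (A (k x)) (k x)))"

lemma trace_nonneg: "pos_op A \<Longrightarrow> 0 \<le> trace A"
  unfolding trace_def using pos_op_nonneg by (intro integral_nonneg_AE AE_I2) (simp del: ip_k)

text \<open>The trace bounds the operator norm. Without square roots: \<open>A h x\<close> is the
  pairing of \<open>A h\<close> with \<open>k x\<close>, so Cauchy-Schwarz in the form of
  \<open>A\<close> holds pointwise and can be integrated over \<open>x\<close>.\<close>

lemma l2_op_le_trace:
  assumes A: "pos_op A" and h: "h \<in> H" shows "Re (l2 (A h) (A h)) \<le> Re (ip (A h) h) * trace A"
proof -
  have Ah: "A h \<in> H" using A h by blast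
  have "Re (l2 (A h) (A h)) \<le> (LINT x|\<rho>. Re (ip (A h) h) * Re (ip (A (k x)) (k x)))"
    unfolding Re_l2_self
  proof (rule integral_mono_D[OF continuous_cmod_sq[OF Ah] continuous_on_mult_left[OF continuous_op[OF A]]])
    fix x assume x: "x \<in> D"
    show "(cmod (A h x))\<^sup>2 \<le> Re (ip (A h) h) * Re (ip (A (k x)) (k x))"
      using pos_op_cauchy_schwarz[OF A h k_in[OF x]] ip_k[OF Ah x] by simp
  qed
  then show ?thesis by (simp add: trace_def)
qed

text \<open>
  \<open>dominates A X a \<mu>\<close> says that the quadratic form of \<open>a T + \<mu>\<close> on the functions vanishing on \<open>X\<close>
  is bounded below by the form of \<open>A\<^sup>-\<^sup>1\<close>; it is stated in the dual form, so that \<open>A\<close> need not be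
  invertible. \<open>a\<close> decreases from \<open>1\<close> to \<open>-1\<close> while points are added to \<open>X\<close>.
\<close>

definition dominates :: "(('a \<Rightarrow> complex) \<Rightarrow> ('a \<Rightarrow> complex)) \<Rightarrow> 'a set \<Rightarrow> real \<Rightarrow> real \<Rightarrow> bool" where
  "dominates A X a \<mu> \<longleftrightarrow> (\<forall>f\<in>H. (\<forall>x\<in>X. f x = 0) \<longrightarrow>
     (\<forall>h\<in>H. (cmod (ip f h))\<^sup>2 \<le> Re (ip (A h) h) * (a * Re (l2 f f) + \<mu> * (nrm f)\<^sup>2)))"

text \<open>The companion of \<open>l2_op_le_trace\<close> on the other side: \<open>T A T\<close>
  is at most \<open>trace A\<close> times \<open>T\<close>. The value \<open>z\<close> is also the
  L2 product of \<open>A (T f)\<close> with \<open>f\<close>, so Cauchy-Schwarz and the previous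
  bound yield a quadratic inequality in \<open>z\<close> from which one factor cancels.\<close>

lemma op_T_le_trace:
  assumes A: "pos_op A" and f: "f \<in> H"
  shows "Re (ip (A (T f)) (T f)) \<le> trace A * Re (l2 f f)"
proof -
  define z where "z = Re (ip (A (T f)) (T f))"
  have ATf: "A (T f) \<in> H" using A f by blast
  have z0: "0 \<le> z" unfolding z_def using A f by (intro pos_op_nonneg) auto
  have "z\<^sup>2 \<le> (cmod (l2 (A (T f)) f))\<^sup>2"
    using f ATf complex_Re_le_cmod[of "l2 (A (T f)) f"] z0 by (auto simp: z_def T_ip intro: power_mono)
  also have "\<dots> \<le> Re (l2 (A (T f)) (A (T f))) * Re (l2 f f)"
    by (rule l2_cauchy_schwarz[OF ATf f])
  also have "\<dots> \<le> (z * trace A) * Re (l2 f f)"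
    unfolding z_def using A f by (intro mult_right_mono l2_op_le_trace) auto
  finally have "z * z \<le> z * (trace A * Re (l2 f f))" by (simp add: power2_eq_square mult.assoc)
  moreover have "0 \<le> trace A * Re (l2 f f)" using trace_nonneg[OF A] by simp
  ultimately have "z \<le> trace A * Re (l2 f f)" using z0
    by (cases "z = 0") (auto simp: mult_le_cancel_left)
  then show ?thesis by (simp add: z_def)
qed

text \<open>
  \<open>A + 2 \<delta> A T A\<close> is an upper bound for \<open>A (1 - \<delta> T A)\<^sup>-\<^sup>1 = (A\<^sup>-\<^sup>1 - \<delta> T)\<^sup>-\<^sup>1\<close> as long as
  \<open>\<delta> trace A \<le> 1/2\<close>.
\<close>

lemma dominates_shift:
  assumes A: "pos_op A" and dom: "dominates A X a \<mu>" and \<delta>: "0 \<le> \<delta>" "\<delta> * trace A \<le> 1 / 2"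
  shows "dominates (\<lambda>f. A f + cscale (of_real (2 * \<delta>)) (A (T (A f)))) X (a - \<delta>) \<mu>"
  unfolding dominates_def
proof (intro ballI impI)
  fix f c assume f: "f \<in> H" and fX: "\<forall>x\<in>X. f x = 0" and c: "c \<in> H"
  define N where "N = Re (l2 f f)"
  define p where "p = a * N + \<mu> * (nrm f)\<^sup>2"
  define n where "n = \<delta> * N"
  define E where "E h = Re (ip (A h + cscale (of_real (2 * \<delta>)) (A (T (A h)))) h)" for h
  have domf: "(cmod (ip f h))\<^sup>2 \<le> Re (ip (A h) h) * p" if "h \<in> H" for h
    using dom f fX that unfolding dominates_def p_def N_def by blast
  note Acl = pos_op_closed[OF A]
  have E_eq: "E h = Re (ip (A h) h) + 2 * \<delta> * Re (l2 (A h) (A h))" if h: "h \<in> H" for h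
  proof -
    have "ip (A (T (A h))) h = ip (T (A h)) (A h)" using h Acl by (intro pos_op_sym[OF A]) auto
    then show ?thesis using h Acl by (simp add: E_def T_ip')
  qed
  have E_nonneg: "0 \<le> E h" if "h \<in> H" for h
    using that \<delta>(1) pos_op_nonneg[OF A that] by (simp add: E_eq)
  show "(cmod (ip f c))\<^sup>2 \<le> Re (ip (A c + cscale (of_real (2 * \<delta>)) (A (T (A c)))) c) *
      ((a - \<delta>) * Re (l2 f f) + \<mu> * (nrm f)\<^sup>2)"
  proof (cases "f = 0")
    case True
    then have "Re (l2 f f) = 0" "nrm f = 0" by (simp_all add: Re_l2_self ip_norm_def)
    then show ?thesis using True c by simp
  next
    case False
    have N0: "0 \<le> N" by (simp add: N_def)
    \<comment> \<open>Testing the domination with \<open>h = f\<close>: the left side is positive,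
      so the form on the right must be.\<close>
    have p0: "p > 0"
    proof -
      have "ip f f \<noteq> 0" using False ip_eq_0[OF f] by blast
      then have "0 < (cmod (ip f f))\<^sup>2" by simp
      then have "0 < Re (ip (A f) f) * p" using domf[OF f] by linarith
      then show ?thesis using pos_op_nonneg[OF A f] by (simp add: zero_less_mult_iff)
    qed
    have opT: "Re (ip (A (T f)) (T f)) \<le> trace A * N"
      unfolding N_def by (rule op_T_le_trace[OF A f])
    \<comment> \<open>Testing the domination with \<open>h = T f\<close> gives
      \<open>N \<le> trace A * p\<close>. So the loss \<open>n\<close> takes at most half of the
      form and \<open>p - n\<close> stays positive.\<close>
    have np: "n \<le> p / 2"
    proof -
      have "N * N = (cmod (ip f (T f)))\<^sup>2"
        using f by (simp add: T_ip N_def l2_self power2_eq_square abs_mult_self_eq del: of_real_mult)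
      also have "\<dots> \<le> Re (ip (A (T f)) (T f)) * p" using f by (intro domf) auto
      also have "\<dots> \<le> (trace A * N) * p" using opT p0 by (intro mult_right_mono) auto
      finally have "N * N \<le> N * (trace A * p)" by (simp add: mult_ac)
      then have "N \<le> trace A * p"
        using N0 trace_nonneg[OF A] p0 by (cases "N = 0") (auto simp: mult_le_cancel_left)
      then have "n \<le> \<delta> * (trace A * p)" unfolding n_def using \<delta>(1) by (rule mult_left_mono)
      also have "\<dots> \<le> p / 2" using mult_right_mono[OF \<delta>(2), of p] p0 by (simp add: mult.assoc)
      finally show ?thesis .
    qed
    have n0: "0 \<le> n" using \<delta>(1) N0 by (simp add: n_def)
    have main: "p - n \<le> E h" if h: "h \<in> H" and ph: "ip f h = of_real (p - n)" for h
    proof -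
      \<comment> \<open>The perturbation \<open>\<delta> T f\<close> raises the pairing with
        \<open>f\<close> from \<open>p - n\<close> to \<open>p\<close>, exactly the value at which
        the old domination yields \<open>p \<le> Re (ip (A b) b)\<close>.\<close>
      define b where "b = h + cscale (of_real \<delta>) (T f)"
      have b: "b \<in> H" using h f by (simp add: b_def)
      have Tf: "T f \<in> H" using f by blast
      have "ip f b = of_real (p - n) + of_real \<delta> * l2 f f"
        using f h by (simp add: b_def ph T_ip)
      also have "\<dots> = of_real p" by (simp add: l2_self n_def N_def)
      finally have "p\<^sup>2 \<le> Re (ip (A b) b) * p" using domf[OF b] by simp
      then have "p \<le> Re (ip (A b) b)" using p0 by (simp add: power2_eq_square)
      also have "Re (ip (A b) b) = Re (ip (A h) h) + 2 * \<delta> * Re (l2 (A h) f) + \<delta>\<^sup>2 * Re (ip (A (T f)) (T f))"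
      proof -
        have "ip (A (T f)) h = cnj (l2 (A h) f)"
          using f h Acl Tf ip_cnj[of "A h" "T f"] pos_op_sym[OF A Tf h] ip_cnj[of h "A (T f)"]
            pos_op_sym[OF A h Tf] by (simp add: T_ip)
        moreover have "ip (A h) (T f) = l2 (A h) f" using f h Acl by (simp add: T_ip)
        moreover have "A b = A h + cscale (of_real \<delta>) (A (T f))"
          using h Tf by (simp add: b_def pos_op_add[OF A] pos_op_scale[OF A])
        moreover have "ip (A h + cscale (of_real \<delta>) (A (T f))) b =
            ip (A h) h + of_real \<delta> * ip (A h) (T f) + of_real \<delta> * ip (A (T f)) h
            + of_real (\<delta>\<^sup>2) * ip (A (T f)) (T f)"
          using h Tf Acl by (simp add: b_def ring_distribs power2_eq_square)
        ultimately show ?thesis by simp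
      qed
      also have "\<dots> \<le> E h + n"
      proof -
        \<comment> \<open>The weights 2 and 1/2 are chosen so that the mixed term costs the
          available \<open>2 * \<delta> * Re (l2 (A h) (A h))\<close> plus \<open>n / 2\<close>. The
          term quadratic in \<open>\<delta>\<close> costs the other \<open>n / 2\<close>.\<close>
        have "Re (l2 (A h) f) \<le> sqrt (Re (l2 (A h) (A h)) * N)"
          using l2_cauchy_schwarz[OF Acl[OF h] f] complex_Re_le_cmod[of "l2 (A h) f"]
          unfolding N_def by (meson order_trans real_le_rsqrt)
        also have "\<dots> = sqrt (2 * Re (l2 (A h) (A h)) * (N / 2))" by simp
        also have "\<dots> \<le> (2 * Re (l2 (A h) (A h)) + N / 2) / 2"
          using N0 by (intro arith_geo_mean_sqrt) auto
        finally have "\<delta> * (2 * Re (l2 (A h) f)) \<le> \<delta> * (2 * Re (l2 (A h) (A h)) + N / 2)"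
          using \<delta>(1) by (intro mult_left_mono) auto
        moreover have "\<delta>\<^sup>2 * Re (ip (A (T f)) (T f)) \<le> n / 2"
        proof -
          have "\<delta>\<^sup>2 * Re (ip (A (T f)) (T f)) \<le> \<delta>\<^sup>2 * (trace A * N)"
            using opT by (intro mult_left_mono) auto
          also have "\<dots> = (\<delta> * trace A) * n" by (simp add: n_def power2_eq_square)
          also have "\<dots> \<le> 1 / 2 * n" using \<delta>(2) n0 by (rule mult_right_mono)
          finally show ?thesis by simp
        qed
        ultimately show ?thesis unfolding E_eq[OF h] by (simp add: n_def algebra_simps)
      qed
      finally show ?thesis by simp
    qed
    have "(cmod (ip f c))\<^sup>2 \<le> E c * (p - n)"
    proof (cases "ip f c = 0")
      case True
      then show ?thesis using E_nonneg[OF c] np p0 by simp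
    next
      case False
      \<comment> \<open>Both sides of the claim are homogeneous of degree two in \<open>c\<close>,
        so \<open>c\<close> may be rescaled to the normalization required by
        \<open>main\<close>.\<close>
      define t where "t = cnj (of_real (p - n) / ip f c)"
      have tH: "cscale t c \<in> H" using c by blast
      have "ip f (cscale t c) = of_real (p - n)" using f c False by (simp add: t_def)
      then have "p - n \<le> E (cscale t c)" by (rule main[OF tH])
      also have "E (cscale t c) = (cmod t)\<^sup>2 * E c"
      proof -
        have ATA: "pos_op (\<lambda>f. A f + cscale (of_real (2 * \<delta>)) (A (T (A f))))"
          using \<delta>(1) by (intro pos_op_add_sandwich A pos_op_T) simp
        have "cnj t * t = of_real ((cmod t)\<^sup>2)" unfolding complex_norm_square by (rule mult.commute)
        then show ?thesis
          unfolding E_def using c pos_op_scale[OF ATA c, of t] pos_op_closed[OF ATA c]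
          by (simp add: mult.assoc[symmetric] del: of_real_power of_real_mult)
      qed
      also have "(cmod t)\<^sup>2 = (p - n)\<^sup>2 / (cmod (ip f c))\<^sup>2"
        using np p0 by (simp add: t_def norm_divide power_divide del: of_real_diff)
      finally have "p - n \<le> (p - n)\<^sup>2 / (cmod (ip f c))\<^sup>2 * E c" .
      then have "(p - n) * (cmod (ip f c))\<^sup>2 \<le> (p - n) * (E c * (p - n))"
        using False by (simp add: field_simps power2_eq_square)
      moreover have "p - n > 0" using np p0 by simp
      ultimately show ?thesis by (rule mult_left_le_imp_le)
    qed
    moreover have "p - n = (a - \<delta>) * Re (l2 f f) + \<mu> * (nrm f)\<^sup>2"
      by (simp add: p_def n_def N_def algebra_simps)
    ultimately show ?thesis by (simp add: E_def)
  qed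
qed

text \<open>Replacing \<open>h\<close> by its part \<open>h'\<close> orthogonal to
  \<open>k x\<close> in the form of \<open>A\<close> changes nothing in the pairing with
  \<open>f\<close>, because \<open>f x = 0\<close>, and turns the old form at \<open>h'\<close> into
  the new form at \<open>h\<close>. Adding a point therefore loses nothing.\<close>

lemma dominates_deflate:
  assumes A: "pos_op A" and dom: "dominates A X a \<mu>" and x: "x \<in> D"
    and pos: "0 < Re (ip (A (k x)) (k x))"
  shows "dominates (\<lambda>f. A (f - cscale (ip (A f) (k x) / ip (A (k x)) (k x)) (k x))) (insert x X) a \<mu>"
  unfolding dominates_def
proof (intro ballI impI)
  fix f h assume f: "f \<in> H" and fX: "\<forall>y\<in>insert x X. f y = 0" and h: "h \<in> H"
  define b where "b = ip (A h) (k x) / ip (A (k x)) (k x)"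
  define h' where "h' = h - cscale b (k x)"
  have h': "h' \<in> H" using h x by (simp add: h'_def)
  have Ah': "A h' \<in> H" using A h' by blast
  have kx: "k x \<in> H" using x by blast
  have "ip (A h') (k x) = 0"
    unfolding h'_def b_def by (rule pos_op_deflate(3)[OF A kx pos h])
  then have "ip (A h') h = ip (A h') h'"
    using h kx Ah' by (simp add: h'_def del: ip_k)
  moreover have "ip f h' = ip f h" using f h x fX by (simp add: h'_def)
  moreover have "(cmod (ip f h'))\<^sup>2 \<le> Re (ip (A h') h') * (a * Re (l2 f f) + \<mu> * (nrm f)\<^sup>2)"
    using dom f fX h' unfolding dominates_def by blast
  ultimately show "(cmod (ip f h))\<^sup>2 \<le>
      Re (ip (A (h - cscale (ip (A h) (k x) / ip (A (k x)) (k x)) (k x))) h) *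
      (a * Re (l2 f f) + \<mu> * (nrm f)\<^sup>2)"
    by (simp add: h'_def b_def)
qed

lemma dominates_mono: "dominates A X a \<mu> \<Longrightarrow> X \<subseteq> Y \<Longrightarrow> dominates A Y a \<mu>"
  unfolding dominates_def by blast

text \<open>An account of the trace. Lowering \<open>a\<close> replaces \<open>A\<close> by
  \<open>B\<close> and costs \<open>2 * \<delta> * V\<close>; adding \<open>x\<close> gains
  \<open>w x / u x\<close>. The integrals of \<open>w\<close> and \<open>u\<close> are
  \<open>W\<close> and \<open>trace B\<close>, so some point gains at least
  \<open>W / trace B\<close>, and this covers the cost since \<open>V \<le> W\<close> and
  \<open>2 * \<delta> * trace B \<le> 1\<close>.\<close>

lemma greedy_step:
  assumes A: "pos_op A" and dom: "dominates A X a \<mu>" and M: "trace A \<le> M" "0 < M"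
  obtains A' x where "pos_op A'" "x \<in> D" "dominates A' (insert x X) (a - 1 / (4 * M)) \<mu>" "trace A' \<le> M"
proof -
  \<comment> \<open>Two requirements: \<open>dominates_shift\<close> asks for
    \<open>\<delta> * trace A \<le> 1 / 2\<close>, and \<open>drop\<close> for
    \<open>2 * \<delta> * trace B \<le> 1\<close>. The latter becomes an exact fit with the estimate
    \<open>trace B \<le> 2 * M\<close>.\<close>
  define \<delta> where "\<delta> = 1 / (4 * M)"
  have \<delta>: "0 \<le> \<delta>" "\<delta> * M = 1 / 4" using M by (simp_all add: \<delta>_def)
  have \<delta>tr: "\<delta> * trace A \<le> 1 / 4" using mult_left_mono[OF M(1) \<delta>(1)] \<delta>(2) by simp
  define B where "B f = A f + cscale (of_real (2 * \<delta>)) (A (T (A f)))" for f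
  have B: "pos_op B"
    unfolding B_def using \<delta>(1) by (intro pos_op_add_sandwich A pos_op_T) simp
  have domB: "dominates B X (a - \<delta>) \<mu>"
    unfolding B_def using \<delta>tr by (intro dominates_shift A dom \<delta>(1)) simp
  note Acl = pos_op_closed[OF A] and Bcl = pos_op_closed[OF B]
  define v where "v x = Re (l2 (A (k x)) (A (k x)))" for x
  define w where "w x = Re (l2 (B (k x)) (B (k x)))" for x
  define u where "u x = Re (ip (B (k x)) (k x))" for x
  have ATA: "Re (ip (C (T (C h))) h) = Re (l2 (C h) (C h))" if C: "pos_op C" and h: "h \<in> H" for C h
    using h pos_op_closed[OF C] by (simp add: pos_op_sym[OF C] T_ip')
  have v_cont: "continuous_on D v"
    using continuous_op[OF pos_op_sandwich[OF A pos_op_T]] by (rule continuous_on_eq) (simp add: ATA[OF A] v_def del: ip_k)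
  have w_cont: "continuous_on D w"
    using continuous_op[OF pos_op_sandwich[OF B pos_op_T]] by (rule continuous_on_eq) (simp add: ATA[OF B] w_def del: ip_k)
  have u_cont: "continuous_on D u" unfolding u_def by (rule continuous_op[OF B])
  have u0: "0 \<le> u x" if "x \<in> D" for x unfolding u_def using that by (intro pos_op_nonneg B) auto
  define V where "V = (LINT x|\<rho>. v x)"
  define W where "W = (LINT x|\<rho>. w x)"
  have V0: "0 \<le> V" unfolding V_def v_def by (intro integral_nonneg_AE AE_I2) simp
  have trB: "trace B = trace A + 2 * \<delta> * V"
  proof -
    have "trace B = (LINT x|\<rho>. Re (ip (A (k x)) (k x)) + 2 * \<delta> * v x)"
      unfolding trace_def
    proof (rule Bochner_Integration.integral_cong[OF refl])
      fix x assume "x \<in> space \<rho>"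
      then have x: "k x \<in> H" by auto
      have "A (T (A (k x))) \<in> H" using Acl x by blast
      then show "Re (ip (B (k x)) (k x)) = Re (ip (A (k x)) (k x)) + 2 * \<delta> * v x"
        using x Acl[OF x] ATA[OF A x] by (simp add: B_def v_def del: ip_k)
    qed
    also have "\<dots> = trace A + 2 * \<delta> * V"
      using integrable_continuous[OF continuous_op[OF A]] integrable_continuous[OF v_cont]
      by (simp add: trace_def V_def del: ip_k)
    finally show ?thesis .
  qed
  have V_le: "V \<le> trace A * trace A"
  proof -
    have "V \<le> (LINT x|\<rho>. Re (ip (A (k x)) (k x)) * trace A)"
      unfolding V_def v_def[abs_def]
      by (rule integral_mono_D[OF v_cont[unfolded v_def[abs_def]] continuous_on_mult_right[OF continuous_op[OF A]]])
        (rule l2_op_le_trace[OF A k_in])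
    then show ?thesis by (simp add: trace_def)
  qed
  \<comment> \<open>The cost is measured with \<open>A\<close>, the gain with \<open>B\<close>. For
    \<open>g = A (k x)\<close>, \<open>B (k x)\<close> is \<open>g\<close> plus a nonnegative
    multiple of \<open>A (T g)\<close>, and the L2 product of these two is the form of
    \<open>A\<close> at \<open>T g\<close>, hence nonnegative.\<close>
  have V_le_W: "V \<le> W"
    unfolding V_def W_def
  proof (rule integral_mono_D[OF v_cont w_cont])
    fix x assume "x \<in> D"
    then have x: "k x \<in> H" by blast
    define g where "g = A (k x)"
    have g: "g \<in> H" using Acl x by (simp add: g_def)
    define h where "h = A (T g)"
    have h: "h \<in> H" using Acl g by (simp add: h_def)
    define c where "c = complex_of_real (2 * \<delta>)"
    have ch: "cscale c h \<in> H" using h by blast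
    have Re_gh: "0 \<le> Re (l2 g h)"
    proof -
      have "l2 g h = ip (T g) h" using T_ip'[OF g h] by simp
      then show ?thesis unfolding h_def using pos_op_nonneg'[OF A T_in[OF g]] by simp
    qed
    have gB: "B (k x) = g + cscale c h" by (simp add: B_def g_def h_def c_def)
    have "l2 (g + cscale c h) (g + cscale c h) = l2 g (g + cscale c h) + c * l2 h (g + cscale c h)"
      using l2_add[OF g ch H_closed(2)[OF g ch]] by (simp add: l2_scale)
    moreover have "l2 g (g + cscale c h) = cnj (l2 g g + c * l2 h g)"
      using l2_cnj[of g "g + cscale c h"] l2_add[OF g ch g] by (simp add: l2_scale)
    moreover have "l2 h (g + cscale c h) = cnj (l2 g h + c * l2 h h)"
      using l2_cnj[of h "g + cscale c h"] l2_add[OF g ch h] by (simp add: l2_scale)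
    moreover have "l2 h g = cnj (l2 g h)" by (rule l2_cnj)
    ultimately have "Re (l2 (g + cscale c h) (g + cscale c h)) =
        Re (l2 g g) + 4 * \<delta> * Re (l2 g h) + (2 * \<delta>) * (2 * \<delta>) * Re (l2 h h)"
      by (simp add: c_def algebra_simps)
    then show "v x \<le> w x"
      using Re_gh \<delta>(1) by (simp add: v_def w_def gB g_def[symmetric])
  qed
  show ?thesis
  \<comment> \<open>If \<open>V = 0\<close>, lowering \<open>a\<close> costs nothing and any point
    will do. Otherwise \<open>trace B\<close> is positive and may serve as a denominator.\<close>
  proof (cases "V = 0")
    case True
    obtain x where "x \<in> D" using nonempty_D by blast
    moreover have "dominates B (insert x X) (a - \<delta>) \<mu>" using domB by (rule dominates_mono) blast
    ultimately show ?thesis using that[OF B] trB True M(1) by (simp add: \<delta>_def)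
  next
    case False
    then have Vpos: "V > 0" using V0 by simp
    have trBpos: "trace B > 0"
    proof (rule ccontr)
      assume "\<not> ?thesis"
      then have "trace B = 0" using trace_nonneg[OF B] by simp
      have "W \<le> (LINT x|\<rho>. Re (ip (B (k x)) (k x)) * trace B)"
        unfolding W_def w_def[abs_def]
        by (rule integral_mono_D[OF w_cont[unfolded w_def[abs_def]] continuous_on_mult_right[OF continuous_op[OF B]]])
          (rule l2_op_le_trace[OF B k_in])
      then show False using \<open>trace B = 0\<close> V_le_W Vpos by simp
    qed
    have drop: "2 * \<delta> * trace B \<le> 1"
    proof -
      have "2 * \<delta> * V \<le> 2 * \<delta> * (trace A * M)"
        using V_le mult_left_mono[OF M(1) trace_nonneg[OF A]] \<delta>(1)
        by (intro mult_left_mono) auto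
      also have "\<dots> = trace A / 2" using \<delta>(2) by (simp add: mult.left_commute mult.commute)
      finally have "trace B \<le> 2 * M" using M(1) trace_nonneg[OF A] trB M(2) by linarith
      then have "2 * \<delta> * trace B \<le> 2 * \<delta> * (2 * M)" using \<delta>(1) by (intro mult_left_mono) auto
      then show ?thesis using \<delta>(2) by simp
    qed
    have "\<exists>x\<in>D. u x > 0 \<and> W / trace B * u x \<le> w x"
    proof (rule ccontr)
      assume neg: "\<not> ?thesis"
      \<comment> \<open>Points with \<open>u x = 0\<close> cannot be added, but there
        \<open>w x = 0\<close> as well. So \<open>W / trace B * u x - w x\<close> is nonnegative
        with integral 0, hence zero throughout \<open>D\<close>; this rules out the strict
        alternative and leaves \<open>u = 0\<close> on \<open>D\<close>.\<close>
      have lt: "w x < W / trace B * u x \<or> (u x = 0 \<and> w x = 0)" if x: "x \<in> D" for x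
      proof (cases "u x > 0")
        case True then show ?thesis using neg x by force
      next
        case False
        then have "u x = 0" using u0[OF x] by simp
        moreover have "w x \<le> u x * trace B"
          unfolding w_def u_def using x by (intro l2_op_le_trace B) auto
        ultimately show ?thesis by (simp add: w_def antisym)
      qed
      have cont: "continuous_on D (\<lambda>x. W / trace B * u x - w x)"
        by (intro continuous_intros u_cont w_cont)
      have "trace B = (LINT x|\<rho>. u x)" by (simp only: trace_def u_def)
      then have "(LINT x|\<rho>. W / trace B * u x - w x) = W / trace B * trace B - W"
        using integrable_continuous[OF u_cont] integrable_continuous[OF w_cont]
        by (simp add: W_def[symmetric])
      also have "\<dots> = 0" using trBpos by simp
      finally have zero: "(LINT x|\<rho>. W / trace B * u x - w x) = 0" .
      have "W / trace B * u x - w x = 0" if x: "x \<in> D" for x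
        by (rule integral_eq_0_D[OF cont _ zero x]) (use lt in fastforce)
      then have "u x = 0" if "x \<in> D" for x using lt[OF that] that by force
      then have "trace B = (LINT x|\<rho>. 0)"
        unfolding trace_def by (intro Bochner_Integration.integral_cong) (auto simp: u_def)
      then show False using trBpos by simp
    qed
    then obtain x where x: "x \<in> D" and ux: "u x > 0" and wx: "W / trace B * u x \<le> w x" by blast
    have kx: "k x \<in> H" using x by blast
    define A' where "A' f = B (f - cscale (ip (B f) (k x) / ip (B (k x)) (k x)) (k x))" for f
    have pos: "0 < Re (ip (B (k x)) (k x))" using ux by (simp add: u_def)
    have A': "pos_op A'" unfolding A'_def by (rule pos_op_deflate(1)[OF B kx pos])
    have dom': "dominates A' (insert x X) (a - \<delta>) \<mu>"
      unfolding A'_def by (rule dominates_deflate[OF B domB x pos])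
    have "trace A' = (LINT y|\<rho>. u y - (cmod (B (k x) y))\<^sup>2 / u x)"
      unfolding trace_def
    proof (rule Bochner_Integration.integral_cong[OF refl])
      fix y assume "y \<in> space \<rho>"
      then have y: "y \<in> D" by simp
      have "ip (B (k y)) (k x) = cnj (ip (B (k x)) (k y))"
        using ip_cnj[of "B (k x)" "k y"] pos_op_sym[OF B k_in[OF y] kx] Bcl[OF kx] y by (simp del: ip_k)
      then have "cmod (ip (B (k y)) (k x)) = cmod (B (k x) y)"
        using Bcl[OF kx] y by simp
      then show "Re (ip (A' (k y)) (k y)) = u y - (cmod (B (k x) y))\<^sup>2 / u x"
        unfolding A'_def u_def pos_op_deflate(2)[OF B kx pos k_in[OF y]] by (simp only:)
    qed
    also have "\<dots> = (LINT y|\<rho>. u y) - (LINT y|\<rho>. (cmod (B (k x) y))\<^sup>2) / u x"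
      using integrable_continuous[OF u_cont] integrable_continuous[OF continuous_cmod_sq[OF Bcl[OF kx]]]
      by simp
    also have "\<dots> = trace B - w x / u x"
      by (simp only: trace_def u_def w_def Re_l2_self)
    also have "\<dots> \<le> M"
    proof -
      have "2 * \<delta> * V \<le> W / trace B"
      proof -
        have "2 * \<delta> * V * trace B = (2 * \<delta> * trace B) * V" by simp
        also have "\<dots> \<le> 1 * V" using drop V0 by (rule mult_right_mono)
        finally show ?thesis using V_le_W trBpos by (simp add: le_divide_eq)
      qed
      also have "\<dots> \<le> w x / u x" using wx ux by (simp add: le_divide_eq)
      finally show ?thesis using trB M(1) by linarith
    qed
    finally show ?thesis using that[OF A' x] dom' by (simp add: \<delta>_def)
  qed
qed

lemma greedy_points:
  assumes A: "pos_op A" and dom: "dominates A {} 1 \<mu>" and M: "trace A \<le> M" "0 < M"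
  shows "\<exists>X A'. (\<forall>i<n. X i \<in> D) \<and> pos_op A' \<and> trace A' \<le> M \<and>
    dominates A' (X ` {..<n}) (1 - real n / (4 * M)) \<mu>"
proof (induction n)
  case 0
  show ?case using A dom M by (intro exI[of _ undefined] exI[of _ A]) simp
next
  case (Suc n)
  then obtain X A' where X: "\<forall>i<n. X i \<in> D" and A': "pos_op A'" "trace A' \<le> M"
    "dominates A' (X ` {..<n}) (1 - real n / (4 * M)) \<mu>" by blast
  obtain A'' x where *: "pos_op A''" "x \<in> D" "trace A'' \<le> M"
    "dominates A'' (insert x (X ` {..<n})) (1 - real n / (4 * M) - 1 / (4 * M)) \<mu>"
    using greedy_step[OF A'(1,3,2) M(2)] by metis
  have "(X(n := x)) ` {..<Suc n} = insert x (X ` {..<n})"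
    by (auto simp: lessThan_Suc)
  moreover have "1 - real n / (4 * M) - 1 / (4 * M) = 1 - real (Suc n) / (4 * M)"
    by (simp add: add_divide_distrib)
  ultimately have "dominates A'' ((X(n := x)) ` {..<Suc n}) (1 - real (Suc n) / (4 * M)) \<mu>"
    using *(4) by (simp only:)
  moreover have "\<forall>i<Suc n. (X(n := x)) i \<in> D" using X *(2) by (auto simp: less_Suc_eq)
  ultimately show ?case using *(1,3) by blast
qed

text \<open>Test with \<open>h = f\<close>: if the claim failed, the right side would be at most 0,
  forcing \<open>f = 0\<close>.\<close>

lemma dominates_negative:
  assumes A: "pos_op A" and dom: "dominates A X (- 1) \<mu>" and \<mu>: "0 \<le> \<mu>"
    and f: "f \<in> H" and fX: "\<And>x. x \<in> X \<Longrightarrow> f x = 0"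
  shows "Re (l2 f f) \<le> \<mu> * (nrm f)\<^sup>2"
proof (rule ccontr)
  assume neg: "\<not> ?thesis"
  have "(cmod (ip f f))\<^sup>2 \<le> Re (ip (A f) f) * (- 1 * Re (l2 f f) + \<mu> * (nrm f)\<^sup>2)"
    using dom f fX unfolding dominates_def by blast
  also have "\<dots> \<le> 0"
    using neg pos_op_nonneg[OF A f] by (intro mult_nonneg_nonpos) auto
  finally have "ip f f = 0" by simp
  then have "f = 0" using ip_eq_0 f by blast
  then show False using neg by (simp add: Re_l2_self ip_norm_def)
qed

subsection \<open>Sampling numbers and interpolation\<close>

text \<open>The sum is the minimal norm interpolant. Conditions are placed on the residual instead
  of asking for Lagrange functions, which do not exist when points coincide or kernel sections are
  dependent. The second clause puts each \<open>\<psi> i\<close> into the span of the sections and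
  carries the induction.\<close>

definition interpolates :: "nat \<Rightarrow> (nat \<Rightarrow> 'a) \<Rightarrow> (nat \<Rightarrow> 'a \<Rightarrow> complex) \<Rightarrow> bool" where
  "interpolates n X \<psi> \<longleftrightarrow> (\<forall>i<n. \<psi> i \<in> H) \<and>
    (\<forall>g\<in>H. (\<forall>i<n. g (X i) = 0) \<longrightarrow> (\<forall>i<n. ip g (\<psi> i) = 0)) \<and>
    (\<forall>f\<in>H. \<forall>j<n. (f - (\<Sum>i<n. cscale (f (X i)) (\<psi> i))) (X j) = 0) \<and>
    (\<forall>f\<in>H. nrm (f - (\<Sum>i<n. cscale (f (X i)) (\<psi> i))) \<le> nrm f)"

lemma interpolatesD:
  assumes "interpolates n X \<psi>"
  shows "i < n \<Longrightarrow> \<psi> i \<in> H"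
    and "g \<in> H \<Longrightarrow> (\<And>i. i < n \<Longrightarrow> g (X i) = 0) \<Longrightarrow> i < n \<Longrightarrow> ip g (\<psi> i) = 0"
    and "f \<in> H \<Longrightarrow> j < n \<Longrightarrow> (f - (\<Sum>i<n. cscale (f (X i)) (\<psi> i))) (X j) = 0"
    and "f \<in> H \<Longrightarrow> nrm (f - (\<Sum>i<n. cscale (f (X i)) (\<psi> i))) \<le> nrm f"
  using assms unfolding interpolates_def by blast+

text \<open>Newton interpolation: each new point adds a correction by \<open>g\<close>, the part of
  its kernel section orthogonal to the functions already used. On functions vanishing at the earlier
  points, pairing with \<open>g\<close> is evaluation at the new point.\<close>

lemma interpolates_ex:
  assumes "\<forall>i<n. X i \<in> D"
  shows "\<exists>\<psi>. interpolates n X \<psi>"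
  using assms
proof (induction n)
  case 0
  then show ?case by (simp add: interpolates_def)
next
  case (Suc n)
  have x: "X n \<in> D" using Suc.prems by simp
  obtain \<psi> where "interpolates n X \<psi>" using Suc.IH Suc.prems less_Suc_eq by auto
  note \<psi> = interpolatesD(1)[OF this] and orth = interpolatesD(2)[OF this]
    and van = interpolatesD(3)[OF this] and le = interpolatesD(4)[OF this]
  define P where "P f = (\<Sum>i<n. cscale (f (X i)) (\<psi> i))" for f :: "'a \<Rightarrow> complex"
  have P: "P f \<in> H" for f unfolding P_def using \<psi> by (intro H_sum H_closed) auto
  have orthP: "ip g (P f) = 0" if g: "g \<in> H" and v: "\<And>i. i < n \<Longrightarrow> g (X i) = 0" for f g
  proof -
    have "ip (P f) g = (\<Sum>i<n. ip (cscale (f (X i)) (\<psi> i)) g)"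
      unfolding P_def using \<psi> g by (intro ip_sum_left) auto
    also have "\<dots> = 0"
      using \<psi> g orth[OF g v] by (intro sum.neutral) (auto simp: ip_cnj[of g])
    finally show ?thesis using ip_cnj[OF P g] by simp
  qed
  have van: "(f - P f) (X j) = 0" if "f \<in> H" "j < n" for f j using van that by (simp add: P_def)
  have le: "nrm (f - P f) \<le> nrm f" if "f \<in> H" for f using le that by (simp add: P_def)
  define g where "g = k (X n) - P (k (X n))"
  have g: "g \<in> H" using x P by (simp add: g_def)
  have gX: "g (X j) = 0" if "j < n" for j unfolding g_def using x that by (intro van) auto
  have ip_g: "ip h g = h (X n)" if h: "h \<in> H" and v: "\<And>i. i < n \<Longrightarrow> h (X i) = 0" for h
    using orthP[OF h v] h x P by (simp add: g_def)
  show ?case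
  proof (cases "g (X n) = 0")
    case True
    have "ip g g = 0" using ip_g[OF g gX] True by simp
    then have g0: "g = 0" using ip_eq_0[OF g] by blast
    \<comment> \<open>The new section depends on the old ones, so every function vanishing at the
      earlier points also vanishes at the new one, and its sample can be ignored.\<close>
    define \<phi> where "\<phi> = \<psi>(n := 0)"
    have sum: "(\<Sum>i<Suc n. cscale (f (X i)) (\<phi> i)) = P f" for f
      by (simp add: \<phi>_def P_def)
    have "(f - P f) (X j) = 0" if f: "f \<in> H" and j: "j < Suc n" for f j
    proof (cases "j < n")
      case True then show ?thesis using van f by blast
    next
      case False
      have "(f - P f) (X n) = ip (f - P f) g"
        using ip_g[of "f - P f"] f P van[OF f] by (metis H_closed(3))
      also have "\<dots> = 0" using g0 f P by simp
      finally show ?thesis using False j by (simp add: less_Suc_eq)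
    qed
    moreover have "ip h (\<phi> i) = 0" if "h \<in> H" "\<And>i. i < Suc n \<Longrightarrow> h (X i) = 0" "i < Suc n" for h i
      using that orth[of h i] by (auto simp: \<phi>_def less_Suc_eq)
    moreover have "\<phi> i \<in> H" if "i < Suc n" for i using \<psi> that by (auto simp: \<phi>_def less_Suc_eq)
    ultimately show ?thesis
      using le unfolding interpolates_def by (intro exI[of _ \<phi>]) (unfold sum, blast)
  next
    case False
    \<comment> \<open>These coefficients result from writing the correction \<open>c f\<close> in
      terms of the samples of \<open>f\<close>; \<open>c f\<close> is the multiple of
      \<open>g\<close> that makes the residual vanish at \<open>X n\<close>.\<close>
    define \<phi> where "\<phi> i = (if i < n then \<psi> i - cscale (\<psi> i (X n) / g (X n)) g
      else cscale (1 / g (X n)) g)" for i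
    define c where "c f = (f - P f) (X n) / g (X n)" for f
    have \<phi>: "\<phi> i \<in> H" for i using \<psi> g by (simp add: \<phi>_def)
    have sum: "f - (\<Sum>i<Suc n. cscale (f (X i)) (\<phi> i)) = (f - P f) - cscale (c f) g" for f
    proof
      fix y
      have 1: "(\<Sum>i<n. cscale (f (X i)) (\<phi> i)) y =
          (\<Sum>i<n. f (X i) * \<psi> i y - f (X i) * \<psi> i (X n) * (g y / g (X n)))"
        unfolding sum_fun_apply by (intro sum.cong) (simp_all add: cscale_def \<phi>_def algebra_simps)
      have 2: "P f z = (\<Sum>i<n. f (X i) * \<psi> i z)" for z
        by (simp add: P_def sum_fun_apply cscale_def)
      have 3: "(\<Sum>i<n. cscale (f (X i)) (\<phi> i)) y = P f y - P f (X n) * (g y / g (X n))"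
        unfolding 1 2 sum_subtractf sum_distrib_right ..
      have 4: "cscale (f (X n)) (\<phi> n) y = f (X n) * (g y / g (X n))"
        by (simp add: cscale_def \<phi>_def)
      have 5: "cscale (c f) g y = (f (X n) - P f (X n)) * (g y / g (X n))"
        by (simp add: cscale_def c_def)
      show "(f - (\<Sum>i<Suc n. cscale (f (X i)) (\<phi> i))) y = ((f - P f) - cscale (c f) g) y"
        unfolding sum.lessThan_Suc minus_apply plus_fun_apply 3 4 5 by (simp add: algebra_simps)
    qed
    have v: "((f - P f) - cscale (c f) g) (X j) = 0" if f: "f \<in> H" and j: "j < Suc n" for f j
    proof (cases "j < n")
      case True
      have "(f - P f) (X j) = 0" by (rule van[OF f True])
      then show ?thesis using gX[OF True] by (simp add: cscale_def)
    next
      case False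
      then have "j = n" using j by simp
      then show ?thesis using \<open>g (X n) \<noteq> 0\<close> by (simp add: cscale_def c_def)
    qed
    have n: "nrm ((f - P f) - cscale (c f) g) \<le> nrm f" if f: "f \<in> H" for f
    proof -
      define r where "r = (f - P f) - cscale (c f) g"
      have r: "r \<in> H" using f g P by (simp add: r_def)
      have rX: "r (X j) = 0" if "j < Suc n" for j unfolding r_def by (rule v[OF f that])
      have "ip r g = 0" using ip_g[OF r] rX by simp
      then have "ip g r = 0" using ip_cnj[OF r g] by simp
      then have "(nrm (r + cscale (c f) g))\<^sup>2 = (nrm r)\<^sup>2 + (cmod (c f))\<^sup>2 * (nrm g)\<^sup>2"
        using nrm_add_scale_sq[OF r g] by simp
      then have "(nrm r)\<^sup>2 \<le> (nrm (r + cscale (c f) g))\<^sup>2" by simp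
      moreover have "r + cscale (c f) g = f - P f" by (simp add: r_def)
      ultimately have "(nrm r)\<^sup>2 \<le> (nrm (f - P f))\<^sup>2" by simp
      then have "nrm r \<le> nrm (f - P f)" by (rule power2_le_imp_le) (use f P in simp)
      then show ?thesis using le[OF f] by (simp add: r_def)
    qed
    have o: "ip h (\<phi> i) = 0" if h: "h \<in> H" and hX: "\<And>i. i < Suc n \<Longrightarrow> h (X i) = 0" for h i
    proof -
      have "ip h g = 0" using ip_g[OF h] hX by simp
      moreover have "ip h (\<psi> i) = 0" if "i < n" using orth[OF h _ that] hX by simp
      ultimately show ?thesis using h g \<psi> by (simp add: \<phi>_def)
    qed
    show ?thesis
      using \<phi> v n o unfolding interpolates_def by (intro exI[of _ \<phi>]) (unfold sum, blast)
  qed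
qed

text \<open>The interpolation residual of a function in the unit ball stays in the unit ball and
  vanishes at the points, so the worst error is governed by such functions alone.\<close>

lemma sampling_number_le:
  assumes X: "\<And>i. i < n \<Longrightarrow> X i \<in> D"
    and bound: "\<And>f x. f \<in> H \<Longrightarrow> nrm f \<le> 1 \<Longrightarrow> (\<And>i. i < n \<Longrightarrow> f (X i) = 0) \<Longrightarrow> x \<in> D \<Longrightarrow>
      ennreal ((cmod (f x))\<^sup>2) \<le> E"
  shows "(sampling_number_linf D H ip n)\<^sup>2 \<le> E"
proof (cases E)
  case top
  then show ?thesis by simp
next
  case (real b)
  obtain \<psi> where "interpolates n X \<psi>" using interpolates_ex X by blast
  note \<psi> = interpolatesD(1)[OF this] and van = interpolatesD(3)[OF this] and le = interpolatesD(4)[OF this]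
  define L where "L v = (\<Sum>i<n. cscale (v i) (\<psi> i))" for v
  have LH: "L v \<in> H" for v unfolding L_def using \<psi> by (intro H_sum H_closed) auto
  have "f \<in> linf_space D" if f: "f \<in> H" for f
  proof -
    obtain \<kappa> where \<kappa>: "\<kappa> \<ge> 0" "\<And>x. x \<in> D \<Longrightarrow> nrm (k x) \<le> \<kappa>" using k_bounded by metis
    have "linf_norm D f \<le> ennreal (nrm f * \<kappa>)"
      unfolding linf_norm_def
    proof (intro SUP_least ennreal_leI)
      fix x assume x: "x \<in> D"
      show "cmod (f x) \<le> nrm f * \<kappa>"
        using eval_bound[OF f x] mult_left_mono[OF \<kappa>(2)[OF x] nrm_nonneg[OF f]] by linarith
    qed
    also have "\<dots> < \<infinity>" by simp
    finally show ?thesis using H_outside[OF f] by (simp add: linf_space_def)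
  qed
  then have "L \<in> linear_maps n (linf_space D)"
    unfolding linear_maps_def using LH
    by (auto simp: L_def cfun.scale_left_distrib sum.distrib cfun.scale_sum_right cscale_def[of _ "_::nat\<Rightarrow>complex"])
  moreover have "linf_norm D (f - L (samples n X f)) \<le> ennreal (sqrt b)" if f: "f \<in> H" "nrm f \<le> 1" for f
  proof -
    have L: "L (samples n X f) = (\<Sum>i<n. cscale (f (X i)) (\<psi> i))"
      unfolding L_def by (intro sum.cong) (auto simp: samples_def)
    define r where "r = f - L (samples n X f)"
    have r: "r \<in> H" using f LH by (simp add: r_def)
    have r1: "nrm r \<le> 1" using le[OF f(1)] f(2) unfolding r_def L by linarith
    have rX: "r (X j) = 0" if "j < n" for j unfolding r_def L by (rule van[OF f(1) that])
    have "cmod (r x) \<le> sqrt b" if x: "x \<in> D" for x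
      using bound[OF r r1 rX x] real by (simp add: real_le_rsqrt)
    then show ?thesis unfolding linf_norm_def r_def by (intro SUP_least ennreal_leI) auto
  qed
  ultimately have "sampling_number_linf D H ip n \<le> ennreal (sqrt b)"
    unfolding sampling_number_def using X
    by (intro INF_lower2[of X] INF_lower2[of L] SUP_least) auto
  then have "(sampling_number_linf D H ip n)\<^sup>2 \<le> (ennreal (sqrt b))\<^sup>2" by (rule power_mono) simp
  also have "\<dots> = E" using real by (simp add: ennreal_power)
  finally show ?thesis .
qed

end

subsection \<open>Completeness of the eigenfunctions\<close>

locale rkhs_spectral = rkhs_embedding D H ip K \<rho>
  for D :: "'a::{metric_space,second_countable_topology} set" and H ip K and \<rho> :: "'a measure" +
  fixes lam :: "nat \<Rightarrow> real" and e :: "nat \<Rightarrow> 'a \<Rightarrow> complex"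
  assumes spectral: "spectral_data H ip \<rho> lam e"
begin

lemma lam_pos: "1 \<le> j \<Longrightarrow> 0 < lam j"
  using spectral unfolding spectral_data_def by blast

lemma lam_pos_Suc [simp]:
  "Suc 0 \<le> j \<Longrightarrow> 0 < lam j" "Suc 0 \<le> j \<Longrightarrow> 0 \<le> lam j" "Suc 0 \<le> j \<Longrightarrow> lam j \<noteq> 0"
  using lam_pos[of j] by auto

lemma lam_antimono: "1 \<le> i \<Longrightarrow> i \<le> j \<Longrightarrow> lam j \<le> lam i"
  using spectral unfolding spectral_data_def by blast

lemma e_in [simp, intro]: "1 \<le> j \<Longrightarrow> e j \<in> H"
  using spectral unfolding spectral_data_def by blast

lemma e_ortho: "1 \<le> i \<Longrightarrow> 1 \<le> j \<Longrightarrow> ip (e i) (e j) = (if i = j then 1 else 0)"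
  using spectral unfolding spectral_data_def by blast

lemma T_e: "1 \<le> j \<Longrightarrow> T (e j) = cscale (of_real (lam j)) (e j)"
  using spectral unfolding spectral_data_def by blast

lemma l2_e: "f \<in> H \<Longrightarrow> 1 \<le> j \<Longrightarrow> l2 f (e j) = of_real (lam j) * ip f (e j)"
  using T_ip[of "e j" f] by (simp add: T_e)

text \<open>A nonzero orthogonal complement would be invariant under \<open>T\<close> and contain an
  eigenvector with positive eigenvalue. By the multiplicity clause of \<open>spectral_data\<close>
  it also lies in the span of the listed eigenfunctions, hence is orthogonal to itself.\<close>

lemma e_complete:
  assumes f: "f \<in> H" and orth: "\<And>j. 1 \<le> j \<Longrightarrow> ip f (e j) = 0"
  shows "f = 0"
proof (rule ccontr)
  assume f0: "f \<noteq> 0"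
  define S where "S = {g \<in> H. \<forall>j\<ge>1. ip g (e j) = 0}"
  obtain \<nu> g where \<nu>: "\<nu> > 0" and g: "g \<in> S" "g \<noteq> 0" and eig: "T g = cscale (of_real \<nu>) g"
  proof (rule eigenvector_exists[of S f])
    show "T g \<in> S" if "g \<in> S" for g
      using that pos_op_sym[OF pos_op_T, of g] by (auto simp: S_def T_e)
    show "g \<in> S" if F: "\<And>n. F n \<in> S" and g: "g \<in> H" and lim: "(\<lambda>n. nrm (F n - g)) \<longlonglongrightarrow> 0" for F g
    proof -
      have "ip g (e j) = 0" if "1 \<le> j" for j
      proof -
        have "(\<lambda>n. ip (F n) (e j)) \<longlonglongrightarrow> ip g (e j)"
          using F g lim that by (intro ip_tendsto) (auto simp: S_def)
        moreover have "(\<lambda>n. ip (F n) (e j)) = (\<lambda>n. 0)" using F that by (auto simp: S_def)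
        ultimately show ?thesis using LIMSEQ_unique[OF _ tendsto_const] by metis
      qed
      then show ?thesis using g by (simp add: S_def)
    qed
  qed (use f f0 orth in \<open>auto simp: S_def\<close>)
  have gH: "g \<in> H" using g by (simp add: S_def)
  have "g \<in> cfun.span {e j | j. 1 \<le> j \<and> lam j = \<nu>}"
    using spectral \<nu> gH eig unfolding spectral_data_def by blast
  moreover have "cfun.subspace {h \<in> H. ip g h = 0}"
    using gH by (intro cfun.subspaceI) auto
  ultimately have "g \<in> {h \<in> H. ip g h = 0}"
    using g by (elim cfun.span_induct) (auto simp: S_def)
  then show False using ip_eq_0 g by blast
qed

section \<open>Projections onto the eigenfunction tails\<close>

text \<open>The orthogonal projection that removes the first \<open>n - 1\<close> eigenfunctions, in
  step with the index convention of \<open>N_fun\<close>; both \<open>Q 0\<close> and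
  \<open>Q 1\<close> are the identity on \<open>H\<close>.\<close>

definition Q :: "nat \<Rightarrow> ('a \<Rightarrow> complex) \<Rightarrow> ('a \<Rightarrow> complex)" where
  "Q n f = f - (\<Sum>j=1..<n. cscale (ip f (e j)) (e j))"

lemma Q_in [simp, intro]: "f \<in> H \<Longrightarrow> Q n f \<in> H"
  unfolding Q_def by (intro H_closed H_sum) auto

lemma ip_Q:
  assumes f: "f \<in> H" and g: "g \<in> H"
  shows "ip (Q n f) g = ip f g - (\<Sum>j=1..<n. ip f (e j) * cnj (ip g (e j)))"
proof -
  have "ip (\<Sum>j=1..<n. cscale (ip f (e j)) (e j)) g = (\<Sum>j=1..<n. ip (cscale (ip f (e j)) (e j)) g)"
    using g by (intro ip_sum_left) auto
  also have "\<dots> = (\<Sum>j=1..<n. ip f (e j) * cnj (ip g (e j)))"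
    using g by (intro sum.cong refl) (simp add: ip_cnj[of g])
  moreover have "(\<Sum>j=1..<n. cscale (ip f (e j)) (e j)) \<in> H" by (intro H_sum H_closed) auto
  ultimately show ?thesis unfolding Q_def using f g by simp
qed

lemma ip_Q_e: assumes f: "f \<in> H" and i: "1 \<le> i" "i < n" shows "ip (Q n f) (e i) = 0"
proof -
  have "(\<Sum>j=1..<n. ip f (e j) * cnj (ip (e i) (e j))) = (\<Sum>j=1..<n. if j = i then ip f (e i) else 0)"
    using i by (intro sum.cong) (auto simp: e_ortho)
  then show ?thesis using f i by (simp add: ip_Q)
qed

lemma Q_self:
  assumes f: "f \<in> H" shows "Re (ip (Q n f) (Q n f)) = Re (ip f f) - (\<Sum>j=1..<n. (cmod (ip f (e j)))\<^sup>2)"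
    and "Re (ip (Q n f) f) = Re (ip (Q n f) (Q n f))"
proof -
  have "ip (Q n f) (Q n f) = ip f (Q n f)"
    using f by (simp add: ip_Q[OF f Q_in[OF f]] ip_Q_e)
  also have "\<dots> = cnj (ip (Q n f) f)" using f by (intro ip_cnj) auto
  finally have eq: "Re (ip (Q n f) (Q n f)) = Re (ip (Q n f) f)" by simp
  then show "Re (ip (Q n f) f) = Re (ip (Q n f) (Q n f))" by simp
  have "(\<Sum>j=1..<n. ip f (e j) * cnj (ip f (e j))) = of_real (\<Sum>j=1..<n. (cmod (ip f (e j)))\<^sup>2)"
    unfolding of_real_sum by (intro sum.cong) (auto simp: complex_norm_square simp del: of_real_power)
  then show "Re (ip (Q n f) (Q n f)) = Re (ip f f) - (\<Sum>j=1..<n. (cmod (ip f (e j)))\<^sup>2)"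
    unfolding eq ip_Q[OF f f] by simp
qed

lemma Q_Pythagoras:
  assumes f: "f \<in> H" and mn: "m \<le> n"
  shows "(nrm (Q m f - Q n f))\<^sup>2 = (nrm (Q m f))\<^sup>2 - (nrm (Q n f))\<^sup>2"
proof -
  have "Re (ip (Q m f) (Q n f)) = Re (ip (Q n f) (Q n f))"
  proof -
    have "ip (Q m f) (Q n f) = ip f (Q n f)"
      using f mn by (simp add: ip_Q[OF f Q_in[OF f]] ip_Q_e)
    also have "\<dots> = cnj (ip (Q n f) f)" using f by (intro ip_cnj) auto
    finally show ?thesis using Q_self(2)[OF f] by simp
  qed
  moreover have "ip (Q n f) (Q m f) = cnj (ip (Q m f) (Q n f))" using f by (intro ip_cnj) auto
  ultimately show ?thesis using f by (simp add: nrm_sq)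
qed

text \<open>The norms decrease, so by Pythagoras the remainders are Cauchy. Their limit is
  orthogonal to every eigenfunction and vanishes by completeness.\<close>

lemma Q_tendsto_0: assumes f: "f \<in> H" shows "(\<lambda>n. nrm (Q n f)) \<longlonglongrightarrow> 0"
proof -
  define a where "a n = (nrm (Q n f))\<^sup>2" for n
  have dec: "a n \<le> a m" if "m \<le> n" for m n
    using Q_Pythagoras[OF f that] zero_le_power2[of "nrm (Q m f - Q n f)"] by (simp add: a_def)
  have "decseq a" using dec by (simp add: decseq_def)
  then obtain L where L: "a \<longlonglongrightarrow> L" using decseq_convergent[of a 0] by (auto simp: a_def)
  have cau: "\<exists>M. \<forall>m\<ge>M. \<forall>n\<ge>M. nrm (Q m f - Q n f) < \<epsilon>" if \<epsilon>: "\<epsilon> > 0" for \<epsilon>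
  proof -
    have "\<epsilon>\<^sup>2 > 0" using \<epsilon> by simp
    then obtain M where M: "\<And>m n. m \<ge> M \<Longrightarrow> n \<ge> M \<Longrightarrow> norm (a m - a n) < \<epsilon>\<^sup>2"
      using CauchyD[OF LIMSEQ_imp_Cauchy[OF L]] by blast
    have le: "nrm (Q m f - Q n f) < \<epsilon>" if "m \<ge> M" "n \<ge> M" "m \<le> n" for m n
    proof (rule power2_less_imp_less)
      have "(nrm (Q m f - Q n f))\<^sup>2 = a m - a n" using Q_Pythagoras[OF f that(3)] by (simp add: a_def)
      also have "\<dots> < \<epsilon>\<^sup>2" using M[OF that(1,2)] by simp
      finally show "(nrm (Q m f - Q n f))\<^sup>2 < \<epsilon>\<^sup>2" .
    qed (use \<epsilon> in simp)
    have "nrm (Q m f - Q n f) < \<epsilon>" if "m \<ge> M" "n \<ge> M" for m n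
      using le[of m n] le[of n m] that nrm_minus_commute[of "Q m f" "Q n f"] f
      by (cases "m \<le> n") auto
    then show ?thesis by blast
  qed
  obtain g where g: "g \<in> H" and lim: "(\<lambda>n. nrm (Q n f - g)) \<longlonglongrightarrow> 0"
    by (rule H_complete[of "\<lambda>n. Q n f"]) (use f cau that in auto)
  have "ip g (e j) = 0" if j: "1 \<le> j" for j
  proof -
    have "(\<lambda>n. ip (Q n f) (e j)) \<longlonglongrightarrow> ip g (e j)"
      using f g lim j by (intro ip_tendsto) auto
    moreover have "\<forall>\<^sub>F n in sequentially. ip (Q n f) (e j) = 0"
      using eventually_gt_at_top[of j] by eventually_elim (use f j in \<open>simp add: ip_Q_e\<close>)
    ultimately have "(\<lambda>n::nat. 0) \<longlonglongrightarrow> ip g (e j)"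
      by (rule Lim_transform_eventually)
    then show ?thesis by (rule LIMSEQ_unique[OF _ tendsto_const])
  qed
  then have "g = 0" using e_complete g by blast
  then show ?thesis using lim by simp
qed

text \<open>The squared norm of evaluation at \<open>x\<close> on the range of \<open>Q n\<close>.
  \<open>q_split\<close> and \<open>q_tendsto_0\<close> identify it with the sum of
  \<open>(cmod (e j x))\<^sup>2\<close> over \<open>j \<ge> n\<close>.\<close>

definition q :: "nat \<Rightarrow> 'a \<Rightarrow> real" where
  "q n x = Re (ip (Q n (k x)) (Q n (k x)))"

lemma q_nonneg: "x \<in> D \<Longrightarrow> 0 \<le> q n x"
  by (simp add: q_def Q_in k_in)

lemma cmod_ip_k_e: "x \<in> D \<Longrightarrow> 1 \<le> j \<Longrightarrow> cmod (ip (k x) (e j)) = cmod (e j x)"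
  using ip_cnj[of "e j" "k x"] by simp

lemma q_eq: assumes x: "x \<in> D" shows "q n x = Re (ip (k x) (k x)) - (\<Sum>j=1..<n. (cmod (e j x))\<^sup>2)"
proof -
  have "(\<Sum>j=1..<n. (cmod (ip (k x) (e j)))\<^sup>2) = (\<Sum>j=1..<n. (cmod (e j x))\<^sup>2)"
    using x by (intro sum.cong) (auto simp: cmod_ip_k_e)
  then show ?thesis using Q_self(1)[OF k_in[OF x]] by (simp only: q_def)
qed

lemma q_split:
  assumes x: "x \<in> D" and "1 \<le> m" "m \<le> n"
  shows "q m x = (\<Sum>j=m..<n. (cmod (e j x))\<^sup>2) + q n x"
proof -
  have "(\<Sum>j=1..<n. (cmod (e j x))\<^sup>2) =
      (\<Sum>j=1..<m. (cmod (e j x))\<^sup>2) + (\<Sum>j=m..<n. (cmod (e j x))\<^sup>2)"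
    using assms by (simp add: sum.atLeastLessThan_concat)
  then show ?thesis unfolding q_eq[OF x] by simp
qed

lemma q_tendsto_0: assumes x: "x \<in> D" shows "(\<lambda>n. q n x) \<longlonglongrightarrow> 0"
proof -
  have "(\<lambda>n. (nrm (Q n (k x)))\<^sup>2) \<longlonglongrightarrow> 0\<^sup>2"
    by (intro tendsto_intros Q_tendsto_0 k_in x)
  then show ?thesis using x by (simp add: q_def nrm_sq Q_in)
qed

lemma pos_op_Q: "pos_op (Q n)"
  unfolding pos_op_def
proof (intro conjI ballI exI[of _ "1::real"])
  fix f assume f: "f \<in> H"
  show "0 \<le> Re (ip (Q n f) f)" using Q_self(2)[OF f] f by simp
  show "nrm (Q n f) \<le> 1 * nrm f"
  proof (rule power2_le_imp_le)
    have "0 \<le> (\<Sum>j=1..<n. (cmod (ip f (e j)))\<^sup>2)" by (rule sum_nonneg) simp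
    then show "(nrm (Q n f))\<^sup>2 \<le> (1 * nrm f)\<^sup>2"
      using Q_self(1)[OF f, of n] f by (simp add: nrm_sq)
  qed (use f in simp)
  fix g assume g: "g \<in> H"
  have "ip f (Q n g) = cnj (ip (Q n g) f)" using f g by (intro ip_cnj) auto
  then show "ip (Q n f) g = ip f (Q n g)"
    using f g ip_cnj[OF f g] by (simp add: ip_Q mult.commute)
qed auto

lemma continuous_q: "continuous_on D (q n)"
proof -
  have "continuous_on D (\<lambda>x. Re (ip (Q n (k x)) (k x)))" by (rule continuous_op[OF pos_op_Q])
  then show ?thesis
    by (rule continuous_on_eq) (simp add: q_def Q_self(2) del: ip_k)
qed

text \<open>The sum of \<open>lam j\<close> over \<open>j \<ge> n\<close>, as \<open>R_split\<close>
  and \<open>R_tendsto_0\<close> show. As an integral of a continuous function it is finite from the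
  start, so summability of the eigenvalues comes out as a consequence.\<close>

definition R :: "nat \<Rightarrow> real" where "R n = (LINT x|\<rho>. q n x)"

lemma integral_e: assumes j: "1 \<le> j" shows "(LINT x|\<rho>. (cmod (e j x))\<^sup>2) = lam j"
  using l2_e[of "e j" j] j by (simp add: Re_l2_self[symmetric] e_ortho)

lemma R_split: assumes "1 \<le> m" "m \<le> n" shows "R m = (\<Sum>j=m..<n. lam j) + R n"
proof -
  have "R m = (LINT x|\<rho>. (\<Sum>j=m..<n. (cmod (e j x))\<^sup>2) + q n x)"
    unfolding R_def using assms by (intro Bochner_Integration.integral_cong refl q_split) auto
  also have "\<dots> = (LINT x|\<rho>. (\<Sum>j=m..<n. (cmod (e j x))\<^sup>2)) + R n"
    unfolding R_def using assms
    by (intro Bochner_Integration.integral_add integrable_continuous continuous_q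
        continuous_on_sum continuous_cmod_sq) auto
  also have "(LINT x|\<rho>. (\<Sum>j=m..<n. (cmod (e j x))\<^sup>2)) = (\<Sum>j=m..<n. LINT x|\<rho>. (cmod (e j x))\<^sup>2)"
    using assms by (intro Bochner_Integration.integral_sum integrable_continuous continuous_cmod_sq) auto
  also have "\<dots> = (\<Sum>j=m..<n. lam j)"
    using assms by (intro sum.cong refl integral_e) auto
  finally show ?thesis .
qed

lemma R_nonneg: "0 \<le> R n"
  unfolding R_def using q_nonneg by (intro integral_nonneg_AE AE_I2) simp

lemma R_pos: assumes "1 \<le> n" shows "0 < R n"
proof -
  have "R n = lam n + R (Suc n)" using R_split[of n "Suc n"] assms by simp
  then show ?thesis using lam_pos[OF assms] R_nonneg[of "Suc n"] by linarith
qed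

lemma R_tendsto_0: "R \<longlonglongrightarrow> 0"
proof -
  have "(\<lambda>n. LINT x|\<rho>. q n x) \<longlonglongrightarrow> (LINT x|\<rho>. 0)"
  proof (rule integral_dominated_convergence[where w = "\<lambda>x. q 0 x"])
    show "AE x in \<rho>. (\<lambda>n. q n x) \<longlonglongrightarrow> 0" using q_tendsto_0 by (intro AE_I2) simp
    show "AE x in \<rho>. norm (q n x) \<le> q 0 x" for n
    proof (rule AE_I2)
      fix x assume "x \<in> space \<rho>"
      then have x: "x \<in> D" by simp
      have "0 \<le> (\<Sum>j=1..<n. (cmod (e j x))\<^sup>2)" by (rule sum_nonneg) simp
      then show "norm (q n x) \<le> q 0 x"
        using q_nonneg[OF x, of n] unfolding q_eq[OF x] by simp
    qed
  qed (use continuous_q in \<open>auto intro: measurable_continuous integrable_continuous\<close>)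
  then show ?thesis by (simp add: R_def[abs_def])
qed

text \<open>The partial sum and the remainder are orthogonal in L2 as well as in \<open>H\<close>,
  because the \<open>e j\<close> are eigenfunctions of \<open>T\<close>.\<close>

lemma Bessel_l2: assumes f: "f \<in> H" shows "(\<Sum>j=1..<n. lam j * (cmod (ip f (e j)))\<^sup>2) \<le> Re (l2 f f)"
proof -
  define S where "S = (\<Sum>j=1..<n. cscale (ip f (e j)) (e j))"
  have S: "S \<in> H" unfolding S_def by (intro H_sum H_closed) auto
  have fS: "f = S + Q n f" by (simp add: Q_def S_def)
  have e_l2: "l2 (e j) g = of_real (lam j) * cnj (ip g (e j))" if "g \<in> H" "1 \<le> j" for g j
    using l2_cnj[of "e j" g] l2_e[OF that] by simp
  have sum: "l2 S g = (\<Sum>j=1..<n. ip f (e j) * (of_real (lam j) * cnj (ip g (e j))))" if g: "g \<in> H" for g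
  proof -
    have "l2 S g = ip S (T g)" using T_ip[OF g S] by simp
    also have "\<dots> = (\<Sum>j=1..<n. ip f (e j) * ip (e j) (T g))"
      unfolding S_def using g by (subst ip_sum_left) auto
    also have "\<dots> = (\<Sum>j=1..<n. ip f (e j) * (of_real (lam j) * cnj (ip g (e j))))"
      using g by (intro sum.cong) (auto simp: T_ip e_l2)
    finally show ?thesis .
  qed
  have SQ: "l2 S (Q n f) = 0" using f by (simp add: sum ip_Q_e)
  have "l2 f f = l2 S f + l2 (Q n f) f"
    using l2_add[OF S Q_in[OF f] f, of n] fS by simp
  moreover have "l2 (Q n f) f = cnj (l2 f (Q n f))" by (rule l2_cnj)
  moreover have "l2 f (Q n f) = l2 S (Q n f) + l2 (Q n f) (Q n f)"
    using l2_add[OF S Q_in[OF f] Q_in[OF f], of n n] fS by simp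
  ultimately have "Re (l2 f f) = Re (l2 S f) + Re (l2 (Q n f) (Q n f))" by (simp add: SQ)
  moreover have "l2 S f = of_real (\<Sum>j=1..<n. lam j * (cmod (ip f (e j)))\<^sup>2)"
    unfolding sum[OF f] of_real_sum of_real_mult complex_norm_square
    by (intro sum.cong) (auto simp: mult_ac)
  ultimately show ?thesis by simp
qed

section \<open>The initial operator of the greedy choice\<close>

text \<open>The inverse of the form that is \<open>lam j\<close> on \<open>e j\<close> for
  \<open>j < m\<close> and \<open>\<mu>\<close> on the range of \<open>Q m\<close>. That form is at
  most \<open>T + \<mu>\<close>, so \<open>A0\<close> bounds the inverse of \<open>T + \<mu>\<close>
  from above, and its trace is explicit.\<close>

definition A0 :: "nat \<Rightarrow> real \<Rightarrow> ('a \<Rightarrow> complex) \<Rightarrow> ('a \<Rightarrow> complex)" where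
  "A0 m \<mu> f = cscale (of_real (1 / \<mu>)) (Q m f) +
     (\<Sum>j=1..<m. cscale (of_real (1 / lam j)) (cscale (ip f (e j)) (e j)))"

lemma pos_op_A0: "0 < \<mu> \<Longrightarrow> pos_op (A0 m \<mu>)"
  unfolding A0_def[abs_def]
  by (intro pos_op_plus pos_op_sum pos_op_cscale pos_op_Q pos_op_rank_one)
    auto

lemma A0_form:
  assumes h: "h \<in> H"
  shows "Re (ip (A0 m \<mu> h) h) =
    (nrm (Q m h))\<^sup>2 / \<mu> + (\<Sum>j=1..<m. (cmod (ip h (e j)))\<^sup>2 / lam j)"
proof -
  have tm: "ip h (e j) * ip (e j) h = of_real ((cmod (ip h (e j)))\<^sup>2)" if "1 \<le> j" for j
    unfolding complex_norm_square using ip_cnj[of h "e j"] h that by simp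
  define S where "S = (\<Sum>j=1..<m. cscale (of_real (1 / lam j)) (cscale (ip h (e j)) (e j)))"
  have "S \<in> H" unfolding S_def by (intro H_sum H_closed) auto
  have "ip S h =
      (\<Sum>j=1..<m. of_real ((cmod (ip h (e j)))\<^sup>2 / lam j))"
    unfolding S_def using h
    by (subst ip_sum_left) (auto intro!: sum.cong simp: tm simp del: of_real_power)
  then have "ip (A0 m \<mu> h) h = of_real (1 / \<mu>) * ip (Q m h) h +
      of_real (\<Sum>j=1..<m. (cmod (ip h (e j)))\<^sup>2 / lam j)"
    unfolding A0_def S_def[symmetric] using h \<open>S \<in> H\<close> by simp
  then have "Re (ip (A0 m \<mu> h) h) = 1 / \<mu> * Re (ip (Q m h) h) +
      (\<Sum>j=1..<m. (cmod (ip h (e j)))\<^sup>2 / lam j)"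
    by simp
  then show ?thesis using h by (simp add: Q_self(2) nrm_sq)
qed

text \<open>Weighted Cauchy-Schwarz separately on the first eigenfunctions and on the remainder;
  Bessel in L2 and contractivity of \<open>Q m\<close> then bound the two parts of the form by
  \<open>T\<close> and \<open>\<mu>\<close>.\<close>

lemma dominates_A0:
  assumes \<mu>: "0 < \<mu>" shows "dominates (A0 m \<mu>) {} 1 \<mu>"
  unfolding dominates_def
proof (intro ballI impI)
  fix f h assume f: "f \<in> H" and h: "h \<in> H"
  define x where "x = (\<Sum>j=1..<m. cmod (ip f (e j)) * cmod (ip h (e j)))"
  define y where "y = nrm (Q m f) * nrm (Q m h)"
  define X where "X = (\<Sum>j=1..<m. lam j * (cmod (ip f (e j)))\<^sup>2)"
  define X' where "X' = (\<Sum>j=1..<m. (cmod (ip h (e j)))\<^sup>2 / lam j)"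
  define Y where "Y = \<mu> * (nrm (Q m f))\<^sup>2"
  define Y' where "Y' = (nrm (Q m h))\<^sup>2 / \<mu>"
  have ln: "lam j > 0" if "j \<in> {1..<m}" for j using lam_pos that by simp
  have sn: "lam j \<noteq> 0" if "j \<in> {1..<m}" for j using ln[OF that] by simp
  have X0: "0 \<le> X" "0 \<le> X'" unfolding X_def X'_def
    by (intro sum_nonneg; use lam_pos in \<open>force intro: less_imp_le\<close>)+
  have Y0: "0 \<le> Y" "0 \<le> Y'" using \<mu> by (simp_all add: Y_def Y'_def)
  have x0: "0 \<le> x" unfolding x_def by (intro sum_nonneg) simp
  have y0: "0 \<le> y" using f h by (simp add: y_def)
  have xle: "x\<^sup>2 \<le> X * X'"
  proof -
    have "x = (\<Sum>j=1..<m. (sqrt (lam j) * cmod (ip f (e j))) * (cmod (ip h (e j)) / sqrt (lam j)))"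
      unfolding x_def by (intro sum.cong refl) (simp add: sn)
    then have "x\<^sup>2 \<le> (\<Sum>j=1..<m. (sqrt (lam j) * cmod (ip f (e j)))\<^sup>2) *
        (\<Sum>j=1..<m. (cmod (ip h (e j)) / sqrt (lam j))\<^sup>2)"
      using Cauchy_Schwarz_ineq_sum by metis
    also have "(\<Sum>j=1..<m. (sqrt (lam j) * cmod (ip f (e j)))\<^sup>2) = X"
      unfolding X_def by (intro sum.cong) (use lam_pos in \<open>auto simp: power_mult_distrib less_imp_le\<close>)
    also have "(\<Sum>j=1..<m. (cmod (ip h (e j)) / sqrt (lam j))\<^sup>2) = X'"
      unfolding X'_def by (intro sum.cong) (use lam_pos in \<open>auto simp: power_divide less_imp_le\<close>)
    finally show ?thesis .
  qed
  have yle: "y\<^sup>2 = Y * Y'" using \<mu> by (simp add: y_def Y_def Y'_def power_mult_distrib)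
  \<comment> \<open>Cauchy-Schwarz in two coordinates: the cross term \<open>2 * x * y\<close> is at
    most \<open>X * Y' + X' * Y\<close> by the arithmetic-geometric mean inequality.\<close>
  have "(x + y)\<^sup>2 \<le> (X + Y) * (X' + Y')"
  proof -
    have "(x * y)\<^sup>2 \<le> (X * X') * (Y * Y')"
      unfolding power_mult_distrib using xle yle by (intro mult_mono) (auto simp: X0 Y0)
    then have "x * y \<le> sqrt ((X * Y') * (X' * Y))"
      by (intro real_le_rsqrt) (simp add: mult_ac)
    also have "\<dots> \<le> (X * Y' + X' * Y) / 2" using X0 Y0 by (intro arith_geo_mean_sqrt) auto
    finally show ?thesis using xle yle by (simp add: power2_sum algebra_simps)
  qed
  moreover have "cmod (ip f h) \<le> x + y"
  proof -
    have "ip (Q m f) h = ip (Q m f) (Q m h)"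
    proof -
      have "ip h (Q m f) = ip (Q m h) (Q m f)"
        using f h by (simp add: ip_Q[OF h Q_in[OF f]] ip_Q_e)
      then show ?thesis using f h ip_cnj[of h "Q m f"] ip_cnj[of "Q m h" "Q m f"] by simp
    qed
    then have "ip f h = ip (Q m f) (Q m h) + (\<Sum>j=1..<m. ip f (e j) * cnj (ip h (e j)))"
      using ip_Q[OF f h, of m] by (simp add: diff_eq_eq)
    then have "cmod (ip f h) \<le> cmod (ip (Q m f) (Q m h)) +
        cmod (\<Sum>j=1..<m. ip f (e j) * cnj (ip h (e j)))"
      by (simp add: norm_triangle_ineq)
    also have "\<dots> \<le> y + x"
      unfolding x_def y_def using f h
      by (intro add_mono cauchy_schwarz Q_in order_trans[OF norm_sum]) (simp_all add: norm_mult)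
    finally show ?thesis by simp
  qed
  then have "(cmod (ip f h))\<^sup>2 \<le> (x + y)\<^sup>2" by (rule power_mono) simp
  moreover have "(X + Y) * (X' + Y') \<le> (Re (l2 f f) + \<mu> * (nrm f)\<^sup>2) * Re (ip (A0 m \<mu> h) h)"
  proof (rule mult_mono)
    have "(nrm (Q m f))\<^sup>2 \<le> (nrm f)\<^sup>2"
      using Q_self(1)[OF f, of m] sum_nonneg[of "{1..<m}" "\<lambda>j. (cmod (ip f (e j)))\<^sup>2"] f
      by (simp add: nrm_sq)
    then show "X + Y \<le> Re (l2 f f) + \<mu> * (nrm f)\<^sup>2"
      unfolding X_def Y_def using \<mu> by (intro add_mono Bessel_l2 f mult_left_mono) auto
    show "X' + Y' \<le> Re (ip (A0 m \<mu> h) h)" using A0_form[OF h] by (simp add: X'_def Y'_def)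
  qed (use X0 Y0 \<mu> in auto)
  ultimately show "(cmod (ip f h))\<^sup>2 \<le> Re (ip (A0 m \<mu> h) h) * (1 * Re (l2 f f) + \<mu> * (nrm f)\<^sup>2)"
    by (simp add: mult.commute)
qed

lemma trace_A0:
  assumes \<mu>: "0 < \<mu>" and m: "1 \<le> m" shows "trace (A0 m \<mu>) = R m / \<mu> + real (m - 1)"
proof -
  have ln: "lam j \<noteq> 0" if "j \<in> {1..<m}" for j using lam_pos that by (metis atLeastLessThan_iff less_irrefl)
  have "trace (A0 m \<mu>) = (LINT x|\<rho>. q m x / \<mu> + (\<Sum>j=1..<m. (cmod (e j x))\<^sup>2 / lam j))"
    unfolding trace_def
    by (intro Bochner_Integration.integral_cong)
      (auto simp: A0_form nrm_sq q_def cmod_ip_k_e Q_in simp del: ip_k intro!: sum.cong)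
  also have "\<dots> = (LINT x|\<rho>. q m x / \<mu>) + (LINT x|\<rho>. (\<Sum>j=1..<m. (cmod (e j x))\<^sup>2 / lam j))"
    using ln \<mu>
    by (intro Bochner_Integration.integral_add integrable_continuous continuous_on_sum
        continuous_on_divide continuous_q continuous_cmod_sq continuous_on_const) auto
  also have "(LINT x|\<rho>. (\<Sum>j=1..<m. (cmod (e j x))\<^sup>2 / lam j)) =
      (\<Sum>j=1..<m. LINT x|\<rho>. (cmod (e j x))\<^sup>2 / lam j)"
    using ln
    by (intro Bochner_Integration.integral_sum integrable_continuous
        continuous_on_divide continuous_cmod_sq continuous_on_const) auto
  also have "\<dots> = (\<Sum>j=1..<m. 1)"
    using ln by (intro sum.cong refl) (simp add: integral_e)
  finally show ?thesis by (simp add: R_def)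
qed

lemma sampling_points_l2:
  assumes m: "1 \<le> m"
  obtains X where "\<And>i. i < 16 * m \<Longrightarrow> X i \<in> D"
    "\<And>f. f \<in> H \<Longrightarrow> (\<And>i. i < 16 * m \<Longrightarrow> f (X i) = 0) \<Longrightarrow> Re (l2 f f) \<le> R m / real m * (nrm f)\<^sup>2"
proof -
  \<comment> \<open>Balances the initial trace: the tail contributes \<open>R m / \<mu> = m\<close>,
    the first eigenfunctions \<open>m - 1\<close>.\<close>
  define \<mu> where "\<mu> = R m / real m"
  have \<mu>: "0 < \<mu>" using R_pos[OF m] m by (simp add: \<mu>_def)
  have "trace (A0 m \<mu>) \<le> 2 * real m"
    using trace_A0[OF \<mu> m] R_pos[OF m] m by (simp add: \<mu>_def)
  then obtain X A where X: "\<forall>i<16*m. X i \<in> D" and A: "pos_op A"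
    and dom: "dominates A (X ` {..<16*m}) (1 - real (16*m) / (4 * (2 * real m))) \<mu>"
    using greedy_points[OF pos_op_A0[OF \<mu>] dominates_A0[OF \<mu>], of m "2 * real m" "16 * m"] m by auto
  have "1 - real (16*m) / (4 * (2 * real m)) = - 1" using m by simp
  then have dom': "dominates A (X ` {..<16*m}) (- 1) \<mu>" using dom by simp
  show ?thesis
  proof (rule that[of X])
    show "X i \<in> D" if "i < 16 * m" for i using X that by blast
    fix f assume "f \<in> H" "\<And>i. i < 16 * m \<Longrightarrow> f (X i) = 0"
    then show "Re (l2 f f) \<le> R m / real m * (nrm f)\<^sup>2"
      using dominates_negative[OF A dom'] \<mu> by (auto simp: \<mu>_def)
  qed
qed

end

subsection \<open>Upper bounds for the sampling numbers\<close>

lemma divide_of_nat_ennreal: "1 \<le> p \<Longrightarrow> (x::ennreal) / of_nat p = x * ennreal (1 / real p)"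
  by (simp add: divide_ennreal_def ennreal_of_nat_eq_real_of_nat inverse_ennreal inverse_eq_divide)

lemma sum_le_infsum_ennreal:
  fixes f :: "'i \<Rightarrow> ennreal"
  assumes "finite I" "I \<subseteq> A" shows "sum f I \<le> infsum f A"
  using assms by (subst nonneg_infsum_complete) (auto intro: SUP_upper)

lemma N_fun_mono: "m \<le> n \<Longrightarrow> N_fun D lam e m \<le> N_fun D lam e n"
  unfolding N_fun_def by (intro SUP_mono' ennreal_leI sum_mono2) auto

context rkhs_spectral
begin

lemma cmod_eta_sq: "1 \<le> j \<Longrightarrow> (cmod (eta lam e j x))\<^sup>2 = (cmod (e j x))\<^sup>2 / lam j"
  by (simp add: eta_def sing_num_def norm_divide power_divide)

text \<open>In the head, the weights \<open>sqrt (lam j)\<close> turn \<open>e j\<close> into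
  \<open>eta\<close> and make Bessel in L2 applicable, so the head is controlled by the quantity
  that the points make small. The tail only uses the norm in \<open>H\<close>.\<close>

lemma pointwise_bound:
  assumes f: "f \<in> H" and x: "x \<in> D"
  shows "(cmod (f x))\<^sup>2 \<le>
    2 * ((\<Sum>j=1..<m. (cmod (eta lam e j x))\<^sup>2) * Re (l2 f f)) + 2 * (q m x * (nrm f)\<^sup>2)"
proof -
  define s where "s = (\<Sum>j=1..<m. ip f (e j) * e j x)"
  define N where "N = (\<Sum>j=1..<m. (cmod (eta lam e j x))\<^sup>2)"
  have kx: "k x \<in> H" using x by blast
  have "f x = s + ip (Q m f) (k x)"
  proof -
    have "(\<Sum>j=1..<m. ip f (e j) * cnj (ip (k x) (e j))) = s"
      unfolding s_def using x ip_cnj[OF kx] by (intro sum.cong) (auto simp: ip_cnj[OF kx, symmetric])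
    then show ?thesis using ip_Q[OF f kx, of m] f x by simp
  qed
  also have "ip (Q m f) (k x) = ip f (Q m (k x))" by (rule pos_op_sym[OF pos_op_Q f kx])
  finally have "cmod (f x) \<le> cmod s + cmod (ip f (Q m (k x)))" by (simp add: norm_triangle_ineq)
  then have "(cmod (f x))\<^sup>2 \<le> (cmod s + cmod (ip f (Q m (k x))))\<^sup>2" by (rule power_mono) simp
  also have "\<dots> \<le> 2 * (cmod s)\<^sup>2 + 2 * (cmod (ip f (Q m (k x))))\<^sup>2"
    using sum_squares_bound[of "cmod s" "cmod (ip f (Q m (k x)))"] unfolding power2_sum by linarith
  finally have 1: "(cmod (f x))\<^sup>2 \<le> 2 * (cmod s)\<^sup>2 + 2 * (cmod (ip f (Q m (k x))))\<^sup>2" .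
  have 2: "(cmod (ip f (Q m (k x))))\<^sup>2 \<le> q m x * (nrm f)\<^sup>2"
    using cauchy_schwarz_sq[OF f Q_in[OF kx], of m] f by (simp add: q_def nrm_sq mult.commute)
  have N0: "0 \<le> N" unfolding N_def by (rule sum_nonneg) simp
  have "cmod s \<le> (\<Sum>j=1..<m. (sqrt (lam j) * cmod (ip f (e j))) * cmod (eta lam e j x))"
    unfolding s_def
  proof (rule order_trans[OF norm_sum], rule sum_mono)
    fix j assume "j \<in> {1..<m}"
    then have "lam j > 0" by simp
    then show "norm (ip f (e j) * e j x) \<le> (sqrt (lam j) * cmod (ip f (e j))) * cmod (eta lam e j x)"
      by (simp add: eta_def sing_num_def norm_mult norm_divide)
  qed
  then have "(cmod s)\<^sup>2 \<le> (\<Sum>j=1..<m. (sqrt (lam j) * cmod (ip f (e j))) * cmod (eta lam e j x))\<^sup>2"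
    by (rule power_mono) simp
  also have "\<dots> \<le> (\<Sum>j=1..<m. (sqrt (lam j) * cmod (ip f (e j)))\<^sup>2) * N"
    unfolding N_def by (rule Cauchy_Schwarz_ineq_sum)
  also have "(\<Sum>j=1..<m. (sqrt (lam j) * cmod (ip f (e j)))\<^sup>2) = (\<Sum>j=1..<m. lam j * (cmod (ip f (e j)))\<^sup>2)"
    by (intro sum.cong) (auto simp: power_mult_distrib)
  also have "\<dots> * N \<le> Re (l2 f f) * N" using Bessel_l2[OF f] N0 by (rule mult_right_mono)
  finally show ?thesis using 1 2 by (simp add: N_def mult.commute)
qed

lemma ennreal_limit_le:
  fixes a :: "nat \<Rightarrow> real"
  assumes "a \<longlonglongrightarrow> l" "\<And>n. p \<le> n \<Longrightarrow> ennreal (a n) \<le> E" shows "ennreal l \<le> E"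
  using LIMSEQ_le_const2[OF tendsto_ennrealI[OF assms(1)]] assms(2) by blast

text \<open>Only the finite sums \<open>R p - R M\<close> are compared with the extended-real
  series; the limit in \<open>M\<close> is taken on the left.\<close>

lemma R_le_sigma_tail:
  assumes p: "1 \<le> p" "n \<le> p" shows "ennreal (R p) \<le> sigma_tail lam n"
proof (rule ennreal_limit_le[of "\<lambda>M. R p - R M" _ p])
  show "(\<lambda>M. R p - R M) \<longlonglongrightarrow> R p" using tendsto_diff[OF tendsto_const R_tendsto_0] by simp
  fix M assume M: "p \<le> M"
  have "ennreal (R p - R M) = (\<Sum>j=p..<M. ennreal (lam j))"
    using R_split[OF p(1) M] p by (subst sum_ennreal) auto
  also have "\<dots> = (\<Sum>j=p..<M. ennreal ((sing_num lam j)\<^sup>2))"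
    using p by (intro sum.cong) (auto simp: sing_num_def)
  also have "\<dots> \<le> sigma_tail lam n"
    unfolding sigma_tail_def using p by (intro sum_le_infsum_ennreal) auto
  finally show "ennreal (R p - R M) \<le> sigma_tail lam n" .
qed

text \<open>At least half of the numbers up to \<open>i\<close> lie in the block, and each has
  reciprocal at least \<open>1 / i\<close>.\<close>

lemma harmonic_block: assumes "1 \<le> i" shows "1 \<le> 2 * (\<Sum>j | i \<le> 2 * j \<and> j \<le> i. 1 / real j)"
proof -
  define J where "J = {j. i \<le> 2 * j \<and> j \<le> i}"
  have J: "J = {(i + 1) div 2..i}" by (auto simp: J_def)
  have "real i \<le> 2 * real (card J)" unfolding J by simp
  then have "1 \<le> 2 * (real (card J) * (1 / real i))" using assms by (simp add: field_simps)
  also have "real (card J) * (1 / real i) = (\<Sum>j\<in>J. 1 / real i)" by simp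
  also have "\<dots> \<le> (\<Sum>j\<in>J. 1 / real j)"
    using assms by (intro sum_mono divide_left_mono) (auto simp: J_def)
  finally show ?thesis by (simp add: J_def)
qed

text \<open>
  Since \<open>lam\<close> is nonincreasing, \<open>lam i\<close> is at most twice the sum of \<open>lam j / j\<close> over
  \<open>i/2 \<le> j \<le> i\<close>; exchanging the sums, each \<open>j\<close> collects only indices \<open>i \<le> 2 j < 4 j\<close>.
\<close>

lemma q_le_N_sigma_tail:
  assumes x: "x \<in> D" and p: "1 \<le> p" "2 * n \<le> p"
  shows "ennreal (q p x) \<le> 2 * N_sigma_tail D lam e n"
proof (rule ennreal_limit_le[of "\<lambda>M. q p x - q M x" _ p])
  show "(\<lambda>M. q p x - q M x) \<longlonglongrightarrow> q p x" using tendsto_diff[OF tendsto_const q_tendsto_0[OF x]] by simp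
  fix M assume M: "p \<le> M"
  define h where "h i = (cmod (eta lam e i x))\<^sup>2" for i
  have h0: "0 \<le> h i" for i by (simp add: h_def)
  \<comment> \<open>The cut at \<open>M\<close> keeps the sum finite and is harmless since
    \<open>j \<le> i < M\<close>. The bound \<open>n \<le> j\<close> follows from
    \<open>2 * n \<le> p \<le> i \<le> 2 * j\<close>, which is where the factor 2 between
    \<open>n\<close> and \<open>p\<close> comes from.\<close>
  define I where "I = {j. 1 \<le> j \<and> n \<le> j \<and> j < M}"
  have I: "finite I" "I \<subseteq> {k. 1 \<le> k \<and> n \<le> k}" by (auto simp: I_def)
  have "q p x - q M x = (\<Sum>i=p..<M. (cmod (e i x))\<^sup>2)" using q_split[OF x p(1) M] by simp
  also have "\<dots> \<le> (\<Sum>i=p..<M. 2 * (\<Sum>j\<in>I. if i \<le> 2 * j \<and> j \<le> i then lam j * h i / real j else 0))"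
  proof (rule sum_mono)
    fix i assume "i \<in> {p..<M}"
    then have i: "1 \<le> i" "p \<le> i" "i < M" using p by auto
    have "(cmod (e i x))\<^sup>2 = lam i * h i * 1" using i lam_pos[OF i(1)] by (simp add: h_def cmod_eta_sq)
    also have "\<dots> \<le> lam i * h i * (2 * (\<Sum>j | i \<le> 2 * j \<and> j \<le> i. 1 / real j))"
      using i h0 lam_pos[OF i(1)] by (intro mult_left_mono harmonic_block) auto
    also have "\<dots> = 2 * (\<Sum>j | i \<le> 2 * j \<and> j \<le> i. lam i * h i / real j)"
      by (simp add: sum_distrib_left mult_ac)
    also have "\<dots> \<le> 2 * (\<Sum>j | i \<le> 2 * j \<and> j \<le> i. lam j * h i / real j)"
      using i h0 by (intro mult_left_mono sum_mono divide_right_mono mult_right_mono lam_antimono) auto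
    also have "(\<Sum>j | i \<le> 2 * j \<and> j \<le> i. lam j * h i / real j) =
        (\<Sum>j\<in>I \<inter> {j. i \<le> 2 * j \<and> j \<le> i}. lam j * h i / real j)"
      using i p by (intro sum.cong) (auto simp: I_def)
    also have "\<dots> = (\<Sum>j\<in>I. if i \<le> 2 * j \<and> j \<le> i then lam j * h i / real j else 0)"
      using I(1) by (simp add: sum.inter_restrict)
    finally show "(cmod (e i x))\<^sup>2 \<le>
        2 * (\<Sum>j\<in>I. if i \<le> 2 * j \<and> j \<le> i then lam j * h i / real j else 0)" .
  qed
  also have "\<dots> = 2 * (\<Sum>j\<in>I. \<Sum>i=p..<M. if i \<le> 2 * j \<and> j \<le> i then lam j * h i / real j else 0)"
    unfolding sum_distrib_left[symmetric] by (subst sum.swap) simp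
  also have "\<dots> \<le> 2 * (\<Sum>j\<in>I. (\<Sum>i=1..<4 * j. h i) * lam j / real j)"
  proof (intro mult_left_mono sum_mono)
    fix j assume "j \<in> I"
    then have j: "1 \<le> j" by (simp add: I_def)
    have "(\<Sum>i=p..<M. if i \<le> 2 * j \<and> j \<le> i then lam j * h i / real j else 0) =
        (\<Sum>i\<in>{p..<M} \<inter> {i. i \<le> 2 * j \<and> j \<le> i}. lam j * h i / real j)"
      by (simp add: sum.inter_restrict)
    also have "\<dots> \<le> (\<Sum>i=1..<4 * j. lam j * h i / real j)"
      using j lam_pos[OF j] h0 by (intro sum_mono2) auto
    also have "\<dots> = (\<Sum>i=1..<4 * j. h i) * lam j / real j"
      unfolding sum_distrib_right sum_divide_distrib by (simp only: mult.commute)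
    finally show "(\<Sum>i=p..<M. if i \<le> 2 * j \<and> j \<le> i then lam j * h i / real j else 0)
        \<le> (\<Sum>i=1..<4 * j. h i) * lam j / real j" .
  qed simp
  finally have "ennreal (q p x - q M x) \<le> ennreal (2 * (\<Sum>j\<in>I. (\<Sum>i=1..<4 * j. h i) * lam j / real j))"
    by (rule ennreal_leI)
  also have "\<dots> = 2 * (\<Sum>j\<in>I. ennreal ((\<Sum>i=1..<4 * j. h i) * lam j / real j))"
  proof -
    have "0 \<le> (\<Sum>i=1..<4 * j. h i) * lam j / real j" if "j \<in> I" for j
      using that h0 lam_pos[of j] by (intro divide_nonneg_nonneg mult_nonneg_nonneg sum_nonneg) (auto simp: I_def)
    then show ?thesis by (subst sum_ennreal) (auto simp: ennreal_mult sum_nonneg)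
  qed
  also have "\<dots> \<le> 2 * (\<Sum>j\<in>I. N_fun D lam e (4 * j) * ennreal ((sing_num lam j)\<^sup>2) / of_nat j)"
  proof (intro mult_left_mono sum_mono)
    fix j assume "j \<in> I"
    then have j: "1 \<le> j" by (simp add: I_def)
    have s0: "0 \<le> (\<Sum>i=1..<4 * j. h i)" using h0 by (rule sum_nonneg)
    have "ennreal ((\<Sum>i=1..<4 * j. h i) * lam j / real j) =
        ennreal (\<Sum>i=1..<4 * j. h i) * ennreal (lam j) * ennreal (1 / real j)"
      using s0 lam_pos[OF j] by (simp flip: ennreal_mult)
    also have "\<dots> \<le> N_fun D lam e (4 * j) * ennreal (lam j) * ennreal (1 / real j)"
      unfolding N_fun_def h_def by (intro mult_right_mono SUP_upper x) auto
    also have "\<dots> = N_fun D lam e (4 * j) * ennreal ((sing_num lam j)\<^sup>2) / of_nat j"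
      using j lam_pos[OF j] by (simp add: divide_of_nat_ennreal sing_num_def)
    finally show "ennreal ((\<Sum>i=1..<4 * j. h i) * lam j / real j) \<le>
        N_fun D lam e (4 * j) * ennreal ((sing_num lam j)\<^sup>2) / of_nat j" .
  qed simp
  also have "\<dots> \<le> 2 * N_sigma_tail D lam e n"
    unfolding N_sigma_tail_def by (intro mult_left_mono sum_le_infsum_ennreal I) auto
  finally show "ennreal (q p x - q M x) \<le> 2 * N_sigma_tail D lam e n" .
qed

section \<open>Assembly of the two bounds\<close>

text \<open>Keeping \<open>p\<close> apart from \<open>N\<close> and \<open>n\<close> serves both
  parts of the theorem: \<open>p = m\<close> for the first, \<open>p = m div 16\<close> for the
  second. The 4 is the 2 of \<open>pointwise_bound\<close> times the 2 of
  \<open>q_le_N_sigma_tail\<close>.\<close>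

lemma sampling_number_linear:
  assumes p: "1 \<le> p" "16 * p \<le> N" and n: "2 * n \<le> p"
  shows "(sampling_number_linf D H ip N)\<^sup>2 \<le>
    2 * (N_fun D lam e p / of_nat p * sigma_tail lam n) + 4 * N_sigma_tail D lam e n"
proof -
  obtain X where X: "\<And>i. i < 16 * p \<Longrightarrow> X i \<in> D"
    and l2X: "\<And>f. f \<in> H \<Longrightarrow> (\<And>i. i < 16 * p \<Longrightarrow> f (X i) = 0) \<Longrightarrow> Re (l2 f f) \<le> R p / real p * (nrm f)\<^sup>2"
    using sampling_points_l2[OF p(1)] by blast
  \<comment> \<open>Exactly \<open>N\<close> points are required; the surplus ones repeat
    \<open>X 0\<close>.\<close>
  define X' where "X' i = (if i < 16 * p then X i else X 0)" for i
  show ?thesis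
  proof (rule sampling_number_le[of N X'])
    show "X' i \<in> D" if "i < N" for i using X p by (simp add: X'_def)
    fix f x assume f: "f \<in> H" "nrm f \<le> 1" and fX: "\<And>i. i < N \<Longrightarrow> f (X' i) = 0" and x: "x \<in> D"
    have n1: "(nrm f)\<^sup>2 \<le> 1" using f by (simp add: power_le_one)
    have Rp: "0 \<le> R p / real p" using R_nonneg by simp
    have "f (X i) = 0" if "i < 16 * p" for i using fX[of i] that p by (simp add: X'_def)
    then have "Re (l2 f f) \<le> R p / real p * (nrm f)\<^sup>2" using l2X[OF f(1)] by blast
    also have "\<dots> \<le> R p / real p * 1" using n1 Rp by (rule mult_left_mono)
    finally have l2: "Re (l2 f f) \<le> R p / real p" by simp
    define s where "s = (\<Sum>j=1..<p. (cmod (eta lam e j x))\<^sup>2)"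
    have s0: "0 \<le> s" unfolding s_def by (rule sum_nonneg) simp
    have "(cmod (f x))\<^sup>2 \<le> 2 * (s * Re (l2 f f)) + 2 * (q p x * (nrm f)\<^sup>2)"
      unfolding s_def by (rule pointwise_bound[OF f(1) x])
    also have "\<dots> \<le> 2 * (s * (R p / real p)) + 2 * (q p x * 1)"
      using l2 n1 s0 q_nonneg[OF x] by (intro add_mono mult_left_mono) auto
    finally have "ennreal ((cmod (f x))\<^sup>2) \<le> ennreal (2 * (s * (R p / real p)) + 2 * (q p x * 1))"
      by (rule ennreal_leI)
    also have "\<dots> = 2 * (ennreal s * ennreal (1 / real p) * ennreal (R p)) + 2 * ennreal (q p x)"
    proof -
      have "ennreal s * ennreal (1 / real p) * ennreal (R p) = ennreal (s * (R p / real p))"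
        using s0 R_nonneg[of p] by (simp flip: ennreal_mult)
      moreover have "ennreal (2 * z) = 2 * ennreal z" if "0 \<le> z" for z
        using that by (simp add: ennreal_mult)
      ultimately show ?thesis
        using s0 Rp q_nonneg[OF x, of p] by (simp only: ennreal_plus mult_nonneg_nonneg zero_le_numeral mult_1_right)
    qed
    also have "\<dots> \<le> 2 * (N_fun D lam e p * ennreal (1 / real p) * sigma_tail lam n) +
        2 * (2 * N_sigma_tail D lam e n)"
    proof (intro add_mono mult_left_mono mult_mono)
      show "ennreal s \<le> N_fun D lam e p" unfolding s_def N_fun_def by (intro SUP_upper x)
      show "ennreal (R p) \<le> sigma_tail lam n" using p n by (intro R_le_sigma_tail) auto
      show "ennreal (q p x) \<le> 2 * N_sigma_tail D lam e n" using p n by (intro q_le_N_sigma_tail x) auto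
    qed auto
    also have "\<dots> = 2 * (N_fun D lam e p / of_nat p * sigma_tail lam n) + 4 * N_sigma_tail D lam e n"
      using p by (simp add: divide_of_nat_ennreal mult.assoc[symmetric])
    finally show "ennreal ((cmod (f x))\<^sup>2) \<le>
        2 * (N_fun D lam e p / of_nat p * sigma_tail lam n) + 4 * N_sigma_tail D lam e n" .
  qed
qed

text \<open>Covers \<open>m < 32\<close> in the second part, where the tail starts at index 0. Then
  \<open>(cmod (f x))\<^sup>2\<close> is at most \<open>q 1 x\<close>, the diagonal value of the
  kernel, and the full series already bounds it.\<close>

lemma sampling_number_trivial:
  "(sampling_number_linf D H ip N)\<^sup>2 \<le> 2 * N_sigma_tail D lam e 0"
proof -
  obtain x0 where x0: "x0 \<in> D" using nonempty_D by blast
  show ?thesis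
  proof (rule sampling_number_le[of N "\<lambda>_. x0"])
    fix f x assume f: "f \<in> H" "nrm f \<le> 1" and x: "x \<in> D"
    have "(cmod (f x))\<^sup>2 \<le> (nrm f)\<^sup>2 * q 1 x"
      using cauchy_schwarz_sq[OF f(1) k_in[OF x]] f x q_eq[OF x, of 1] by (simp add: nrm_sq)
    also have "\<dots> \<le> 1 * q 1 x"
      using f q_nonneg[OF x] by (intro mult_right_mono) (auto simp: power_le_one)
    finally have "ennreal ((cmod (f x))\<^sup>2) \<le> ennreal (q 1 x)" by (intro ennreal_leI) simp
    also have "\<dots> \<le> 2 * N_sigma_tail D lam e 0" by (rule q_le_N_sigma_tail[OF x]) auto
    finally show "ennreal ((cmod (f x))\<^sup>2) \<le> 2 * N_sigma_tail D lam e 0" .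
  qed (use x0 in simp)
qed

lemma sampling_bound_log:
  assumes m: "2 \<le> m"
  shows "(sampling_number_linf D H ip (nat \<lfloor>32 * real m * ln (real m)\<rfloor>))\<^sup>2
    \<le> ennreal 6 * max (N_fun D lam e m / of_nat m * sigma_tail lam (m div 2))
                       (N_sigma_tail D lam e (m div 2))"
    (is "_ \<le> _ * max ?A ?B")
proof -
  have "ln 2 \<le> ln (real m)" using m by simp
  \<comment> \<open>With \<open>ln m \<ge> 2 / 3\<close>, \<open>32 m ln m\<close> is at least
    \<open>64 m / 3\<close> and exceeds the \<open>16 m\<close> points needed for
    \<open>p = m\<close>; rounding down is harmless because \<open>16 m\<close> is an
    integer.\<close>
  then have "2 / 3 \<le> ln (real m)" using ln2_ge_two_thirds by linarith
  then have "(32 * real m) * (2 / 3) \<le> (32 * real m) * ln (real m)" by (intro mult_left_mono) auto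
  then have "16 * m \<le> nat \<lfloor>32 * real m * ln (real m)\<rfloor>" using m by (intro le_nat_floor) simp
  then have "(sampling_number_linf D H ip (nat \<lfloor>32 * real m * ln (real m)\<rfloor>))\<^sup>2 \<le> 2 * ?A + 4 * ?B"
    using m by (intro sampling_number_linear) auto
  also have "\<dots> \<le> 2 * max ?A ?B + 4 * max ?A ?B" by (intro add_mono mult_left_mono) auto
  also have "\<dots> = ennreal 6 * max ?A ?B" by (simp flip: distrib_right)
  finally show ?thesis .
qed

lemma sampling_bound_linear:
  assumes m: "2 \<le> m"
  shows "(sampling_number_linf D H ip m)\<^sup>2
    \<le> ennreal 132 * max (N_fun D lam e m * ennreal (ln (real m)) / of_nat m
                            * sigma_tail lam (nat \<lfloor>1 / 32 * real m\<rfloor>))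
                         (N_sigma_tail D lam e (nat \<lfloor>1 / 32 * real m\<rfloor>))"
proof -
  have fl: "nat \<lfloor>1 / 32 * real m\<rfloor> = m div 32"
    using floor_divide_of_nat_eq[of m 32, where 'a = real] by simp
  define S where "S = sigma_tail lam (m div 32)"
  define B where "B = N_sigma_tail D lam e (m div 32)"
  define A where "A = N_fun D lam e m * ennreal (ln (real m)) / of_nat m * S"
  have "(sampling_number_linf D H ip m)\<^sup>2 \<le> 128 * A + 4 * B"
  proof (cases "m div 32 = 0")
    case True
    have "(sampling_number_linf D H ip m)\<^sup>2 \<le> 2 * B"
      unfolding B_def True by (rule sampling_number_trivial)
    also have "\<dots> \<le> 4 * B" by (intro mult_right_mono) auto
    also have "\<dots> \<le> 128 * A + 4 * B" by simp
    finally show ?thesis .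
  next
    case False
    \<comment> \<open>The largest \<open>p\<close> with \<open>16 * p \<le> m\<close>. Since
      \<open>p \<ge> 1\<close>, also \<open>m < 16 * (p + 1) \<le> 32 * p\<close>, and
      \<open>2 * (m div 32) \<le> p\<close> is the reason for the constant
      \<open>1 / 32\<close>.\<close>
    define p where "p = m div 16"
    have p: "1 \<le> p" "16 * p \<le> m" "2 * (m div 32) \<le> p" "m \<le> 32 * p" "p \<le> m"
      using False by (auto simp: p_def)
    have "ln 2 \<le> ln (real m)" using m by simp
    then have ln_m: "1 / 2 \<le> ln (real m)" using ln2_ge_two_thirds by linarith
    \<comment> \<open>Passing from \<open>p\<close> to \<open>m\<close> costs 32, and inserting the
      logarithm via \<open>2 * ln m \<ge> 1\<close> doubles this. With the factor 2 in front, 128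
      arises, and \<open>132 = 128 + 4\<close>.\<close>
    have "1 / real p \<le> 64 * (ln (real m) * (1 / real m))"
    proof -
      have "real m \<le> 32 * real p" using p(4) by linarith
      then have "1 / real p \<le> 32 / real m" using p m by (simp add: field_simps)
      also have "\<dots> \<le> 64 * ln (real m) / real m" using ln_m by (intro divide_right_mono) auto
      finally show ?thesis by simp
    qed
    then have "ennreal (1 / real p) \<le> ennreal (64 * (ln (real m) * (1 / real m)))"
      by (rule ennreal_leI)
    also have "\<dots> = ennreal 64 * (ennreal (ln (real m)) * ennreal (1 / real m))"
      using ln_m by (subst ennreal_mult', simp, subst ennreal_mult') auto
    finally have le: "ennreal (1 / real p) \<le> 64 * (ennreal (ln (real m)) * ennreal (1 / real m))"
      by simp
    have "(sampling_number_linf D H ip m)\<^sup>2 \<le> 2 * (N_fun D lam e p / of_nat p * S) + 4 * B"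
      unfolding S_def B_def using p by (intro sampling_number_linear) auto
    also have "N_fun D lam e p / of_nat p * S = N_fun D lam e p * ennreal (1 / real p) * S"
      using p by (simp add: divide_of_nat_ennreal)
    also have "\<dots> \<le> N_fun D lam e m * (64 * (ennreal (ln (real m)) * ennreal (1 / real m))) * S"
      by (intro mult_mono le N_fun_mono p) auto
    also have "\<dots> = 64 * A"
      using m by (simp add: A_def divide_of_nat_ennreal mult_ac)
    finally show ?thesis by (simp add: mult.assoc[symmetric] mult_left_mono add_right_mono)
  qed
  also have "\<dots> \<le> 128 * max A B + 4 * max A B" by (intro add_mono mult_left_mono) auto
  also have "\<dots> = ennreal 132 * max A B" by (simp flip: distrib_right)
  finally show ?thesis unfolding fl A_def B_def S_def .
qed

end

text \<open>Guarantees that there is a point to sample: over an empty \<open>D\<close> the space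
  would be the span of the empty set.\<close>

lemma infinite_dimensional_nonempty:
  assumes "hilbert_function_space D H ip" "infinite_dimensional H" shows "D \<noteq> {}"
proof
  assume "D = {}"
  then have "f x = 0" if "f \<in> H" for f x
    using hilbert_functions.H_outside[OF hilbert_functions.intro[OF assms(1)] that] \<open>D = {}\<close> by simp
  then have "H \<subseteq> {0}" by (auto simp: fun_eq_iff)
  then have "H \<subseteq> cfun.span {}" by simp
  then show False using assms(2) unfolding infinite_dimensional_def by blast
qed

theorem theorem4p2:
  "\<exists>b c3 c4 c5 :: real. b > 0 \<and> c3 > 0 \<and> c4 > 0 \<and> c5 > 0 \<and>
     (\<forall>(d::nat) (D :: (nat \<Rightarrow> real) set) (K :: (nat \<Rightarrow> real) \<Rightarrow> (nat \<Rightarrow> real) \<Rightarrow> complex)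
        (H :: ((nat \<Rightarrow> real) \<Rightarrow> complex) set)
        (ip :: ((nat \<Rightarrow> real) \<Rightarrow> complex) \<Rightarrow> ((nat \<Rightarrow> real) \<Rightarrow> complex) \<Rightarrow> complex)
        (\<rho> :: (nat \<Rightarrow> real) measure)
        (lam :: nat \<Rightarrow> real) (e :: nat \<Rightarrow> (nat \<Rightarrow> real) \<Rightarrow> complex).
        D \<subseteq> topspace (Euclidean_space d) \<longrightarrow> compact D \<longrightarrow>
        continuous_on (D \<times> D) (\<lambda>(x, y). K x y) \<longrightarrow>
        hermitian_pos_def_kernel D K \<longrightarrow>
        bdd_above ((\<lambda>x. sqrt (Re (K x x))) ` D) \<longrightarrow>
        is_rkhs D K H ip \<longrightarrow> infinite_dimensional H \<longrightarrow>
        finite_borel_measure_on D \<rho> \<longrightarrow> full_support D \<rho> \<longrightarrow>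
        spectral_data H ip \<rho> lam e \<longrightarrow>
        (\<forall>m::nat. m \<ge> 2 \<longrightarrow>
           (sampling_number_linf D H ip (nat \<lfloor>b * real m * ln (real m)\<rfloor>))\<^sup>2
             \<le> ennreal c3 * max (N_fun D lam e m / of_nat m * sigma_tail lam (m div 2))
                                (N_sigma_tail D lam e (m div 2))
         \<and> (sampling_number_linf D H ip m)\<^sup>2
             \<le> ennreal c4 * max (N_fun D lam e m * ennreal (ln (real m)) / of_nat m
                                    * sigma_tail lam (nat \<lfloor>c5 * real m\<rfloor>))
                                (N_sigma_tail D lam e (nat \<lfloor>c5 * real m\<rfloor>))))"
proof (rule exI[of _ 32], rule exI[of _ 6], rule exI[of _ 132], rule exI[of _ "1 / 32"],
    intro conjI allI impI)
  fix d :: nat and D :: "(nat \<Rightarrow> real) set" and K H ip \<rho> lam and m :: nat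
    and e :: "nat \<Rightarrow> (nat \<Rightarrow> real) \<Rightarrow> complex"
  assume *: "compact D" "continuous_on (D \<times> D) (\<lambda>(x, y). K x y)" "is_rkhs D K H ip"
    "finite_borel_measure_on D \<rho>" "full_support D \<rho>" "spectral_data H ip \<rho> lam e"
    and inf: "infinite_dimensional H" and m: "2 \<le> m"
  have hfs: "hilbert_function_space D H ip" using *(3) by (simp add: is_rkhs_def)
  interpret rkhs_spectral D H ip K \<rho> lam e
    by unfold_locales (use * hfs infinite_dimensional_nonempty[OF hfs inf] in auto)
  show "(sampling_number_linf D H ip (nat \<lfloor>32 * real m * ln (real m)\<rfloor>))\<^sup>2
    \<le> ennreal 6 * max (N_fun D lam e m / of_nat m * sigma_tail lam (m div 2))
                       (N_sigma_tail D lam e (m div 2))"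
    by (rule sampling_bound_log[OF m])
  show "(sampling_number_linf D H ip m)\<^sup>2
    \<le> ennreal 132 * max (N_fun D lam e m * ennreal (ln (real m)) / of_nat m
                            * sigma_tail lam (nat \<lfloor>1 / 32 * real m\<rfloor>))
                         (N_sigma_tail D lam e (nat \<lfloor>1 / 32 * real m\<rfloor>))"
    by (rule sampling_bound_linear[OF m])
qed simp_all

end
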